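(* Let $N\ge1$, $m\ge1$ be integers. If $f\in L_2(\mathbb{R}^N)$ and $f(x)=0$ for almost every $x$ with $|x|<3$, then for every $r<3$ there exists a constant $c_r$ (independent of $f$) such that $$\int_{|x|\le r}\{E_*f(x)\}^2\,dx\le c_r\int_{|x|\ge3}|f(x)|^2\,dx,$$ where $E_*f(x)=\sup_{\lambda>0}|E_\lambda f(x)|$.
   Context: $\hat f(\xi)=(2\pi)^{-N/2}\int_{\mathbb{R}^N}f(x)e^{-i(x,\xi)}dx$ is the unitary Fourier transform, extended to $L_2$. For $f\in L_2(\mathbb{R}^N)$ and $\lambda>0$, $E_\lambda f(x)=(2\pi)^{-N/2}\int_{|\xi|^{2m}<\lambda}\hat f(\xi)e^{i(x,\xi)}d\xi$ (the spectral expansion of $f$ with respect to the polyharmonic operator $(-\Delta)^m$), which is defined for every $x$. *)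

theory Defs
  imports "HOL-Analysis.Analysis"
begin

definition L2 :: "('a::euclidean_space \<Rightarrow> complex) set" where
  "L2 = {f. f \<in> borel_measurable lebesgue \<and> integrable lebesgue (\<lambda>x. (cmod (f x))\<^sup>2)}"

definition fnorm_const :: "'a::euclidean_space itself \<Rightarrow> real" where
  "fnorm_const _ = (2 * pi) powr (- real DIM('a) / 2)"

definition fourier_trunc :: "('a::euclidean_space \<Rightarrow> complex) \<Rightarrow> real \<Rightarrow> 'a \<Rightarrow> complex" where
  "fourier_trunc f R \<xi> =
     complex_of_real (fnorm_const TYPE('a)) *
       (LINT x : ball 0 R | lebesgue. f x * cis (- (x \<bullet> \<xi>)))"

text \<open>g is the (unitary) L2 Fourier transform of f: the L2 limit of truncated Fourier integrals
  (the standard extension of the Fourier transform from L1 \<inter> L2 to L2).\<close>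
definition is_fourier_L2 :: "('a::euclidean_space \<Rightarrow> complex) \<Rightarrow> ('a \<Rightarrow> complex) \<Rightarrow> bool" where
  "is_fourier_L2 f g \<longleftrightarrow> g \<in> L2 \<and>
     ((\<lambda>R. \<integral>\<^sup>+ \<xi>. ennreal ((cmod (g \<xi> - fourier_trunc f R \<xi>))\<^sup>2) \<partial>lebesgue) \<longlongrightarrow> 0) at_top"

definition fourier_L2 :: "('a::euclidean_space \<Rightarrow> complex) \<Rightarrow> 'a \<Rightarrow> complex" where
  "fourier_L2 f = (SOME g. is_fourier_L2 f g)"

text \<open>Spectral expansion E_lambda f of f w.r.t. the polyharmonic operator (-Delta)^m.\<close>
definition spectral_exp :: "nat \<Rightarrow> real \<Rightarrow> ('a::euclidean_space \<Rightarrow> complex) \<Rightarrow> 'a \<Rightarrow> complex" where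
  "spectral_exp m lam f x =
     complex_of_real (fnorm_const TYPE('a)) *
       (LINT \<xi> : {\<xi>. norm \<xi> ^ (2 * m) < lam} | lebesgue. fourier_L2 f \<xi> * cis (x \<bullet> \<xi>))"

definition spectral_max :: "nat \<Rightarrow> ('a::euclidean_space \<Rightarrow> complex) \<Rightarrow> 'a \<Rightarrow> ennreal" where
  "spectral_max m f x = (SUP lam\<in>{0<..}. ennreal (cmod (spectral_exp m lam f x)))"

end

theory Submission
  imports Defs "HOL-Probability.Probability"
begin

text \<open>
  Write \<open>g\<close> for the Fourier transform of \<open>f\<close> and \<open>G\<^sub>R(x)\<close> for the integral of \<open>g(\<xi>) e\<^bsup>i(x,\<xi>)\<^esup>\<close>
  over \<open>|\<xi>| < R\<close>.

  At integer radii \<open>k\<close>, let \<open>M\<^sub>k\<close> be the indicator of \<open>|\<xi>| < k\<close> convolved with a probability density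
  whose Fourier transform is supported in the ball of radius \<open>3 - r\<close>. As \<open>f\<close> vanishes on
  \<open>|x| < 3\<close>, the multiplier \<open>M\<^sub>k\<close> contributes nothing at \<open>|x| \<le> r\<close>, so \<open>G\<^sub>k\<close> comes from the multiplier
  \<open>1\<^sub>k - M\<^sub>k = O(1 / (1 + (|\<xi>| - k)\<^sup>2))\<close>. Its squares are summable over \<open>k\<close>, and Bessel's inequality
  bounds the sum over \<open>k\<close> of the squared norms of \<open>G\<^sub>k\<close> by a multiple of the squared norm of \<open>g\<close>.

  Between \<open>k\<close> and \<open>k + 1\<close>, functions supported in an annulus of width \<open>\<delta>\<close> have Fourier integrals whose
  squared norm on a fixed ball is \<open>O(\<delta>)\<close> times the squared norm of the function (a trace estimate, proved
  with a Gaussian weight and Schur's test). Cutting the unit annulus into \<open>n\<close> thin ones and using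
  Cauchy-Schwarz, the total variation of \<open>G\<close> over \<open>[k, k + 1]\<close> is bounded in mean square uniformly in \<open>n\<close>.
\<close>

subsection \<open>Gaussians and Fourier integrals\<close>

text \<open>The exponent \<open>m\<close> only reparametrises the radii, so the supremum runs over
  all balls of frequencies. It is uncountable, while a square function controls only separated
  radii: at a fixed frequency the errors are summable because the numbers
  \<open>norm \<xi> - k\<close> spread out. Hence two scales. The vanishing of \<open>f\<close> is
  used only at the integers; between them the restriction to a bounded set of x does the work.
  Localising x at unit scale blurs frequencies at unit scale, and to such a blur an annulus of width
  \<delta> looks like a few slabs of comparable thickness, whatever its radius. This is the source
  of the gain \<delta> and of its uniformity in k.

  The averaging density is the normalised squared modulus of the Fourier integral of a tent
  function: the square makes it nonnegative, the compactly supported autocorrelation of the tent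
  makes it band-limited, and the Lipschitz property gives it a finite second moment, which is the
  price of quadratic decay of the error away from the sphere.\<close>

definition gauss :: "'a::euclidean_space \<Rightarrow> real" where
  "gauss x = exp (- (norm x)\<^sup>2 / 2)"

text \<open>Positive sign and no normalising constant, so that one operator serves both directions:
  up to \<open>fnorm_const\<close>, the forward transform is \<open>fint h (- \<xi>)\<close> and the
  spectral expansion is \<open>fint\<close> of the transform cut off to a ball.\<close>

definition fint :: "('a::euclidean_space \<Rightarrow> complex) \<Rightarrow> 'a \<Rightarrow> complex" where
  "fint h \<xi> = (LINT x|lborel. h x * cis (x \<bullet> \<xi>))"

lemma gauss_nonneg [simp]: "0 \<le> gauss x" and gauss_le_1: "gauss x \<le> 1"
  by (auto simp: gauss_def)

lemma measurable_gauss [measurable]: "gauss \<in> borel_measurable borel"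
  unfolding gauss_def by measurable

lemma measurable_cis [measurable]: "cis \<in> borel_measurable borel"
  by (intro borel_measurable_continuous_onI continuous_on_cis continuous_on_id)

lemma measurable_cnj [measurable]: "cnj \<in> borel_measurable borel"
  by (intro borel_measurable_continuous_onI continuous_on_cnj continuous_on_id)

lemma gauss_prod: "gauss x = (\<Prod>b\<in>Basis. exp (- (x \<bullet> b)\<^sup>2 / 2))"
proof -
  have "(norm x)\<^sup>2 = (\<Sum>b\<in>Basis. (x \<bullet> b)\<^sup>2)"
    unfolding power2_norm_eq_inner by (subst euclidean_inner) (simp add: power2_eq_square)
  then show ?thesis
    by (simp add: gauss_def exp_sum[symmetric] sum_negf sum_divide_distrib)
qed

lemma cis_inner_prod: "cis (x \<bullet> \<xi>) = (\<Prod>b\<in>Basis. cis ((x \<bullet> b) * (\<xi> \<bullet> b)))"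
proof -
  have cis_sum: "cis (\<Sum>b\<in>B. f b) = (\<Prod>b\<in>B. cis (f b))" if "finite B" for f and B :: "'a set"
    using that by (induction B) (auto simp: cis_mult[symmetric])
  show ?thesis
    by (subst euclidean_inner) (simp add: cis_sum)
qed

text \<open>This is the characteristic function of the standard normal law, with the factor
  \<open>1 / sqrt (2 * pi)\<close> of its density cleared.\<close>

lemma gauss_fourier_real:
  fixes t :: real
  shows "integrable lborel (\<lambda>x::real. complex_of_real (exp (- x\<^sup>2 / 2)) * cis (x * t))"
    and "(LINT x|lborel. complex_of_real (exp (- x\<^sup>2 / 2)) * cis (x * t))
         = complex_of_real (sqrt (2 * pi) * exp (- t\<^sup>2 / 2))"
proof -
  have "integrable lborel (\<lambda>x::real. sqrt (2 * pi) * std_normal_density x)"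
    by (intro integrable_mult_right) (simp add: integrable_normal_density)
  then have i: "integrable lborel (\<lambda>x::real. exp (- x\<^sup>2 / 2))"
    by (simp add: normal_density_def)
  show "integrable lborel (\<lambda>x::real. complex_of_real (exp (- x\<^sup>2 / 2)) * cis (x * t))"
    by (rule Bochner_Integration.integrable_bound[OF i]) (auto simp: norm_mult)
  have "char std_normal_distribution t = (LINT x|lborel. std_normal_density x *\<^sub>R iexp (t * x))"
    unfolding char_def by (subst integral_density) auto
  also have "\<dots> = (LINT x|lborel. complex_of_real (1 / sqrt (2 * pi)) * (complex_of_real (exp (- x\<^sup>2 / 2)) * cis (x * t)))"
    by (intro Bochner_Integration.integral_cong)
       (auto simp: normal_density_def cis_conv_exp scaleR_conv_of_real mult_ac)
  also have "\<dots> = complex_of_real (1 / sqrt (2 * pi)) * (LINT x|lborel. complex_of_real (exp (- x\<^sup>2 / 2)) * cis (x * t))"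
    by (rule integral_mult_right_zero)
  finally have "complex_of_real (1 / sqrt (2 * pi)) * (LINT x|lborel. complex_of_real (exp (- x\<^sup>2 / 2)) * cis (x * t))
       = complex_of_real (exp (- (t\<^sup>2) / 2))"
    by (simp add: char_std_normal_distribution)
  then have "complex_of_real (sqrt (2 * pi)) * (complex_of_real (1 / sqrt (2 * pi)) * (LINT x|lborel. complex_of_real (exp (- x\<^sup>2 / 2)) * cis (x * t)))
       = complex_of_real (sqrt (2 * pi) * exp (- (t\<^sup>2) / 2))" 
    by (simp only: of_real_mult)
  then show "(LINT x|lborel. complex_of_real (exp (- x\<^sup>2 / 2)) * cis (x * t))
         = complex_of_real (sqrt (2 * pi) * exp (- t\<^sup>2 / 2))"
    by (simp add: mult.assoc[symmetric] flip: of_real_mult)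
qed

text \<open>Gaussian and character both factor over the coordinates and \<open>lborel\<close> is the
  image of a product measure, so Fubini leaves a product of one-dimensional integrals.\<close>

lemma gauss_fourier:
  fixes \<xi> :: "'a::euclidean_space"
  shows "integrable lborel (\<lambda>x::'a. complex_of_real (gauss x) * cis (x \<bullet> \<xi>))"
    and "(LINT x|lborel. complex_of_real (gauss x) * cis (x \<bullet> \<xi>)) = complex_of_real (sqrt (2 * pi) ^ DIM('a) * gauss \<xi>)"
proof -
  interpret product_sigma_finite "\<lambda>b::'a. lborel :: real measure"
    by standard
  let ?P = "Pi\<^sub>M Basis (\<lambda>b::'a. lborel :: real measure)"
  let ?e = "\<lambda>f. \<Sum>b\<in>Basis. f b *\<^sub>R b :: 'a"
  let ?F = "\<lambda>x::'a. complex_of_real (gauss x) * cis (x \<bullet> \<xi>)"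
  let ?f = "\<lambda>b y. complex_of_real (exp (- y\<^sup>2 / 2)) * cis (y * (\<xi> \<bullet> b))"
  have [measurable]: "?e \<in> measurable ?P borel" by measurable
  have e: "?F (?e f) = (\<Prod>b\<in>Basis. ?f b (f b))" for f
    unfolding gauss_prod cis_inner_prod of_real_prod prod.distrib[symmetric]
    by (intro prod.cong) (auto simp: inner_sum_left inner_Basis if_distrib cong: if_cong)
  have 1: "integrable ?P (\<lambda>f. \<Prod>b\<in>Basis. ?f b (f b))"
    by (rule product_integrable_prod) (simp, rule gauss_fourier_real)
  have 2: "(LINT f|?P. (\<Prod>b\<in>Basis. ?f b (f b))) = (\<Prod>b\<in>Basis. LINT y|lborel. ?f b y)"
    by (rule product_integral_prod) (simp, rule gauss_fourier_real)
  have m: "?F \<in> borel_measurable borel" by measurable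
  show "integrable lborel ?F"
    by (subst lborel_eq, subst integrable_distr_eq) (use m 1 in \<open>auto simp: e\<close>)
  have "(LINT x|lborel. ?F x) = (LINT f|?P. ?F (?e f))"
    by (subst lborel_eq, subst integral_distr) (use m in auto)
  also have "\<dots> = (\<Prod>b\<in>Basis. complex_of_real (sqrt (2 * pi) * exp (- (\<xi> \<bullet> b)\<^sup>2 / 2)))"
    unfolding e 2 gauss_fourier_real ..
  finally show "(LINT x|lborel. ?F x) = complex_of_real (sqrt (2 * pi) ^ DIM('a) * gauss \<xi>)"
    by (simp add: gauss_prod prod.distrib)
qed

lemma integrable_gauss: "integrable lborel (gauss :: 'a::euclidean_space \<Rightarrow> real)"
  using integrable_norm[OF gauss_fourier(1)[of "0::'a"]] by (simp add: norm_mult)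

lemma integral_gauss: "(LINT x|lborel. gauss (x::'a::euclidean_space)) = sqrt (2 * pi) ^ DIM('a)"
proof -
  have "complex_of_real (LINT x|lborel. gauss (x::'a)) = complex_of_real (sqrt (2 * pi) ^ DIM('a))"
    using gauss_fourier(2)[of "0::'a"] by (simp add: gauss_def)
  then show ?thesis unfolding of_real_eq_iff .
qed

section \<open>Scaling, translation and reflection of integrals\<close>

lemma scaled_integral_lborel:
  fixes f :: "'a::euclidean_space \<Rightarrow> 'b::{banach, second_countable_topology}" and s :: real
  assumes s: "s > 0" and [measurable]: "f \<in> borel_measurable borel"
  shows "(LINT x|lborel. f (s *\<^sub>R x)) = (1 / s ^ DIM('a)) *\<^sub>R (LINT x|lborel. f x)"
    and "integrable lborel f \<Longrightarrow> integrable lborel (\<lambda>x. f (s *\<^sub>R x))"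
proof -
  have d: "lborel = density (distr lborel borel (\<lambda>x::'a. 0 + s *\<^sub>R x)) (\<lambda>_. ennreal (\<bar>s\<bar> ^ DIM('a)))"
    using s by (intro lborel_affine) auto
  have sp: "s ^ DIM('a) > 0" using s by simp
  show "(LINT x|lborel. f (s *\<^sub>R x)) = (1 / s ^ DIM('a)) *\<^sub>R (LINT x|lborel. f x)"
    using s by (subst (2) d) (simp add: integral_density integral_distr)
  assume "integrable lborel f"
  then have "integrable lborel (\<lambda>x. s ^ DIM('a) *\<^sub>R f (s *\<^sub>R x))"
    using s by (subst (asm) d) (simp add: integrable_density integrable_distr_eq)
  then have "integrable lborel (\<lambda>x. (1 / s ^ DIM('a)) *\<^sub>R s ^ DIM('a) *\<^sub>R f (s *\<^sub>R x))"
    by (rule integrable_scaleR_right)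
  then show "integrable lborel (\<lambda>x. f (s *\<^sub>R x))"
    using s by simp
qed

lemma gauss_fourier_scaled:
  fixes z :: "'a::euclidean_space" and s :: real
  assumes s: "s > 0"
  shows "integrable lborel (\<lambda>x::'a. gauss (s *\<^sub>R x))"
    and "(LINT x|lborel. complex_of_real (gauss (s *\<^sub>R x)) * cis (x \<bullet> z))
         = complex_of_real (sqrt (2 * pi) ^ DIM('a) / s ^ DIM('a) * gauss ((1 / s) *\<^sub>R z))"
proof -
  show "integrable lborel (\<lambda>x::'a. gauss (s *\<^sub>R x))"
    by (rule scaled_integral_lborel(2)[OF s _ integrable_gauss]) measurable
  have "(LINT x|lborel. complex_of_real (gauss (s *\<^sub>R x)) * cis (x \<bullet> z))
     = (LINT x|lborel. (\<lambda>x. complex_of_real (gauss x) * cis (x \<bullet> ((1 / s) *\<^sub>R z))) (s *\<^sub>R x))"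
    using s by simp
  also have "\<dots> = (1 / s ^ DIM('a)) *\<^sub>R (LINT x|lborel. complex_of_real (gauss x) * cis (x \<bullet> ((1 / s) *\<^sub>R z)))"
    by (rule scaled_integral_lborel(1)[OF s]) measurable
  finally show "(LINT x|lborel. complex_of_real (gauss (s *\<^sub>R x)) * cis (x \<bullet> z))
         = complex_of_real (sqrt (2 * pi) ^ DIM('a) / s ^ DIM('a) * gauss ((1 / s) *\<^sub>R z))"
    unfolding gauss_fourier(2) by (simp add: scaleR_conv_of_real mult_ac)
qed

lemma translated_integral_lborel:
  fixes f :: "'a::euclidean_space \<Rightarrow> 'b::{banach, second_countable_topology}"
  assumes [measurable]: "f \<in> borel_measurable borel"
  shows "(LINT x|lborel. f (x + t)) = (LINT x|lborel. f x)"
    and "integrable lborel f \<Longrightarrow> integrable lborel (\<lambda>x. f (x + t))"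
  by (subst (2) lborel_distr_plus[of t, symmetric], simp add: integral_distr add.commute)
     (subst (asm) lborel_distr_plus[of t, symmetric], simp add: integrable_distr_eq add.commute)

lemma reflected_integral_lborel:
  fixes f :: "'a::euclidean_space \<Rightarrow> 'b::{banach, second_countable_topology}"
  assumes [measurable]: "f \<in> borel_measurable borel"
  shows "(LINT x|lborel. f (t - x)) = (LINT x|lborel. f x)"
    and "integrable lborel f \<Longrightarrow> integrable lborel (\<lambda>x. f (t - x))"
  by (subst (2) lborel_affine[of "-1" t], simp, simp add: integral_distr density_1)
     (subst (asm) lborel_affine[of "-1" t], simp, simp add: integrable_distr_eq density_1)

lemma integral_gauss_scaled:
  assumes s: "s > 0"
  shows "integrable lborel (\<lambda>y::'a::euclidean_space. gauss ((1 / s) *\<^sub>R (x - y)))"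
    and "(LINT y|lborel. gauss ((1 / s) *\<^sub>R (x - y :: 'a))) = s ^ DIM('a) * sqrt (2 * pi) ^ DIM('a)"
proof -
  have s1: "1 / s > 0" using s by simp
  have [measurable]: "(\<lambda>y::'a. gauss ((1 / s) *\<^sub>R y)) \<in> borel_measurable borel" by measurable
  show "integrable lborel (\<lambda>y::'a. gauss ((1 / s) *\<^sub>R (x - y)))"
    by (rule reflected_integral_lborel(2)[OF _ gauss_fourier_scaled(1)[OF s1]]) measurable
  have "(LINT y|lborel. gauss ((1 / s) *\<^sub>R (x - y))) = (LINT y|lborel. gauss ((1 / s) *\<^sub>R y :: 'a))"
    by (rule reflected_integral_lborel(1)) measurable
  also have "\<dots> = s ^ DIM('a) * sqrt (2 * pi) ^ DIM('a)"
    using scaled_integral_lborel(1)[OF s1 measurable_gauss] s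
    by (simp add: integral_gauss power_one_over)
  finally show "(LINT y|lborel. gauss ((1 / s) *\<^sub>R (x - y :: 'a))) = s ^ DIM('a) * sqrt (2 * pi) ^ DIM('a)" .
qed

text \<open>Fatou's lemma in the form used for limits below: a bound uniform in \<open>n\<close>
  survives without a dominating function.\<close>

lemma nn_integral_liminf_le:
  fixes u :: "nat \<Rightarrow> 'a \<Rightarrow> ennreal"
  assumes "\<And>n. u n \<in> borel_measurable M" and B: "\<And>n. (\<integral>\<^sup>+x. u n x \<partial>M) \<le> B"
  shows "(\<integral>\<^sup>+x. liminf (\<lambda>n. u n x) \<partial>M) \<le> B"
proof -
  have "(\<integral>\<^sup>+x. liminf (\<lambda>n. u n x) \<partial>M) \<le> liminf (\<lambda>n. \<integral>\<^sup>+x. u n x \<partial>M)"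
    by (rule nn_integral_liminf[OF assms(1)])
  also have "\<dots> \<le> B"
    by (intro Liminf_le always_eventually allI B) simp_all
  finally show ?thesis .
qed

lemma nn_integral_lim_le:
  fixes u :: "nat \<Rightarrow> 'a \<Rightarrow> ennreal"
  assumes "\<And>n. u n \<in> borel_measurable M" and lim: "\<And>x. (\<lambda>n. u n x) \<longlonglongrightarrow> v x"
    and B: "\<And>n. (\<integral>\<^sup>+x. u n x \<partial>M) \<le> B"
  shows "(\<integral>\<^sup>+x. v x \<partial>M) \<le> B"
  using nn_integral_liminf_le[of u M B, OF assms(1) B] lim_imp_Liminf[OF _ lim] by simp

section \<open>Gaussian-weighted squares of Fourier integrals and Bessel's inequality\<close>

lemma integrable_lborel_product:
  fixes f :: "'a::euclidean_space \<Rightarrow> complex" and g :: "'b::euclidean_space \<Rightarrow> complex"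
  assumes f: "integrable lborel f" and g: "integrable lborel g"
  shows "integrable (lborel \<Otimes>\<^sub>M lborel) (\<lambda>p. f (fst p) * g (snd p))"
proof (rule lborel_pair.Fubini_integrable)
  have [measurable]: "f \<in> borel_measurable borel" "g \<in> borel_measurable borel"
    using borel_measurable_integrable[OF f] borel_measurable_integrable[OF g] by simp_all
  show "(\<lambda>p. f (fst p) * g (snd p)) \<in> borel_measurable (lborel \<Otimes>\<^sub>M lborel)"
    by measurable
  show "integrable lborel (\<lambda>x. LINT y|lborel. norm (f (fst (x, y)) * g (snd (x, y))))"
    using f by (simp add: norm_mult)
  show "AE x in lborel. integrable lborel (\<lambda>y. f (fst (x, y)) * g (snd (x, y)))"
    using g by simp
qed

lemma measurable_fint [measurable]:
  assumes [measurable]: "h \<in> borel_measurable borel"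
  shows "fint h \<in> borel_measurable borel"
  unfolding fint_def by measurable

lemma integrable_mult_cis:
  assumes "integrable lborel h"
  shows "integrable lborel (\<lambda>x. h x * cis (x \<bullet> \<xi>))"
  by (rule Bochner_Integration.integrable_bound[OF assms])
     (use borel_measurable_integrable[OF assms] in \<open>auto simp: norm_mult\<close>)

lemma norm_fint_le:
  assumes "integrable lborel h"
  shows "cmod (fint h \<xi>) \<le> (LINT x|lborel. cmod (h x))"
proof -
  have "cmod (fint h \<xi>) \<le> (LINT x|lborel. cmod (h x * cis (x \<bullet> \<xi>)))"
    unfolding fint_def by (rule integral_norm_bound)
  then show ?thesis by (simp add: norm_mult)
qed

text \<open>The square of \<open>cmod (fint h \<xi>)\<close> is a double integral with phase
  \<open>(x - y) \<bullet> \<xi>\<close>; the Gaussian weight makes everything absolutely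
  convergent, so the integral over \<xi> can be done first and yields a Gaussian in
  \<open>x - y + z\<close>. The case \<open>z = 0\<close> gives norm bounds, general
  \<open>z\<close> locates the support of the transform of the squared modulus.\<close>

lemma fint_gauss_weighted:
  fixes h :: "'a::euclidean_space \<Rightarrow> complex"
  assumes h: "integrable lborel h" and s: "s > 0"
  shows "(LINT \<xi>|lborel. complex_of_real ((cmod (fint h \<xi>))\<^sup>2 * gauss (s *\<^sub>R \<xi>)) * cis (z \<bullet> \<xi>))
    = (LINT p|(lborel \<Otimes>\<^sub>M lborel). h (fst p) * cnj (h (snd p))
          * complex_of_real (sqrt (2 * pi) ^ DIM('a) / s ^ DIM('a) * gauss ((1 / s) *\<^sub>R (fst p - snd p + z))))"
proof -
  have [measurable]: "h \<in> borel_measurable borel"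
    using borel_measurable_integrable[OF h] by simp
  let ?H = "\<lambda>p::'a\<times>'a. h (fst p) * cnj (h (snd p))"
  have ch: "integrable lborel (\<lambda>x. cnj (h x))" using h by simp
  have H: "integrable lborel ?H"
    using integrable_lborel_product[OF h ch] by (simp add: lborel_prod)
  have G: "integrable lborel (\<lambda>\<xi>::'a. complex_of_real (gauss (s *\<^sub>R \<xi>)))"
    using gauss_fourier_scaled(1)[OF s, where 'a = 'a] by simp
  let ?T = "\<lambda>p (\<xi>::'a). ?H p * complex_of_real (gauss (s *\<^sub>R \<xi>)) * cis (\<xi> \<bullet> (fst p - snd p + z))"
  have T: "integrable (lborel \<Otimes>\<^sub>M lborel) (case_prod ?T)"
  proof (rule Bochner_Integration.integrable_bound[OF integrable_lborel_product[OF H G]])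
    show "case_prod ?T \<in> borel_measurable (lborel \<Otimes>\<^sub>M lborel)"
      unfolding lborel_prod[symmetric] by measurable
  qed (simp add: norm_mult split: prod.split)
  have sq: "complex_of_real ((cmod (fint h \<xi>))\<^sup>2 * gauss (s *\<^sub>R \<xi>)) * cis (z \<bullet> \<xi>)
        = (LINT p|lborel. ?T p \<xi>)" for \<xi>
  proof -
    have 1: "integrable lborel (\<lambda>x. h x * cis (x \<bullet> \<xi>))" by (rule integrable_mult_cis[OF h])
    have 2: "integrable lborel (\<lambda>x. cnj (h x * cis (x \<bullet> \<xi>)))" using 1 integrable_cnj by blast
    have "complex_of_real ((cmod (fint h \<xi>))\<^sup>2) = fint h \<xi> * (LINT y|lborel. cnj (h y * cis (y \<bullet> \<xi>)))"
      unfolding complex_norm_square fint_def Bochner_Integration.integral_cnj ..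
    also have "\<dots> = (LINT x|lborel. (LINT y|lborel. (h x * cis (x \<bullet> \<xi>)) * cnj (h y * cis (y \<bullet> \<xi>))))"
      unfolding fint_def by simp
    also have "\<dots> = (LINT p|(lborel \<Otimes>\<^sub>M lborel). (h (fst p) * cis (fst p \<bullet> \<xi>)) * cnj (h (snd p) * cis (snd p \<bullet> \<xi>)))"
      using lborel_pair.integral_fst'[OF integrable_lborel_product[OF 1 2]] by simp
    also have "\<dots> = (LINT p|lborel. ?H p * cis ((fst p - snd p) \<bullet> \<xi>))"
      unfolding lborel_prod
      by (intro Bochner_Integration.integral_cong) 
         (auto simp: cis_cnj inner_diff_left cis_mult cis_divide divide_inverse)
    finally have *: "complex_of_real ((cmod (fint h \<xi>))\<^sup>2) = \<dots>" .
    have "(LINT p|lborel. ?T p \<xi>) = (LINT p|lborel. (?H p * cis ((fst p - snd p) \<bullet> \<xi>)) * (complex_of_real (gauss (s *\<^sub>R \<xi>)) * cis (z \<bullet> \<xi>)))"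
      by (intro Bochner_Integration.integral_cong)
         (auto simp: cis_mult inner_add_left inner_commute[of \<xi>] mult_ac add_ac)
    also have "\<dots> = complex_of_real ((cmod (fint h \<xi>))\<^sup>2) * (complex_of_real (gauss (s *\<^sub>R \<xi>)) * cis (z \<bullet> \<xi>))"
      unfolding * by (rule integral_mult_left_zero)
    finally show ?thesis by (simp add: mult_ac)
  qed
  have "(LINT \<xi>|lborel. complex_of_real ((cmod (fint h \<xi>))\<^sup>2 * gauss (s *\<^sub>R \<xi>)) * cis (z \<bullet> \<xi>))
     = (LINT \<xi>|lborel. (LINT p|lborel. ?T p \<xi>))"
    by (simp only: sq)
  also have "\<dots> = (LINT p|lborel. (LINT \<xi>|lborel. ?T p \<xi>))"
    by (rule lborel_pair.Fubini_integral[OF T])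
  also have "\<dots> = (LINT p|lborel. ?H p * (LINT \<xi>|lborel. complex_of_real (gauss (s *\<^sub>R \<xi>)) * cis (\<xi> \<bullet> (fst p - snd p + z))))"
    by (simp only: mult.assoc integral_mult_right_zero)
  finally show ?thesis
    unfolding gauss_fourier_scaled(2)[OF s] lborel_prod .
qed

text \<open>From \<open>2 * |h x| * |h y| \<le> |h x|^2 + |h y|^2\<close> and the symmetry of
  \<open>K\<close>, each of the two terms contributes half of the bound. The row integrals run only
  over a set \<open>S\<close> carrying \<open>h\<close>: for a thin \<open>S\<close> the constant
  \<open>C\<close> is small, which is where the gain for annuli enters.\<close>

lemma schur_test:
  fixes h :: "'a::euclidean_space \<Rightarrow> complex" and K :: "'a \<Rightarrow> 'a \<Rightarrow> real"
  assumes [measurable]: "h \<in> borel_measurable borel" "case_prod K \<in> borel_measurable (borel \<Otimes>\<^sub>M borel)"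
      "S \<in> sets borel"
    and sym: "\<And>x y. K x y = K y x" and nn: "\<And>x y. 0 \<le> K x y"
    and C: "\<And>x. (\<integral>\<^sup>+y\<in>S. ennreal (K x y) \<partial>lborel) \<le> C"
    and supp: "\<And>x. x \<notin> S \<Longrightarrow> h x = 0"
  shows "(\<integral>\<^sup>+p. ennreal (cmod (h (fst p)) * cmod (h (snd p)) * K (fst p) (snd p)) \<partial>(lborel \<Otimes>\<^sub>M lborel))
     \<le> C * (\<integral>\<^sup>+x. ennreal ((cmod (h x))\<^sup>2) \<partial>lborel)"
proof -
  have [measurable]: "(\<lambda>p. K (fst p) (snd p)) \<in> borel_measurable (borel \<Otimes>\<^sub>M borel)"
    using assms(2) by (simp add: case_prod_unfold)
  have [measurable]: "(\<lambda>y. K x y) \<in> borel_measurable borel" for x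
    using measurable_compose[OF measurable_Pair1'[of x borel borel] assms(2)] by simp
  let ?A = "\<lambda>x y. ennreal ((cmod (h x))\<^sup>2 / 2) * (ennreal (K x y) * indicator S y)"
  have half: "(\<integral>\<^sup>+x. \<integral>\<^sup>+y. ?A x y \<partial>lborel \<partial>lborel) \<le> C * (\<integral>\<^sup>+x. ennreal ((cmod (h x))\<^sup>2 / 2) \<partial>lborel)"
  proof -
    have "(\<integral>\<^sup>+x. \<integral>\<^sup>+y. ?A x y \<partial>lborel \<partial>lborel)
        = (\<integral>\<^sup>+x. ennreal ((cmod (h x))\<^sup>2 / 2) * (\<integral>\<^sup>+y\<in>S. ennreal (K x y) \<partial>lborel) \<partial>lborel)"
      by (subst nn_integral_cmult) auto
    also have "\<dots> \<le> (\<integral>\<^sup>+x. ennreal ((cmod (h x))\<^sup>2 / 2) * C \<partial>lborel)"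
      by (intro nn_integral_mono mult_left_mono C) auto
    also have "\<dots> = (\<integral>\<^sup>+x. ennreal ((cmod (h x))\<^sup>2 / 2) \<partial>lborel) * C"
      by (rule nn_integral_multc) measurable
    finally show ?thesis by (simp add: mult.commute)
  qed
  have "(\<integral>\<^sup>+p. ennreal (cmod (h (fst p)) * cmod (h (snd p)) * K (fst p) (snd p)) \<partial>(lborel \<Otimes>\<^sub>M lborel))
    \<le> (\<integral>\<^sup>+p. ?A (fst p) (snd p) + ?A (snd p) (fst p) \<partial>(lborel \<Otimes>\<^sub>M lborel))"
  proof (rule nn_integral_mono)
    fix p :: "'a \<times> 'a"
    obtain x y where p: "p = (x, y)" by force
    show "ennreal (cmod (h (fst p)) * cmod (h (snd p)) * K (fst p) (snd p)) \<le> ?A (fst p) (snd p) + ?A (snd p) (fst p)"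
    proof (cases "x \<in> S \<and> y \<in> S")
      case True
      have "cmod (h x) * cmod (h y) * K x y \<le> ((cmod (h x))\<^sup>2 / 2 + (cmod (h y))\<^sup>2 / 2) * K x y"
        using sum_squares_bound[of "cmod (h x)" "cmod (h y)"] by (intro mult_right_mono nn) auto
      then have "ennreal (cmod (h x) * cmod (h y) * K x y) \<le> ennreal ((cmod (h x))\<^sup>2 / 2 * K x y + (cmod (h y))\<^sup>2 / 2 * K y x)"
        by (intro ennreal_leI) (simp add: algebra_simps sym[of y x])
      also have "\<dots> = ?A x y + ?A y x"
        using True by (subst ennreal_plus) (auto simp: nn simp flip: ennreal_mult)
      finally show ?thesis by (simp add: p)
    qed (use supp in \<open>auto simp: p\<close>)
  qed
  also have "\<dots> = (\<integral>\<^sup>+p. ?A (fst p) (snd p) \<partial>(lborel \<Otimes>\<^sub>M lborel)) + (\<integral>\<^sup>+p. ?A (snd p) (fst p) \<partial>(lborel \<Otimes>\<^sub>M lborel))"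
    by (rule nn_integral_add) measurable
  also have "(\<integral>\<^sup>+p. ?A (fst p) (snd p) \<partial>(lborel \<Otimes>\<^sub>M lborel)) = (\<integral>\<^sup>+x. \<integral>\<^sup>+y. ?A x y \<partial>lborel \<partial>lborel)"
    by (subst lborel.nn_integral_fst[symmetric]) auto
  also have "(\<integral>\<^sup>+p. ?A (snd p) (fst p) \<partial>(lborel \<Otimes>\<^sub>M lborel)) = (\<integral>\<^sup>+x. \<integral>\<^sup>+y. ?A x y \<partial>lborel \<partial>lborel)"
    by (subst lborel_pair.nn_integral_snd[symmetric]) auto
  also have "\<dots> + \<dots> \<le> C * (\<integral>\<^sup>+x. ennreal ((cmod (h x))\<^sup>2 / 2) \<partial>lborel) + C * (\<integral>\<^sup>+x. ennreal ((cmod (h x))\<^sup>2 / 2) \<partial>lborel)"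
    by (intro add_mono half)
  also have "\<dots> = C * (\<integral>\<^sup>+x. ennreal ((cmod (h x))\<^sup>2) \<partial>lborel)"
    by (subst distrib_left[symmetric], subst nn_integral_add[symmetric]) (auto simp flip: ennreal_plus)
  finally show ?thesis .
qed

text \<open>With \<open>S = UNIV\<close> this leads to Bessel's inequality, with \<open>S\<close> an
  annulus to the trace estimate.\<close>

lemma fint_gauss_weighted_le:
  fixes h :: "'a::euclidean_space \<Rightarrow> complex"
  assumes h: "integrable lborel h" and s: "s > 0" and [measurable]: "S \<in> sets borel"
    and C: "\<And>x. (\<integral>\<^sup>+y\<in>S. ennreal (gauss ((1 / s) *\<^sub>R (x - y))) \<partial>lborel) \<le> C"
    and supp: "\<And>x. x \<notin> S \<Longrightarrow> h x = 0"
  shows "(\<integral>\<^sup>+\<xi>. ennreal ((cmod (fint h \<xi>))\<^sup>2 * gauss (s *\<^sub>R \<xi>)) \<partial>lborel)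
     \<le> ennreal (sqrt (2 * pi) ^ DIM('a) / s ^ DIM('a)) * C * (\<integral>\<^sup>+x. ennreal ((cmod (h x))\<^sup>2) \<partial>lborel)"
proof -
  have [measurable]: "h \<in> borel_measurable borel"
    using borel_measurable_integrable[OF h] by simp
  let ?c = "sqrt (2 * pi) ^ DIM('a) / s ^ DIM('a)"
  have c: "0 \<le> ?c" using s by simp
  define L where "L = (LINT x|lborel. cmod (h x))"
  have L: "0 \<le> L" "\<And>\<xi>. cmod (fint h \<xi>) \<le> L"
    unfolding L_def using norm_fint_le[OF h] by auto
  have "integrable lborel (\<lambda>\<xi>::'a. L\<^sup>2 * gauss (s *\<^sub>R \<xi>))"
    using gauss_fourier_scaled(1)[OF s, where 'a = 'a] by simp
  then have i: "integrable lborel (\<lambda>\<xi>. (cmod (fint h \<xi>))\<^sup>2 * gauss (s *\<^sub>R \<xi>))"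
    by (rule Bochner_Integration.integrable_bound) (auto intro!: mult_right_mono power_mono L)
  let ?H = "\<lambda>p. h (fst p) * cnj (h (snd p)) * complex_of_real (?c * gauss ((1 / s) *\<^sub>R (fst p - snd p)))"
  have ch: "integrable lborel (\<lambda>x. cnj (h x))" using h by simp
  have "integrable (lborel \<Otimes>\<^sub>M lborel) (\<lambda>p. complex_of_real ?c * (h (fst p) * cnj (h (snd p))))"
    by (intro integrable_mult_right integrable_lborel_product h ch)
  then have H: "integrable (lborel \<Otimes>\<^sub>M lborel) ?H"
  proof (rule Bochner_Integration.integrable_bound)
    show "?H \<in> borel_measurable (lborel \<Otimes>\<^sub>M lborel)" by measurable
    have cg: "?c * (a * gauss x) \<le> ?c * a" if "0 \<le> a" for a and x :: 'a
      using that by (intro mult_left_mono[OF _ c]) (simp add: gauss_le_1 mult_left_le)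
    have "norm (?H p) \<le> norm (complex_of_real ?c * (h (fst p) * cnj (h (snd p))))" for p
      using cg[of "cmod (h (fst p)) * cmod (h (snd p))" "(1 / s) *\<^sub>R (fst p - snd p)"]
      unfolding norm_mult norm_of_real abs_mult abs_of_nonneg[OF c] abs_of_nonneg[OF gauss_nonneg] complex_mod_cnj
      by (simp add: mult_ac)
    then show "AE p in lborel \<Otimes>\<^sub>M lborel. norm (?H p) \<le> norm (complex_of_real ?c * (h (fst p) * cnj (h (snd p))))"
      by simp
  qed
  have "complex_of_real (LINT \<xi>|lborel. (cmod (fint h \<xi>))\<^sup>2 * gauss (s *\<^sub>R \<xi>)) = (LINT p|(lborel \<Otimes>\<^sub>M lborel). ?H p)"
    using fint_gauss_weighted[OF h s, of 0]
    by (simp only: inner_zero_left cis_zero mult_1_right add_0_right integral_complex_of_real)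
  note eq = this
  have e: "(LINT \<xi>|lborel. (cmod (fint h \<xi>))\<^sup>2 * gauss (s *\<^sub>R \<xi>)) = norm (LINT p|(lborel \<Otimes>\<^sub>M lborel). ?H p)"
    by (simp only: norm_of_real flip: eq) (intro abs_of_nonneg[symmetric] integral_nonneg, simp)
  have "(\<integral>\<^sup>+\<xi>. ennreal ((cmod (fint h \<xi>))\<^sup>2 * gauss (s *\<^sub>R \<xi>)) \<partial>lborel)
      = ennreal (norm (LINT p|(lborel \<Otimes>\<^sub>M lborel). ?H p))"
    unfolding e[symmetric] by (rule nn_integral_eq_integral[OF i]) simp
  also have "\<dots> \<le> (\<integral>\<^sup>+p. ennreal (norm (?H p)) \<partial>(lborel \<Otimes>\<^sub>M lborel))"
    by (rule integral_norm_bound_ennreal[OF H])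
  also have "\<dots> = (\<integral>\<^sup>+p. ennreal ?c * ennreal (cmod (h (fst p)) * cmod (h (snd p)) * gauss ((1 / s) *\<^sub>R (fst p - snd p))) \<partial>(lborel \<Otimes>\<^sub>M lborel))"
    unfolding norm_mult norm_of_real complex_mod_cnj abs_mult abs_of_nonneg[OF c] abs_of_nonneg[OF gauss_nonneg]
    by (intro nn_integral_cong, subst ennreal_mult[symmetric]) (rule c, simp_all add: mult_ac)
  also have "\<dots> = ennreal ?c * (\<integral>\<^sup>+p. ennreal (cmod (h (fst p)) * cmod (h (snd p)) * gauss ((1 / s) *\<^sub>R (fst p - snd p))) \<partial>(lborel \<Otimes>\<^sub>M lborel))"
    by (rule nn_integral_cmult) measurable
  also have "\<dots> \<le> ennreal ?c * (C * (\<integral>\<^sup>+x. ennreal ((cmod (h x))\<^sup>2) \<partial>lborel))"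
    by (intro mult_left_mono schur_test[where S = S and K = "\<lambda>x y. gauss ((1 / s) *\<^sub>R (x - y))"] C supp)
       (auto simp: gauss_def norm_minus_commute)
  finally show ?thesis by (simp add: mult.assoc)
qed

text \<open>The full row integral of the kernel is \<open>t ^ N * sqrt (2 * pi) ^ N\<close> in
  dimension N, which cancels the prefactor \<open>1 / t ^ N\<close>. The bound is thus independent
  of \<open>t\<close>, and the weight is removed by letting \<open>t\<close> tend to 0.\<close>

lemma fint_bessel:
  fixes h :: "'a::euclidean_space \<Rightarrow> complex"
  assumes h: "integrable lborel h"
  shows "(\<integral>\<^sup>+\<xi>. ennreal ((cmod (fint h \<xi>))\<^sup>2) \<partial>lborel)
     \<le> ennreal ((2 * pi) ^ DIM('a)) * (\<integral>\<^sup>+x. ennreal ((cmod (h x))\<^sup>2) \<partial>lborel)"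
proof -
  have [measurable]: "h \<in> borel_measurable borel"
    using borel_measurable_integrable[OF h] by simp
  let ?B = "ennreal ((2 * pi) ^ DIM('a)) * (\<integral>\<^sup>+x. ennreal ((cmod (h x))\<^sup>2) \<partial>lborel)"
  let ?s = "\<lambda>n. 1 / real (Suc n)"
  have B: "(\<integral>\<^sup>+\<xi>. ennreal ((cmod (fint h \<xi>))\<^sup>2 * gauss (t *\<^sub>R \<xi>)) \<partial>lborel) \<le> ?B" if s: "t > 0" for t
  proof -
    let ?C = "ennreal (t ^ DIM('a) * sqrt (2 * pi) ^ DIM('a))"
    have "(\<integral>\<^sup>+\<xi>. ennreal ((cmod (fint h \<xi>))\<^sup>2 * gauss (t *\<^sub>R \<xi>)) \<partial>lborel)
      \<le> ennreal (sqrt (2 * pi) ^ DIM('a) / t ^ DIM('a)) * ?C * (\<integral>\<^sup>+x. ennreal ((cmod (h x))\<^sup>2) \<partial>lborel)"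
    proof (rule fint_gauss_weighted_le[OF h s, of UNIV])
      show "(\<integral>\<^sup>+y\<in>UNIV. ennreal (gauss ((1 / t) *\<^sub>R (x - y))) \<partial>lborel) \<le> ?C" for x :: 'a
        using nn_integral_eq_integral[OF integral_gauss_scaled(1)[OF s, of x]] integral_gauss_scaled(2)[OF s, of x]
        by (simp only: indicator_UNIV mult_1_right) simp
    qed simp_all
    also have "ennreal (sqrt (2 * pi) ^ DIM('a) / t ^ DIM('a)) * ?C = ennreal ((2 * pi) ^ DIM('a))"
    proof -
      have "sqrt (2 * pi) ^ DIM('a) / t ^ DIM('a) * (t ^ DIM('a) * sqrt (2 * pi) ^ DIM('a)) = sqrt (2 * pi) ^ DIM('a) * sqrt (2 * pi) ^ DIM('a)"
        using s by simp
      also have "\<dots> = (sqrt (2 * pi) * sqrt (2 * pi)) ^ DIM('a)"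
        by (rule power_mult_distrib[symmetric])
      finally show ?thesis
        using s by (subst ennreal_mult[symmetric]) simp_all
    qed
    finally show ?thesis .
  qed
  have lim: "(\<lambda>n. ennreal ((cmod (fint h \<xi>))\<^sup>2 * gauss (?s n *\<^sub>R \<xi>))) \<longlonglongrightarrow> ennreal ((cmod (fint h \<xi>))\<^sup>2)" for \<xi>
  proof -
    have "(\<lambda>n. (cmod (fint h \<xi>))\<^sup>2 * exp (- (norm (?s n *\<^sub>R \<xi>))\<^sup>2 / 2)) \<longlonglongrightarrow> (cmod (fint h \<xi>))\<^sup>2 * exp (- (norm (0 *\<^sub>R \<xi>))\<^sup>2 / 2)"
      by (intro tendsto_intros LIMSEQ_Suc[OF lim_1_over_n]) auto
    then show ?thesis by (simp add: gauss_def)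
  qed
  show ?thesis
    by (rule nn_integral_lim_le[OF _ lim]) (measurable, rule B, simp)
qed

subsection \<open>Restriction to thin annuli\<close>

lemma emeasure_le_of_diameter:
  fixes T :: "real set"
  assumes "\<And>s t. s \<in> T \<Longrightarrow> t \<in> T \<Longrightarrow> \<bar>s - t\<bar> \<le> d" and "0 \<le> d"
  shows "emeasure lborel T \<le> ennreal (2 * d)"
proof (cases "T = {}")
  case False
  then obtain s where "s \<in> T" by auto
  then have "T \<subseteq> {s - d..s + d}" using assms(1) by (fastforce simp: abs_le_iff)
  then have "emeasure lborel T \<le> emeasure lborel {s - d..s + d}" by (intro emeasure_mono) auto
  also have "\<dots> = ennreal (2 * d)" using assms(2) by simp
  finally show ?thesis .
qed simp

text \<open>Along a line in direction \<open>e\<close> the squared norm is quadratic, so the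
  difference of two squared norms is \<open>(s - t) * (u + v)\<close>, with \<open>u\<close>,
  \<open>v\<close> the components along \<open>e\<close>. It is also the difference of the norms, at
  most \<open>b - a\<close>, times their sum, at most \<open>c * (|u| + |v|)\<close>. When
  \<open>u\<close> and \<open>v\<close> have the same sign the common factor cancels.\<close>

lemma annulus_section_diameter:
  fixes y e :: "'a::euclidean_space"
  assumes e: "norm e = 1" and c: "0 \<le> c" and ab: "a \<le> b"
    and 1: "a \<le> norm (y + s *\<^sub>R e)" "norm (y + s *\<^sub>R e) \<le> b" "norm (y + s *\<^sub>R e) \<le> c * \<bar>(y + s *\<^sub>R e) \<bullet> e\<bar>"
    and 2: "a \<le> norm (y + t *\<^sub>R e)" "norm (y + t *\<^sub>R e) \<le> b" "norm (y + t *\<^sub>R e) \<le> c * \<bar>(y + t *\<^sub>R e) \<bullet> e\<bar>"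
    and sgn: "0 \<le> ((y + s *\<^sub>R e) \<bullet> e) * ((y + t *\<^sub>R e) \<bullet> e)"
  shows "\<bar>s - t\<bar> \<le> c * (b - a)"
proof -
  define u v where "u = (y + s *\<^sub>R e) \<bullet> e" and "v = (y + t *\<^sub>R e) \<bullet> e"
  have ee: "e \<bullet> e = 1" using e by (simp add: norm_eq_1)
  have u: "u = y \<bullet> e + s" "v = y \<bullet> e + t" by (simp_all add: u_def v_def inner_add_left ee)
  have uv: "\<bar>u + v\<bar> = \<bar>u\<bar> + \<bar>v\<bar>"
    using sgn unfolding u_def[symmetric] v_def[symmetric] by (auto simp: zero_le_mult_iff)
  let ?p = "norm (y + s *\<^sub>R e)" and ?q = "norm (y + t *\<^sub>R e)"
  have n: "(norm (y + r *\<^sub>R e))\<^sup>2 = (norm y)\<^sup>2 + 2 * r * (y \<bullet> e) + r * r" for r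
    unfolding power2_norm_eq_inner inner_add_left inner_add_right inner_scaleR_left inner_scaleR_right ee
    using inner_commute[of e y] by (simp add: distrib_left)
  have "(?p - ?q) * (?p + ?q) = ?p\<^sup>2 - ?q\<^sup>2"
    by (simp add: power2_eq_square algebra_simps)
  also have "\<dots> = (s - t) * (u + v)"
    unfolding n u by (simp add: algebra_simps)
  finally have "\<bar>s - t\<bar> * \<bar>u + v\<bar> = \<bar>(?p - ?q) * (?p + ?q)\<bar>"
    by (simp only: abs_mult)
  also have "\<dots> = \<bar>?p - ?q\<bar> * (?p + ?q)" by (simp add: abs_mult)
  also have "\<dots> \<le> (b - a) * (c * \<bar>u\<bar> + c * \<bar>v\<bar>)"
    using 1 2 by (intro mult_mono add_mono) (auto simp: u_def v_def ab)
  also have "\<dots> = c * (b - a) * \<bar>u + v\<bar>" by (simp add: uv algebra_simps)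
  finally have *: "\<bar>s - t\<bar> * \<bar>u + v\<bar> \<le> c * (b - a) * \<bar>u + v\<bar>" .
  show ?thesis
  \<comment> \<open>When no division is possible, the equal signs force \<open>u = v = 0\<close>,
    and then \<open>s = t\<close>.\<close>
  proof (cases "u + v = 0")
    case True
    then have "s = t" using uv u by auto
    then show ?thesis using c ab by simp
  qed (use * in \<open>simp add: mult_le_cancel_right\<close>)
qed

text \<open>Pigeonhole on the squared coordinates. It splits space into finitely many sectors, in
  each of which some basis direction crosses the spheres at an angle bounded away from
  tangency.\<close>

lemma ex_Basis_norm_le:
  fixes y :: "'a::euclidean_space"
  shows "\<exists>e\<in>Basis. norm y \<le> sqrt (real DIM('a)) * \<bar>y \<bullet> e\<bar>"
proof (rule ccontr)
  assume "\<not> ?thesis"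
  then have *: "sqrt (real DIM('a)) * \<bar>y \<bullet> e\<bar> < norm y" if "e \<in> Basis" for e using that by force
  have "real DIM('a) * (y \<bullet> e)\<^sup>2 < (norm y)\<^sup>2" if "e \<in> Basis" for e
    using power_strict_mono[OF *[OF that], of 2] by (simp add: power_mult_distrib)
  then have "(\<Sum>e\<in>Basis. real DIM('a) * (y \<bullet> e)\<^sup>2) < (\<Sum>e\<in>(Basis::'a set). (norm y)\<^sup>2)"
    by (intro sum_strict_mono) auto
  moreover have "(norm y)\<^sup>2 = (\<Sum>e\<in>Basis. (y \<bullet> e)\<^sup>2)"
    unfolding power2_norm_eq_inner by (subst euclidean_inner) (simp add: power2_eq_square)
  ultimately show False by (simp add: sum_distrib_left[symmetric])
qed

text \<open>The inequality \<open>(q + 1)^2 \<le> 2 * q^2 + 2\<close> dominates all shifts of length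
  at most 1 by a single wider Gaussian; both the \<open>sqrt 2\<close> and the
  \<open>exp (1/2)\<close> come from it.\<close>

lemma gauss_shift_le:
  fixes v e :: "'a::euclidean_space"
  assumes "norm e = 1" "0 \<le> t" "t \<le> 1"
  shows "gauss (v - t *\<^sub>R e) \<le> exp (1/2) * gauss ((1 / sqrt 2) *\<^sub>R v)"
proof -
  let ?w = "v - t *\<^sub>R e"
  have "norm v \<le> norm ?w + norm (t *\<^sub>R e)" using norm_triangle_ineq[of ?w "t *\<^sub>R e"] by simp
  also have "\<dots> \<le> norm ?w + 1" using assms by simp
  finally have "(norm v)\<^sup>2 \<le> (norm ?w + 1)\<^sup>2" by (intro power_mono) auto
  also have "\<dots> \<le> 2 * (norm ?w)\<^sup>2 + 2"
    using sum_squares_bound[of "norm ?w" 1] by (simp add: power2_sum)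
  finally have "(norm v)\<^sup>2 \<le> 2 * (norm ?w)\<^sup>2 + 2" .
  then show ?thesis
    by (simp add: gauss_def exp_add[symmetric] power_mult_distrib power_divide)
qed

lemma nn_integral_lborel_translate:
  fixes f :: "'a::euclidean_space \<Rightarrow> ennreal"
  assumes [measurable]: "f \<in> borel_measurable borel"
  shows "(\<integral>\<^sup>+x. f (x + t) \<partial>lborel) = (\<integral>\<^sup>+x. f x \<partial>lborel)"
  by (subst (2) lborel_distr_plus[of t, symmetric]) (simp add: nn_integral_distr add.commute)

text \<open>Averaging over the translates by \<^term>\<open>t *\<^sub>R e\<close> with \<^term>\<open>0 \<le> t \<and> t \<le> (1::real)\<close> lets the
  one-dimensional section estimate be used without splitting the space into \<^term>\<open>e\<close> and its complement.\<close>

lemma gauss_annulus_sector: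
  fixes e x :: "'a::euclidean_space"
  assumes e: "e \<in> Basis" and c: "0 \<le> c" and ab: "a \<le> b"
    and A: "A = {y. a \<le> norm y \<and> norm y \<le> b \<and> norm y \<le> c * \<bar>y \<bullet> e\<bar>}"
  shows "(\<integral>\<^sup>+y\<in>A. ennreal (gauss (x - y)) \<partial>lborel)
    \<le> ennreal (4 * c * exp (1/2) * (sqrt 2 ^ DIM('a) * sqrt (2 * pi) ^ DIM('a)) * (b - a))"
proof -
  let ?D = "sqrt 2 ^ DIM('a) * sqrt (2 * pi) ^ DIM('a)"
  have e1: "norm e = 1" using e by simp
  have [measurable]: "A \<in> sets borel" unfolding A by measurable
  let ?w = "\<lambda>y. ennreal (exp (1/2) * gauss ((1 / sqrt 2) *\<^sub>R (x - y)))"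
  let ?I = "\<integral>\<^sup>+y\<in>A. ennreal (gauss (x - y)) \<partial>lborel"
  have I: "?I \<le> (\<integral>\<^sup>+y. ?w y * indicator A (y + t *\<^sub>R e) \<partial>lborel)" if "t \<in> {0..1}" for t
  proof -
    have "?I = (\<integral>\<^sup>+y. ennreal (gauss (x - (y + t *\<^sub>R e))) * indicator A (y + t *\<^sub>R e) \<partial>lborel)"
      by (subst nn_integral_lborel_translate) auto
    also have "\<dots> \<le> (\<integral>\<^sup>+y. ?w y * indicator A (y + t *\<^sub>R e) \<partial>lborel)"
    proof (intro nn_integral_mono mult_right_mono ennreal_leI)
      show "gauss (x - (y + t *\<^sub>R e)) \<le> exp (1/2) * gauss ((1 / sqrt 2) *\<^sub>R (x - y))" for y
        using gauss_shift_le[OF e1, of t "x - y"] that by (simp add: algebra_simps)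
    qed auto
    finally show ?thesis .
  qed
  have sec: "(\<integral>\<^sup>+t. indicator {0..1} t * indicator A (y + t *\<^sub>R e) \<partial>lborel) \<le> ennreal (4 * (c * (b - a)))" for y
  proof -
    \<comment> \<open>The diameter bound compares points on one side of the hyperplane orthogonal to
      \<open>e\<close>, so the section is cut in two. Each half costs a factor 2 for an interval
      centred at an arbitrary point, which makes 4.\<close>
    let ?P = "{t. y + t *\<^sub>R e \<in> A \<and> 0 \<le> (y + t *\<^sub>R e) \<bullet> e}"
    let ?N = "{t. y + t *\<^sub>R e \<in> A \<and> (y + t *\<^sub>R e) \<bullet> e \<le> 0}"
    have [measurable]: "?P \<in> sets borel" "?N \<in> sets borel" by measurable
    have d: "0 \<le> c * (b - a)" using c ab by simp
    have "(\<integral>\<^sup>+t. indicator {0..1} t * indicator A (y + t *\<^sub>R e) \<partial>lborel)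
        \<le> (\<integral>\<^sup>+t. indicator ?P t + indicator ?N t \<partial>lborel)"
      by (intro nn_integral_mono) (auto split: split_indicator)
    also have "\<dots> = emeasure lborel ?P + emeasure lborel ?N"
      by (subst nn_integral_add) auto
    also have "\<dots> \<le> ennreal (2 * (c * (b - a))) + ennreal (2 * (c * (b - a)))"
    proof (rule add_mono)
      show "emeasure lborel ?P \<le> ennreal (2 * (c * (b - a)))"
        by (rule emeasure_le_of_diameter[OF _ d], rule annulus_section_diameter[OF e1 c ab, of y]) (auto simp: A)
      show "emeasure lborel ?N \<le> ennreal (2 * (c * (b - a)))"
        by (rule emeasure_le_of_diameter[OF _ d], rule annulus_section_diameter[OF e1 c ab, of y])
           (auto simp: A intro: mult_nonpos_nonpos)
    qed
    also have "\<dots> = ennreal (4 * (c * (b - a)))"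
      using d by (subst ennreal_plus[symmetric]) auto
    finally show ?thesis .
  qed
  have wi: "(\<integral>\<^sup>+y. ?w y \<partial>lborel) = ennreal (exp (1/2) * ?D)"
  proof -
    have s: "sqrt 2 > 0" by simp
    have "(\<integral>\<^sup>+y. ?w y \<partial>lborel) = ennreal (LINT y|lborel. exp (1/2) * gauss ((1 / sqrt 2) *\<^sub>R (x - y)))"
      by (intro nn_integral_eq_integral integrable_mult_right integral_gauss_scaled(1)[OF s]) auto
    then show ?thesis using integral_gauss_scaled(2)[OF s, of x] by simp
  qed
  have "?I = (\<integral>\<^sup>+t. ?I * indicator {0..1::real} t \<partial>lborel)"
    by (subst nn_integral_cmult) auto
  also have "\<dots> \<le> (\<integral>\<^sup>+t. (\<integral>\<^sup>+y. ?w y * (indicator {0..1} t * indicator A (y + t *\<^sub>R e)) \<partial>lborel) \<partial>lborel)"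
    by (intro nn_integral_mono) (use I in \<open>auto split: split_indicator\<close>)
  \<comment> \<open>After the exchange the weight no longer depends on \<open>t\<close>, and the
    inner integral is the length of a one-dimensional section of the annulus.\<close>
  also have "\<dots> = (\<integral>\<^sup>+y. (\<integral>\<^sup>+t. ?w y * (indicator {0..1} t * indicator A (y + t *\<^sub>R e)) \<partial>lborel) \<partial>lborel)"
    by (rule lborel_pair.Fubini') measurable
  also have "\<dots> = (\<integral>\<^sup>+y. ?w y * (\<integral>\<^sup>+t. indicator {0..1} t * indicator A (y + t *\<^sub>R e) \<partial>lborel) \<partial>lborel)"
    by (subst nn_integral_cmult) auto
  also have "\<dots> \<le> (\<integral>\<^sup>+y. ?w y * ennreal (4 * (c * (b - a))) \<partial>lborel)"
    by (intro nn_integral_mono mult_left_mono sec) auto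
  also have "\<dots> = ennreal (exp (1/2) * ?D) * ennreal (4 * (c * (b - a)))"
    by (subst nn_integral_multc) (auto simp: wi)
  also have "\<dots> = ennreal (4 * c * exp (1/2) * ?D * (b - a))"
  proof -
    have "0 \<le> exp (1/2) * ?D" "0 \<le> 4 * (c * (b - a))" using c ab by simp_all
    note ennreal_mult[OF this, symmetric]
    also have "exp (1/2) * ?D * (4 * (c * (b - a))) = 4 * c * exp (1/2) * ?D * (b - a)"
      by (simp only: mult_ac)
    finally show ?thesis .
  qed
  finally show ?thesis .
qed

text \<open>Half-open, so that consecutive annuli are disjoint and fill the larger one, and
  \<open>annulus 0 R\<close> is the open ball of the spectral expansion.\<close>

definition annulus :: "real \<Rightarrow> real \<Rightarrow> 'a::euclidean_space set" where
  "annulus a b = {y. a \<le> norm y \<and> norm y < b}"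

lemma sets_annulus [measurable]: "annulus a b \<in> sets borel"
  unfolding annulus_def by measurable

text \<open>The annulus is covered by one sector per basis vector, with aperture
  \<open>c = sqrt (real DIM('a))\<close>. The constant depends neither on the centre
  \<open>x\<close> nor on the radius \<open>a\<close>: the Gaussian sees only a unit-size piece, so
  the growing area of the sphere does not matter.\<close>

lemma gauss_annulus_bound:
  obtains C where "0 \<le> C"
    "\<And>a b (x::'a::euclidean_space). a \<le> b \<Longrightarrow>
       (\<integral>\<^sup>+y\<in>annulus a b. ennreal (gauss (x - y)) \<partial>lborel) \<le> ennreal (C * (b - a))"
proof
  define c where "c = sqrt (real DIM('a))"
  define E where "E = 4 * c * exp (1/2) * (sqrt 2 ^ DIM('a) * sqrt (2 * pi) ^ DIM('a))"
  have c: "0 \<le> c" by (simp add: c_def)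
  then have E: "0 \<le> E" by (simp add: E_def)
  then show "0 \<le> real DIM('a) * E" by simp
  fix a b :: real and x :: 'a assume ab: "a \<le> b"
  let ?A = "\<lambda>e::'a. {y. a \<le> norm y \<and> norm y \<le> b \<and> norm y \<le> c * \<bar>y \<bullet> e\<bar>}"
  have "(\<integral>\<^sup>+y\<in>annulus a b. ennreal (gauss (x - y)) \<partial>lborel)
     \<le> (\<integral>\<^sup>+y. (\<Sum>e\<in>Basis. ennreal (gauss (x - y)) * indicator (?A e) y) \<partial>lborel)"
  proof (rule nn_integral_mono)
    fix y :: 'a
    obtain e where e: "e \<in> Basis" "norm y \<le> c * \<bar>y \<bullet> e\<bar>"
      using ex_Basis_norm_le[of y] by (auto simp: c_def)
    have "ennreal (gauss (x - y)) * indicator (annulus a b) y \<le> ennreal (gauss (x - y)) * indicator (?A e) y"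
      using e by (auto split: split_indicator simp: annulus_def)
    also have "\<dots> \<le> (\<Sum>e\<in>Basis. ennreal (gauss (x - y)) * indicator (?A e) y)"
      using e by (intro member_le_sum) auto
    finally show "ennreal (gauss (x - y)) * indicator (annulus a b) y \<le> \<dots>" .
  qed
  also have "\<dots> = (\<Sum>e\<in>Basis. \<integral>\<^sup>+y\<in>?A e. ennreal (gauss (x - y)) \<partial>lborel)"
    by (rule nn_integral_sum) measurable
  also have "\<dots> \<le> (\<Sum>e\<in>(Basis::'a set). ennreal (E * (b - a)))"
    unfolding E_def by (intro sum_mono gauss_annulus_sector c ab) auto
  also have "\<dots> = ennreal (real DIM('a) * E * (b - a))"
    using E ab by (simp add: ennreal_mult ennreal_of_nat_eq_real_of_nat mult.assoc)
  finally show "(\<integral>\<^sup>+y\<in>annulus a b. ennreal (gauss (x - y)) \<partial>lborel) \<le> ennreal (real DIM('a) * E * (b - a))" .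
qed

text \<open>On the ball of radius \<open>r\<close> the Gaussian weight is at least
  \<open>exp (- r^2 / 2)\<close>, so it may be inserted at the cost of a constant; the Schur bound
  over the thin annulus then supplies the factor \<open>b - a\<close>.\<close>

lemma fint_annulus_bound:
  obtains C where "0 \<le> C"
    "\<And>a b (h :: 'a::euclidean_space \<Rightarrow> complex). a \<le> b \<Longrightarrow> integrable lborel h \<Longrightarrow> (\<And>x. x \<notin> annulus a b \<Longrightarrow> h x = 0) \<Longrightarrow>
       (\<integral>\<^sup>+\<xi>\<in>cball 0 r. ennreal ((cmod (fint h \<xi>))\<^sup>2) \<partial>lborel)
         \<le> ennreal (C * (b - a)) * (\<integral>\<^sup>+x. ennreal ((cmod (h x))\<^sup>2) \<partial>lborel)"
proof -
  obtain B where B: "0 \<le> B" "\<And>a b (x::'a). a \<le> b \<Longrightarrow>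
       (\<integral>\<^sup>+y\<in>annulus a b. ennreal (gauss (x - y)) \<partial>lborel) \<le> ennreal (B * (b - a))"
    by (rule gauss_annulus_bound) blast
  define C where "C = exp (r\<^sup>2 / 2) * (sqrt (2 * pi) ^ DIM('a) * B)"
  have "0 \<le> C" using B(1) by (simp add: C_def)
  moreover have "(\<integral>\<^sup>+\<xi>\<in>cball 0 r. ennreal ((cmod (fint h \<xi>))\<^sup>2) \<partial>lborel)
         \<le> ennreal (C * (b - a)) * (\<integral>\<^sup>+x. ennreal ((cmod (h x))\<^sup>2) \<partial>lborel)"
    if ab: "a \<le> b" and h: "integrable lborel h" and supp: "\<And>x. x \<notin> annulus a b \<Longrightarrow> h x = 0"
    for a b and h :: "'a \<Rightarrow> complex"
  proof -
    have [measurable]: "h \<in> borel_measurable borel"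
      using borel_measurable_integrable[OF h] by simp
    have "(\<integral>\<^sup>+\<xi>\<in>cball 0 r. ennreal ((cmod (fint h \<xi>))\<^sup>2) \<partial>lborel)
       \<le> (\<integral>\<^sup>+\<xi>. ennreal (exp (r\<^sup>2 / 2)) * ennreal ((cmod (fint h \<xi>))\<^sup>2 * gauss (1 *\<^sub>R \<xi>)) \<partial>lborel)"
    proof (rule nn_integral_mono)
      fix \<xi> :: 'a
      have "(cmod (fint h \<xi>))\<^sup>2 * 1 \<le> (cmod (fint h \<xi>))\<^sup>2 * (exp (r\<^sup>2 / 2) * gauss \<xi>)" if "norm \<xi> \<le> r"
        using that by (intro mult_left_mono) (auto simp: gauss_def exp_add[symmetric] intro: power_mono)
      then show "ennreal ((cmod (fint h \<xi>))\<^sup>2) * indicator (cball 0 r) \<xi> \<le> ennreal (exp (r\<^sup>2 / 2)) * ennreal ((cmod (fint h \<xi>))\<^sup>2 * gauss (1 *\<^sub>R \<xi>))"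
        by (subst ennreal_mult[symmetric]) (auto split: split_indicator intro!: ennreal_leI simp: mult_ac)
    qed
    also have "\<dots> = ennreal (exp (r\<^sup>2 / 2)) * (\<integral>\<^sup>+\<xi>. ennreal ((cmod (fint h \<xi>))\<^sup>2 * gauss (1 *\<^sub>R \<xi>)) \<partial>lborel)"
      by (rule nn_integral_cmult) measurable
    also have "\<dots> \<le> ennreal (exp (r\<^sup>2 / 2)) * (ennreal (sqrt (2 * pi) ^ DIM('a) / 1 ^ DIM('a)) * ennreal (B * (b - a)) * (\<integral>\<^sup>+x. ennreal ((cmod (h x))\<^sup>2) \<partial>lborel))"
      by (intro mult_left_mono fint_gauss_weighted_le[where S = "annulus a b"] h supp)
         (use B(2)[OF ab] in auto)
    also have "\<dots> = ennreal (C * (b - a)) * (\<integral>\<^sup>+x. ennreal ((cmod (h x))\<^sup>2) \<partial>lborel)"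
      using B(1) ab by (simp add: C_def mult.assoc ennreal_mult)
    finally show ?thesis .
  qed
  ultimately show ?thesis by (rule that)
qed

subsection \<open>A band-limited averaging kernel\<close>

lemma norm_cis_minus_1: "cmod (cis \<theta> - 1) = 2 * \<bar>sin (\<theta> / 2)\<bar>"
proof -
  have "cis (2 * a) - 1 = complex_of_real (2 * sin a) * (\<i> * cis a)" for a
    by (auto simp: complex_eq_iff cos_double_sin sin_double power2_eq_square)
  from this[of "\<theta> / 2"] show ?thesis
    by (simp add: norm_mult)
qed

lemma norm_cis_minus_1_le: "cmod (cis \<theta> - 1) \<le> \<bar>\<theta>\<bar>"
  using abs_sin_x_le_abs_x[of "\<theta> / 2"] by (simp add: norm_cis_minus_1)

lemma fint_translate:
  assumes h: "integrable lborel h"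
  shows "fint (\<lambda>x. h (x + v)) \<xi> = cis (- (v \<bullet> \<xi>)) * fint h \<xi>"
proof -
  have [measurable]: "h \<in> borel_measurable borel"
    using borel_measurable_integrable[OF h] by simp
  have "fint (\<lambda>x. h (x + v)) \<xi> = (LINT x|lborel. (\<lambda>x. cis (- (v \<bullet> \<xi>)) * (h x * cis (x \<bullet> \<xi>))) (x + v))"
    unfolding fint_def
    by (intro Bochner_Integration.integral_cong)
       (auto simp: inner_add_left cis_mult mult.left_commute[of "cis _"])
  also have "\<dots> = (LINT x|lborel. cis (- (v \<bullet> \<xi>)) * (h x * cis (x \<bullet> \<xi>)))"
    by (rule translated_integral_lborel) measurable
  finally show ?thesis by (simp add: fint_def)
qed

lemma fint_diff:
  assumes "integrable lborel f" "integrable lborel g"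
  shows "fint (\<lambda>x. f x - g x) \<xi> = fint f \<xi> - fint g \<xi>"
  unfolding fint_def left_diff_distrib
  by (intro Bochner_Integration.integral_diff integrable_mult_cis assms)

text \<open>Difference quotients replace a derivative: shifting \<open>h\<close> by
  \<open>t *\<^sub>R e\<close> multiplies \<open>fint h\<close> by a phase, so Bessel's inequality
  for the increment of \<open>h\<close> bounds the weight
  \<open>(2 * sin (t * (\<xi> \<bullet> e) / 2) / t)^2\<close>, which tends to
  \<open>(\<xi> \<bullet> e)^2\<close>. The Lipschitz condition bounds the quotients uniformly in
  \<open>t\<close>.\<close>

lemma fint_lipschitz_moment:
  fixes h :: "'a::euclidean_space \<Rightarrow> complex"
  assumes h: "integrable lborel h" and lip: "\<And>x y. cmod (h x - h y) \<le> norm (x - y)"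
    and supp: "\<And>x. \<epsilon> \<le> norm x \<Longrightarrow> h x = 0" and \<epsilon>: "0 < \<epsilon>" and e: "e \<in> Basis"
  shows "(\<integral>\<^sup>+\<xi>. ennreal ((\<xi> \<bullet> e)\<^sup>2 * (cmod (fint h \<xi>))\<^sup>2) \<partial>lborel)
    \<le> ennreal ((2 * pi) ^ DIM('a)) * emeasure lborel (cball (0::'a) (2 * \<epsilon>))"
proof -
  have [measurable]: "h \<in> borel_measurable borel"
    using borel_measurable_integrable[OF h] by simp
  let ?B = "ennreal ((2 * pi) ^ DIM('a)) * emeasure lborel (cball (0::'a) (2 * \<epsilon>))"
  have main: "(\<integral>\<^sup>+\<xi>. ennreal ((2 * sin (t * (\<xi> \<bullet> e) / 2) / t)\<^sup>2 * (cmod (fint h \<xi>))\<^sup>2) \<partial>lborel) \<le> ?B"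
    if t: "0 < t" "t \<le> \<epsilon>" for t
  proof -
    let ?d = "\<lambda>x. h (x + t *\<^sub>R e) - h x"
    have i: "integrable lborel (\<lambda>x. h (x + t *\<^sub>R e))"
      by (rule translated_integral_lborel(2)[OF _ h]) simp
    have d: "integrable lborel ?d" using i h by simp
    have f: "fint ?d \<xi> = (cis (- (t * (\<xi> \<bullet> e))) - 1) * fint h \<xi>" for \<xi>
      using fint_diff[OF i h] fint_translate[OF h, of "t *\<^sub>R e"]
      by (simp add: algebra_simps inner_commute)
    have "(2 * sin (t * (\<xi> \<bullet> e) / 2) / t)\<^sup>2 * (cmod (fint h \<xi>))\<^sup>2 = 1 / t\<^sup>2 * (cmod (fint ?d \<xi>))\<^sup>2" for \<xi>
      unfolding f norm_mult norm_cis_minus_1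
      by (simp add: power_mult_distrib power_divide)
    then have "(\<integral>\<^sup>+\<xi>. ennreal ((2 * sin (t * (\<xi> \<bullet> e) / 2) / t)\<^sup>2 * (cmod (fint h \<xi>))\<^sup>2) \<partial>lborel)
      = (\<integral>\<^sup>+\<xi>. ennreal (1 / t\<^sup>2) * ennreal ((cmod (fint ?d \<xi>))\<^sup>2) \<partial>lborel)"
      by (simp only: ennreal_mult zero_le_power2 zero_le_divide_1_iff)
    also have "\<dots> = ennreal (1 / t\<^sup>2) * (\<integral>\<^sup>+\<xi>. ennreal ((cmod (fint ?d \<xi>))\<^sup>2) \<partial>lborel)"
      by (rule nn_integral_cmult) measurable
    also have "\<dots> \<le> ennreal (1 / t\<^sup>2) * (ennreal ((2 * pi) ^ DIM('a)) * (\<integral>\<^sup>+x. ennreal ((cmod (?d x))\<^sup>2) \<partial>lborel))"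
      by (intro mult_left_mono fint_bessel d) simp
    \<comment> \<open>The shift is at most \<epsilon>, so the increment still lives in the ball of
      radius \<open>2 * \<epsilon>\<close>.\<close>
    also have "(\<integral>\<^sup>+x. ennreal ((cmod (?d x))\<^sup>2) \<partial>lborel) \<le> (\<integral>\<^sup>+x. ennreal (t\<^sup>2) * indicator (cball (0::'a) (2 * \<epsilon>)) x \<partial>lborel)"
    proof (rule nn_integral_mono)
      fix x :: 'a
      have te: "norm (t *\<^sub>R e) = t" using t e by simp
      have "?d x = 0" if "2 * \<epsilon> < norm x"
      proof -
        have "norm x \<le> norm (x + t *\<^sub>R e) + t"
          using norm_triangle_ineq4[of "x + t *\<^sub>R e" "t *\<^sub>R e"] te by simp
        then show ?thesis using that t \<epsilon> by (simp add: supp)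
      qed
      moreover have "(cmod (?d x))\<^sup>2 \<le> t\<^sup>2"
        using lip[of "x + t *\<^sub>R e" x] te by (intro power_mono) auto
      ultimately show "ennreal ((cmod (?d x))\<^sup>2) \<le> ennreal (t\<^sup>2) * indicator (cball (0::'a) (2 * \<epsilon>)) x"
        by (cases "norm x \<le> 2 * \<epsilon>") (auto intro!: ennreal_leI)
    qed
    also have "\<dots> = ennreal (t\<^sup>2) * emeasure lborel (cball (0::'a) (2 * \<epsilon>))"
      by (rule nn_integral_cmult_indicator) simp
    finally have "(\<integral>\<^sup>+\<xi>. ennreal ((2 * sin (t * (\<xi> \<bullet> e) / 2) / t)\<^sup>2 * (cmod (fint h \<xi>))\<^sup>2) \<partial>lborel)
      \<le> ennreal (1 / t\<^sup>2) * (ennreal ((2 * pi) ^ DIM('a)) * (ennreal (t\<^sup>2) * emeasure lborel (cball (0::'a) (2 * \<epsilon>))))"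
      by (simp add: mult_left_mono)
    also have "\<dots> = (ennreal (1 / t\<^sup>2) * ennreal (t\<^sup>2)) * ?B"
      by (simp only: mult_ac)
    also have "ennreal (1 / t\<^sup>2) * ennreal (t\<^sup>2) = 1"
      using t by (subst ennreal_mult[symmetric]) auto
    finally show ?thesis by simp
  qed
  define t where "t n = \<epsilon> / real (Suc n)" for n
  have t: "0 < t n" "t n \<le> \<epsilon>" for n
    using \<epsilon> by (auto simp: t_def field_simps)
  have t0: "t \<longlonglongrightarrow> 0"
    unfolding t_def by (rule LIMSEQ_Suc[OF lim_const_over_n])
  have lim: "(\<lambda>n. ennreal ((2 * sin (t n * (\<xi> \<bullet> e) / 2) / t n)\<^sup>2 * (cmod (fint h \<xi>))\<^sup>2))
     \<longlonglongrightarrow> ennreal ((\<xi> \<bullet> e)\<^sup>2 * (cmod (fint h \<xi>))\<^sup>2)" for \<xi>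
  proof -
    have "((\<lambda>t. 2 * sin (t * (\<xi> \<bullet> e) / 2)) has_field_derivative (\<xi> \<bullet> e)) (at 0)"
      by (auto intro!: derivative_eq_intros)
    then have "((\<lambda>t. 2 * sin (t * (\<xi> \<bullet> e) / 2) / t) \<longlongrightarrow> \<xi> \<bullet> e) (at 0)"
      by (simp add: has_field_derivative_iff)
    moreover have "filterlim t (at 0) sequentially"
      using t0 t(1) by (auto simp: filterlim_at less_imp_neq[symmetric] intro!: always_eventually)
    ultimately have "(\<lambda>n. 2 * sin (t n * (\<xi> \<bullet> e) / 2) / t n) \<longlonglongrightarrow> \<xi> \<bullet> e"
      by (rule filterlim_compose)
    then show ?thesis by (intro tendsto_intros tendsto_ennrealI)
  qed
  show ?thesis
    by (rule nn_integral_lim_le[OF _ lim]) (measurable, rule main[OF t])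
qed

text \<open>The squared modulus transforms to the autocorrelation of \<open>h\<close>, which lives
  in the ball of radius \<open>2 * \<epsilon>\<close>. With the Gaussian regularisation this
  autocorrelation is blurred at a width tending to 0; the remaining margin of \<epsilon> makes the
  blurred value exponentially small, which beats the prefactor.\<close>

lemma fint_square_fourier_vanishes:
  fixes h :: "'a::euclidean_space \<Rightarrow> complex"
  assumes h: "integrable lborel h" and L2: "integrable lborel (\<lambda>\<xi>. (cmod (fint h \<xi>))\<^sup>2)"
    and supp: "\<And>x. \<epsilon> \<le> norm x \<Longrightarrow> h x = 0" and \<epsilon>: "0 < \<epsilon>" and z: "3 * \<epsilon> \<le> norm z"
  shows "(LINT \<xi>|lborel. complex_of_real ((cmod (fint h \<xi>))\<^sup>2) * cis (z \<bullet> \<xi>)) = 0"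
proof -
  have [measurable]: "h \<in> borel_measurable borel"
    using borel_measurable_integrable[OF h] by simp
  let ?s = "\<lambda>n. 1 / real (Suc n)"
  let ?F = "\<lambda>n \<xi>. complex_of_real ((cmod (fint h \<xi>))\<^sup>2 * gauss (?s n *\<^sub>R \<xi>)) * cis (z \<bullet> \<xi>)"
  let ?f = "\<lambda>\<xi>. complex_of_real ((cmod (fint h \<xi>))\<^sup>2) * cis (z \<bullet> \<xi>)"
  have l1: "(\<lambda>n. LINT \<xi>|lborel. ?F n \<xi>) \<longlonglongrightarrow> (LINT \<xi>|lborel. ?f \<xi>)"
  proof (rule integral_dominated_convergence[OF _ _ L2])
    show "AE \<xi> in lborel. (\<lambda>n. ?F n \<xi>) \<longlonglongrightarrow> ?f \<xi>"
    proof (rule AE_I2)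
      fix \<xi> :: 'a
      have "(\<lambda>n. complex_of_real ((cmod (fint h \<xi>))\<^sup>2 * exp (- (norm (?s n *\<^sub>R \<xi>))\<^sup>2 / 2)) * cis (z \<bullet> \<xi>))
         \<longlonglongrightarrow> complex_of_real ((cmod (fint h \<xi>))\<^sup>2 * exp (- (norm (0 *\<^sub>R \<xi>))\<^sup>2 / 2)) * cis (z \<bullet> \<xi>)"
        by (intro tendsto_intros LIMSEQ_Suc[OF lim_1_over_n]) auto
      then show "(\<lambda>n. ?F n \<xi>) \<longlonglongrightarrow> ?f \<xi>" by (simp add: gauss_def)
    qed
    show "AE \<xi> in lborel. norm (?F n \<xi>) \<le> (cmod (fint h \<xi>))\<^sup>2" for n
      unfolding norm_mult norm_cis norm_of_real abs_mult abs_of_nonneg[OF gauss_nonneg]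
      by (intro AE_I2) (simp add: mult_left_le gauss_le_1 del: of_nat_Suc)
  qed measurable
  define H where "H p = h (fst p) * cnj (h (snd p))" for p
  have ch: "integrable lborel (\<lambda>x. cnj (h x))" using h by simp
  have H: "integrable (lborel \<Otimes>\<^sub>M lborel) H"
    unfolding H_def by (rule integrable_lborel_product[OF h ch])
  \<comment> \<open>The width is \<open>1 / Suc n\<close>, so the prefactor grows like a power of
    \<open>Suc n\<close>. The Gaussian exponent is weakened from the square of \<open>Suc n\<close>
    to its first power, to match the standard limit of a power over an exponential.\<close>
  define c where "c n = sqrt (2 * pi) ^ DIM('a) * (real (Suc n) ^ DIM('a) * exp (- (\<epsilon>\<^sup>2 / 2) * real (Suc n)))" for n
  have c0: "0 \<le> c n" for n by (simp add: c_def)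
  have bound: "norm (LINT \<xi>|lborel. ?F n \<xi>) \<le> (LINT p|(lborel \<Otimes>\<^sub>M lborel). c n * norm (H p))" for n
  proof -
    have s: "?s n > 0" by simp
    let ?k = "\<lambda>p. sqrt (2 * pi) ^ DIM('a) / ?s n ^ DIM('a) * gauss ((1 / ?s n) *\<^sub>R (fst p - snd p + z))"
    have k: "norm (H p * complex_of_real (?k p)) \<le> c n * norm (H p)" for p
    proof (cases "norm (fst p) < \<epsilon> \<and> norm (snd p) < \<epsilon>")
      case True
      have "norm z \<le> norm (fst p - snd p + z) + (norm (fst p) + norm (snd p))"
        using norm_triangle_ineq4[of "fst p - snd p + z" "fst p - snd p"] norm_triangle_ineq4[of "fst p" "snd p"] by simp
      then have "\<epsilon> \<le> norm (fst p - snd p + z)" using True z by simp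
      then have q: "\<epsilon>\<^sup>2 \<le> (norm (fst p - snd p + z))\<^sup>2" using \<epsilon> by (intro power_mono) auto
      have "\<epsilon>\<^sup>2 * real (Suc n) \<le> (norm (fst p - snd p + z))\<^sup>2 * (real (Suc n))\<^sup>2"
        by (intro mult_mono q) (auto simp: power2_eq_square)
      then have g: "gauss ((1 / ?s n) *\<^sub>R (fst p - snd p + z)) \<le> exp (- (\<epsilon>\<^sup>2 / 2) * real (Suc n))"
        by (simp add: gauss_def power_mult_distrib mult.commute del: of_nat_Suc)
      have "?k p = sqrt (2 * pi) ^ DIM('a) * (real (Suc n) ^ DIM('a) * gauss ((1 / ?s n) *\<^sub>R (fst p - snd p + z)))"
        by (simp add: power_one_over del: of_nat_Suc)
      also have "\<dots> \<le> c n"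
        unfolding c_def by (intro mult_left_mono g) auto
      finally have "?k p \<le> c n" .
      moreover have "0 \<le> ?k p" by (intro mult_nonneg_nonneg divide_nonneg_nonneg) auto
      ultimately show ?thesis
        unfolding norm_mult norm_of_real by (subst mult.commute) (intro mult_right_mono, auto)
    next
      case False
      then have "H p = 0" using supp[of "fst p"] supp[of "snd p"] by (auto simp: H_def not_less)
      then show ?thesis by simp
    qed
    have "(LINT \<xi>|lborel. ?F n \<xi>) = (LINT p|(lborel \<Otimes>\<^sub>M lborel). H p * complex_of_real (?k p))"
      using fint_gauss_weighted[OF h s, of z] unfolding H_def .
    then have "norm (LINT \<xi>|lborel. ?F n \<xi>) \<le> (LINT p|(lborel \<Otimes>\<^sub>M lborel). norm (H p * complex_of_real (?k p)))"
      by (simp only: integral_norm_bound)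
    also have "\<dots> \<le> (LINT p|(lborel \<Otimes>\<^sub>M lborel). c n * norm (H p))"
    proof (rule integral_mono)
      have cH: "integrable (lborel \<Otimes>\<^sub>M lborel) (\<lambda>p. c n * norm (H p))"
        using H by simp
      show "integrable (lborel \<Otimes>\<^sub>M lborel) (\<lambda>p. c n * norm (H p))" by (rule cH)
      show "integrable (lborel \<Otimes>\<^sub>M lborel) (\<lambda>p. norm (H p * complex_of_real (?k p)))"
      proof (rule Bochner_Integration.integrable_bound[OF cH])
        show "(\<lambda>p. norm (H p * complex_of_real (?k p))) \<in> borel_measurable (lborel \<Otimes>\<^sub>M lborel)"
          unfolding H_def by measurable
        show "AE p in lborel \<Otimes>\<^sub>M lborel. norm (norm (H p * complex_of_real (?k p))) \<le> norm (c n * norm (H p))"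
          using order_trans[OF k abs_ge_self] by (intro AE_I2) (simp only: real_norm_def abs_norm_cancel)
      qed
    qed (rule k)
    finally show ?thesis .
  qed
  have c: "c \<longlonglongrightarrow> 0"
  proof -
    let ?a = "\<epsilon>\<^sup>2 / 2"
    have a: "?a > 0" using \<epsilon> by simp
    have 1: "((\<lambda>x. x ^ DIM('a) / exp x) \<longlongrightarrow> (0::real)) at_top"
      by (rule tendsto_power_div_exp_0)
    have 2: "filterlim (\<lambda>n. ?a * real (Suc n)) at_top sequentially"
      by (intro filterlim_tendsto_pos_mult_at_top[OF tendsto_const a] filterlim_compose[OF filterlim_real_sequentially filterlim_Suc])
    have lim: "(\<lambda>n. sqrt (2 * pi) ^ DIM('a) * ((1 / ?a) ^ DIM('a) * ((?a * real (Suc n)) ^ DIM('a) / exp (?a * real (Suc n)))))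
      \<longlonglongrightarrow> sqrt (2 * pi) ^ DIM('a) * ((1 / ?a) ^ DIM('a) * 0)"
      by (intro tendsto_mult tendsto_const filterlim_compose[OF 1 2])
    have eq: "(1 / b) ^ k * ((b * x) ^ k / exp (b * x)) = x ^ k * exp (- b * x)" if "b > 0" for b x :: real and k
      using that by (simp add: power_mult_distrib power_one_over exp_minus field_simps)
    show ?thesis
      using lim unfolding c_def by (simp only: eq[OF a] mult_zero_right)
  qed
  have "(\<lambda>n. LINT \<xi>|lborel. ?F n \<xi>) \<longlonglongrightarrow> 0"
  proof (rule Lim_null_comparison[OF always_eventually])
    show "\<forall>n. norm (LINT \<xi>|lborel. ?F n \<xi>) \<le> c n * (LINT p|(lborel \<Otimes>\<^sub>M lborel). norm (H p))"
      using bound by simp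
    show "(\<lambda>n. c n * (LINT p|(lborel \<Otimes>\<^sub>M lborel). norm (H p))) \<longlonglongrightarrow> 0"
      by (rule tendsto_mult_left_zero[OF c])
  qed
  with l1 show ?thesis by (rule LIMSEQ_unique)
qed

text \<open>The kernel is the normalised squared modulus of \<open>fint\<close> of the tent
  \<open>max 0 (\<epsilon> - norm x)\<close>. Bessel's inequality makes it integrable, and adding
  the Lipschitz moment bound over all basis directions gives the second moment.\<close>

lemma band_limited_kernel:
  fixes \<epsilon> :: real
  assumes \<epsilon>: "0 < \<epsilon>"
  obtains \<Phi> :: "'a::euclidean_space \<Rightarrow> real" where
    "\<Phi> \<in> borel_measurable borel" "\<And>x. 0 \<le> \<Phi> x" "integrable lborel \<Phi>" "(LINT x|lborel. \<Phi> x) = 1"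
    "integrable lborel (\<lambda>x. (norm x)\<^sup>2 * \<Phi> x)"
    "\<And>z. 3 * \<epsilon> \<le> norm z \<Longrightarrow> (LINT x|lborel. complex_of_real (\<Phi> x) * cis (z \<bullet> x)) = 0"
proof -
  define k :: "'a \<Rightarrow> real" where "k x = max 0 (\<epsilon> - norm x)" for x
  have k0: "0 \<le> k x" "k x \<le> \<epsilon>" for x using \<epsilon> by (auto simp: k_def)
  have ks: "k x = 0" if "\<epsilon> \<le> norm x" for x using that by (simp add: k_def)
  have [measurable]: "k \<in> borel_measurable borel" unfolding k_def by measurable
  have ib: "integrable lborel (\<lambda>x::'a. c * indicator (ball 0 d) x :: real)" for c d
    using emeasure_bounded_finite[OF bounded_ball, of "0::'a" d]
    by (intro integrable_mult_right integrable_real_indicator) (auto simp: top.not_eq_extremum)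
  have ki: "integrable lborel k"
    by (rule Bochner_Integration.integrable_bound[OF ib[of \<epsilon> \<epsilon>]])
       (use k0 ks in \<open>auto simp: k_def indicator_def\<close>)
  have k2i: "integrable lborel (\<lambda>x. (k x)\<^sup>2)"
    by (rule Bochner_Integration.integrable_bound[OF ib[of "\<epsilon>\<^sup>2" \<epsilon>]])
       (use k0 ks in \<open>auto simp: indicator_def intro!: power_mono\<close>)
  define h where "h x = complex_of_real (k x)" for x
  have h: "integrable lborel h" unfolding h_def using ki by simp
  have [measurable]: "h \<in> borel_measurable borel" unfolding h_def by measurable
  have lip: "cmod (h x - h y) \<le> norm (x - y)" for x y
  proof -
    have "\<bar>k x - k y\<bar> \<le> \<bar>norm x - norm y\<bar>" by (auto simp: k_def)
    also have "\<dots> \<le> norm (x - y)" by (rule norm_triangle_ineq3)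
    finally show ?thesis by (simp add: h_def flip: of_real_diff)
  qed
  have supp: "h x = 0" if "\<epsilon> \<le> norm x" for x using ks[OF that] by (simp add: h_def)
  define \<Psi> where "\<Psi> \<xi> = (cmod (fint h \<xi>))\<^sup>2" for \<xi>
  have [measurable]: "\<Psi> \<in> borel_measurable borel" unfolding \<Psi>_def by measurable
  have \<Psi>0: "0 \<le> \<Psi> \<xi>" for \<xi> by (simp add: \<Psi>_def)
  have "(\<integral>\<^sup>+x. ennreal ((cmod (h x))\<^sup>2) \<partial>lborel) < \<infinity>"
    using k2i by (simp add: h_def integrable_iff_bounded)
  then have "(\<integral>\<^sup>+\<xi>. ennreal (\<Psi> \<xi>) \<partial>lborel) < \<infinity>"
    unfolding \<Psi>_def by (intro le_less_trans[OF fint_bessel[OF h]]) (simp add: ennreal_mult_less_top)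
  then have \<Psi>i: "integrable lborel \<Psi>"
    by (intro integrableI_bounded) (auto simp: \<Psi>0)
  have mom: "integrable lborel (\<lambda>x. (norm x)\<^sup>2 * \<Psi> x)"
  proof (rule integrableI_bounded)
    have n2: "(norm x)\<^sup>2 = (\<Sum>e\<in>Basis. (x \<bullet> e)\<^sup>2)" for x :: 'a
      unfolding power2_norm_eq_inner by (subst euclidean_inner) (simp add: power2_eq_square)
    have "(\<integral>\<^sup>+x. ennreal (norm ((norm x)\<^sup>2 * \<Psi> x)) \<partial>lborel) = (\<integral>\<^sup>+x. (\<Sum>e\<in>Basis. ennreal ((x \<bullet> e)\<^sup>2 * \<Psi> x)) \<partial>lborel)"
      by (intro nn_integral_cong) (simp add: n2 \<Psi>0 sum_distrib_right sum_nonneg)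
    also have "\<dots> = (\<Sum>e\<in>Basis. \<integral>\<^sup>+x. ennreal ((x \<bullet> e)\<^sup>2 * \<Psi> x) \<partial>lborel)"
      by (rule nn_integral_sum) measurable
    also have "\<dots> \<le> (\<Sum>e\<in>(Basis::'a set). ennreal ((2 * pi) ^ DIM('a)) * emeasure lborel (cball (0::'a) (2 * \<epsilon>)))"
      unfolding \<Psi>_def by (intro sum_mono fint_lipschitz_moment[OF h lip supp \<epsilon>])
    also have "\<dots> < \<infinity>"
      using emeasure_bounded_finite[OF bounded_cball, of "0::'a" "2 * \<epsilon>"]
      by (simp add: ennreal_mult_less_top of_nat_less_top)
    finally show "(\<integral>\<^sup>+x. ennreal (norm ((norm x)\<^sup>2 * \<Psi> x)) \<partial>lborel) < \<infinity>" .
  qed measurable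
  have van: "(LINT x|lborel. complex_of_real (\<Psi> x) * cis (z \<bullet> x)) = 0" if "3 * \<epsilon> \<le> norm z" for z
    unfolding \<Psi>_def using fint_square_fourier_vanishes[OF h \<Psi>i[unfolded \<Psi>_def] supp \<epsilon> that] .
  have posball: "0 < measure lborel (ball (0::'a) d)" if "0 < d" for d
    using that by (rule content_ball_pos)
  \<comment> \<open>Normalising requires a nonzero total mass. At the origin \<open>fint h\<close>
    equals the integral \<open>K\<close> of the tent, and it stays at least \<open>K / 2\<close> in
    modulus on a small ball.\<close>
  have "0 < (LINT x|lborel. \<Psi> x)"
  proof -
    define K where "K = (LINT x|lborel. k x)"
    have "0 < (LINT x|lborel. (\<epsilon> / 2) * indicator (ball (0::'a) (\<epsilon> / 2)) x)"
      using posball[of "\<epsilon> / 2"] \<epsilon> by simp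
    also have "\<dots> \<le> K"
      unfolding K_def by (intro integral_mono ib ki) (use \<epsilon> in \<open>auto simp: k_def indicator_def\<close>)
    finally have K: "0 < K" .
    \<comment> \<open>For \<open>norm \<xi> < \<delta>\<close> and x in the support of the tent the
      phase is at most \<open>\<epsilon> * \<delta> = 1 / 2\<close>, so \<open>fint h \<xi>\<close>
      differs from \<open>K\<close> by at most \<open>K / 2\<close>.\<close>
    define \<delta> where "\<delta> = 1 / (2 * \<epsilon>)"
    have \<delta>: "0 < \<delta>" using \<epsilon> by (simp add: \<delta>_def)
    have low: "(K / 2)\<^sup>2 \<le> \<Psi> \<xi>" if "norm \<xi> < \<delta>" for \<xi>
    proof -
      have 1: "integrable lborel (\<lambda>x. h x * cis (x \<bullet> \<xi>))" by (rule integrable_mult_cis[OF h])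
      have hK: "(LINT x|lborel. h x) = complex_of_real K"
        unfolding h_def K_def by (rule integral_complex_of_real)
      have "fint h \<xi> - complex_of_real K = (LINT x|lborel. h x * cis (x \<bullet> \<xi>) - h x)"
        unfolding fint_def by (subst Bochner_Integration.integral_diff[OF 1 h]) (simp add: hK)
      then have "cmod (fint h \<xi> - complex_of_real K) \<le> (LINT x|lborel. cmod (h x * cis (x \<bullet> \<xi>) - h x))"
        by simp
      also have "\<dots> \<le> (LINT x|lborel. k x * (1 / 2))"
      proof (rule integral_mono)
        show "integrable lborel (\<lambda>x. cmod (h x * cis (x \<bullet> \<xi>) - h x))" using 1 h by simp
        show "integrable lborel (\<lambda>x. k x * (1 / 2))" using ki by simp
        fix x :: 'a
        show "cmod (h x * cis (x \<bullet> \<xi>) - h x) \<le> k x * (1 / 2)"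
        proof (cases "norm x < \<epsilon>")
          case True
          have "cmod (cis (x \<bullet> \<xi>) - 1) \<le> \<bar>x \<bullet> \<xi>\<bar>" by (rule norm_cis_minus_1_le)
          also have "\<dots> \<le> norm x * norm \<xi>" by (rule Cauchy_Schwarz_ineq2)
          also have "\<dots> \<le> \<epsilon> * \<delta>" using True that \<epsilon> by (intro mult_mono) auto
          also have "\<dots> = 1 / 2" using \<epsilon> by (simp add: \<delta>_def)
          finally have "k x * cmod (cis (x \<bullet> \<xi>) - 1) \<le> k x * (1 / 2)" using k0 by (intro mult_left_mono)
          moreover have "h x * cis (x \<bullet> \<xi>) - h x = complex_of_real (k x) * (cis (x \<bullet> \<xi>) - 1)"
            by (simp add: h_def algebra_simps)
          ultimately show ?thesis using k0 by (simp add: norm_mult)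
        qed (use supp ks in auto)
      qed
      also have "\<dots> = K / 2" by (simp add: K_def)
      finally have "K / 2 \<le> cmod (fint h \<xi>)"
        using norm_triangle_ineq2[of "complex_of_real K" "fint h \<xi>"] K by (simp add: norm_minus_commute)
      then show ?thesis unfolding \<Psi>_def using K by (intro power_mono) auto
    qed
    have "0 < (LINT x|lborel. (K / 2)\<^sup>2 * indicator (ball (0::'a) \<delta>) x)"
      using posball[OF \<delta>] K by simp
    also have "\<dots> \<le> (LINT x|lborel. \<Psi> x)"
      by (intro integral_mono ib \<Psi>i) (use low \<Psi>0 in \<open>auto simp: indicator_def\<close>)
    finally show ?thesis .
  qed
  note pos = this
  define c where "c = (LINT x|lborel. \<Psi> x)"
  show ?thesis
  proof (rule that[of "\<lambda>x. \<Psi> x / c"])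
    show "integrable lborel (\<lambda>x. (norm x)\<^sup>2 * (\<Psi> x / c))"
      using mom by simp
    show "(LINT x|lborel. complex_of_real (\<Psi> x / c) * cis (z \<bullet> x)) = 0" if "3 * \<epsilon> \<le> norm z" for z
      using van[OF that] by simp
  qed (use pos \<Psi>0 \<Psi>i in \<open>auto simp: c_def\<close>)
qed

text \<open>Chebyshev's argument: a shift \<zeta> contributes only if the step from \<xi> to
  \<open>\<xi> - \<zeta>\<close> crosses the sphere of radius \<open>R\<close>, and then
  \<open>norm \<zeta>\<close> is at least the distance \<open>|norm \<xi> - R|\<close>. The factor
  \<open>1 + (norm \<xi> - R)^2\<close> is thus absorbed by \<open>1 + (norm \<zeta>)^2\<close>
  under the integral.\<close>

lemma norm_conv_indicator_le:
  fixes \<Phi> :: "'a::euclidean_space \<Rightarrow> real"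
  assumes [measurable]: "\<Phi> \<in> borel_measurable borel" and \<Phi>0: "\<And>x. 0 \<le> \<Phi> x" and \<Phi>: "integrable lborel \<Phi>"
    and 1: "(LINT x|lborel. \<Phi> x) = 1" and mom: "integrable lborel (\<lambda>x. (norm x)\<^sup>2 * \<Phi> x)"
  shows "\<bar>indicator (ball 0 R) \<xi> - (LINT \<zeta>|lborel. indicator (ball 0 R) (\<xi> - \<zeta>) * \<Phi> \<zeta>)\<bar> * (1 + (norm \<xi> - R)\<^sup>2)
     \<le> 1 + (LINT x|lborel. (norm x)\<^sup>2 * \<Phi> x)"
proof -
  let ?d = "1 + (norm \<xi> - R)\<^sup>2"
  let ?i = "indicator (ball 0 R) :: 'a \<Rightarrow> real"
  have i1: "integrable lborel (\<lambda>\<zeta>. ?i (\<xi> - \<zeta>) * \<Phi> \<zeta>)"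
    by (rule Bochner_Integration.integrable_bound[OF \<Phi>]) (auto simp: indicator_def)
  have i2: "integrable lborel (\<lambda>\<zeta>. (?i \<xi> - ?i (\<xi> - \<zeta>)) * \<Phi> \<zeta> * ?d)"
    using i1 \<Phi> by (simp add: left_diff_distrib)
  have "(LINT \<zeta>|lborel. (?i \<xi> - ?i (\<xi> - \<zeta>)) * \<Phi> \<zeta> * ?d) = (LINT \<zeta>|lborel. (?i \<xi> - ?i (\<xi> - \<zeta>)) * \<Phi> \<zeta>) * ?d"
    by (rule integral_mult_left_zero)
  also have "\<dots> = (?i \<xi> - (LINT \<zeta>|lborel. ?i (\<xi> - \<zeta>) * \<Phi> \<zeta>)) * ?d"
    using i1 \<Phi> 1 by (simp add: left_diff_distrib[of _ _ "\<Phi> _"])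
  finally have eq: "(LINT \<zeta>|lborel. (?i \<xi> - ?i (\<xi> - \<zeta>)) * \<Phi> \<zeta> * ?d) = (?i \<xi> - (LINT \<zeta>|lborel. ?i (\<xi> - \<zeta>) * \<Phi> \<zeta>)) * ?d" .
  have d0: "0 \<le> ?d" by simp
  have "\<bar>?i \<xi> - (LINT \<zeta>|lborel. ?i (\<xi> - \<zeta>) * \<Phi> \<zeta>)\<bar> * ?d = \<bar>LINT \<zeta>|lborel. (?i \<xi> - ?i (\<xi> - \<zeta>)) * \<Phi> \<zeta> * ?d\<bar>"
    by (simp only: eq abs_mult abs_of_nonneg[OF d0])
  also have "\<dots> \<le> (LINT \<zeta>|lborel. \<bar>(?i \<xi> - ?i (\<xi> - \<zeta>)) * \<Phi> \<zeta> * ?d\<bar>)"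
    by (rule integral_abs_bound)
  also have "\<dots> \<le> (LINT \<zeta>|lborel. \<Phi> \<zeta> + (norm \<zeta>)\<^sup>2 * \<Phi> \<zeta>)"
  proof (rule integral_mono)
    show "integrable lborel (\<lambda>\<zeta>. \<bar>(?i \<xi> - ?i (\<xi> - \<zeta>)) * \<Phi> \<zeta> * ?d\<bar>)" using i2 by (rule integrable_abs)
    show "integrable lborel (\<lambda>\<zeta>. \<Phi> \<zeta> + (norm \<zeta>)\<^sup>2 * \<Phi> \<zeta>)" using \<Phi> mom by simp
    fix \<zeta> :: 'a
    show "\<bar>(?i \<xi> - ?i (\<xi> - \<zeta>)) * \<Phi> \<zeta> * ?d\<bar> \<le> \<Phi> \<zeta> + (norm \<zeta>)\<^sup>2 * \<Phi> \<zeta>"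
    proof (cases "?i \<xi> = ?i (\<xi> - \<zeta>)")
      case False
      then have "\<bar>norm \<xi> - R\<bar> \<le> \<bar>norm \<xi> - norm (\<xi> - \<zeta>)\<bar>"
        by (cases "norm \<xi> < R"; cases "norm (\<xi> - \<zeta>) < R") (auto simp: indicator_def)
      also have "\<dots> \<le> norm \<zeta>" using norm_triangle_ineq3[of \<xi> "\<xi> - \<zeta>"] by simp
      finally have "(norm \<xi> - R)\<^sup>2 \<le> (norm \<zeta>)\<^sup>2"
        using abs_le_square_iff[of "norm \<xi> - R" "norm \<zeta>"] by simp
      then have "\<Phi> \<zeta> * ?d \<le> \<Phi> \<zeta> * (1 + (norm \<zeta>)\<^sup>2)" by (intro mult_left_mono \<Phi>0) auto
      moreover have "\<bar>(?i \<xi> - ?i (\<xi> - \<zeta>)) * \<Phi> \<zeta> * ?d\<bar> = \<Phi> \<zeta> * ?d"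
        using False \<Phi>0 by (cases "norm \<xi> < R"; cases "norm (\<xi> - \<zeta>) < R") (auto simp: indicator_def abs_mult)
      ultimately show ?thesis by (simp add: algebra_simps)
    qed (simp add: \<Phi>0)
  qed
  also have "\<dots> = 1 + (LINT x|lborel. (norm x)\<^sup>2 * \<Phi> x)" using \<Phi> mom 1 by simp
  finally show ?thesis .
qed

text \<open>The transform of a convolution is a product, so \<open>M R\<close> inherits the band
  limit of the density for every \<open>R\<close>, while averaging an indicator against a
  probability density keeps the values in [0, 1]. The constant \<open>B\<close> is common to all
  radii.\<close>

lemma smoothed_ball_indicators:
  assumes \<epsilon>: "0 < \<epsilon>"
  obtains M :: "real \<Rightarrow> 'a::euclidean_space \<Rightarrow> real" and B :: real where
    "0 \<le> B" "\<And>R. M R \<in> borel_measurable borel" "\<And>R. integrable lborel (M R)"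
    "\<And>R \<xi>. 0 \<le> M R \<xi>" "\<And>R \<xi>. M R \<xi> \<le> 1"
    "\<And>R \<xi>. \<bar>indicator (ball 0 R) \<xi> - M R \<xi>\<bar> * (1 + (norm \<xi> - R)\<^sup>2) \<le> B"
    "\<And>R z. 3 * \<epsilon> \<le> norm z \<Longrightarrow> (LINT \<xi>|lborel. complex_of_real (M R \<xi>) * cis (z \<bullet> \<xi>)) = 0"
proof -
  obtain \<Phi> :: "'a \<Rightarrow> real" where [measurable]: "\<Phi> \<in> borel_measurable borel" and \<Phi>0: "\<And>x. 0 \<le> \<Phi> x"
    and \<Phi>: "integrable lborel \<Phi>" and \<Phi>1: "(LINT x|lborel. \<Phi> x) = 1"
    and mom: "integrable lborel (\<lambda>x. (norm x)\<^sup>2 * \<Phi> x)"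
    and van: "\<And>z. 3 * \<epsilon> \<le> norm z \<Longrightarrow> (LINT x|lborel. complex_of_real (\<Phi> x) * cis (z \<bullet> x)) = 0"
    by (rule band_limited_kernel[OF \<epsilon>, where 'a = 'a]) blast
  let ?i = "\<lambda>R. indicator (ball 0 R) :: 'a \<Rightarrow> real"
  have [measurable]: "ball (0::'a) R \<in> sets borel" for R by simp
  define M where "M R \<xi> = (LINT \<zeta>|lborel. ?i R (\<xi> - \<zeta>) * \<Phi> \<zeta>)" for R \<xi>
  have i1: "integrable lborel (\<lambda>\<zeta>. ?i R (\<xi> - \<zeta>) * \<Phi> \<zeta>)" for R \<xi>
    by (rule Bochner_Integration.integrable_bound[OF \<Phi>]) (auto simp: indicator_def)
  have ii: "integrable lborel (?i R)" for R
    using emeasure_bounded_finite[OF bounded_ball, of "0::'a" R]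
    by (intro integrable_real_indicator) (auto simp: top.not_eq_extremum)
  have it: "integrable lborel (\<lambda>\<xi>. ?i R (\<xi> - \<zeta>))"
    and it': "(LINT \<xi>|lborel. ?i R (\<xi> - \<zeta>)) = (LINT \<xi>|lborel. ?i R \<xi>)" for R \<zeta>
    using translated_integral_lborel[of "?i R" "- \<zeta>"] ii[of R] by simp_all
  have pair: "integrable (lborel \<Otimes>\<^sub>M lborel) (\<lambda>(\<zeta>, \<xi>). ?i R (\<xi> - \<zeta>) * \<Phi> \<zeta>)" for R
  proof (rule lborel_pair.Fubini_integrable)
    show "(\<lambda>(\<zeta>, \<xi>). ?i R (\<xi> - \<zeta>) * \<Phi> \<zeta>) \<in> borel_measurable (lborel \<Otimes>\<^sub>M lborel)"
      by measurable
    have "integrable lborel (\<lambda>\<zeta>. (LINT \<xi>|lborel. ?i R \<xi>) * \<Phi> \<zeta>)"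
      using \<Phi> by simp
    moreover have "(LINT \<xi>|lborel. norm (?i R (\<xi> - \<zeta>) * \<Phi> \<zeta>)) = (LINT \<xi>|lborel. ?i R \<xi>) * \<Phi> \<zeta>" for \<zeta>
      using \<Phi>0 by (simp add: abs_mult it' del: integral_indicator)
    ultimately show "integrable lborel (\<lambda>\<zeta>. LINT \<xi>|lborel. norm (case (\<zeta>, \<xi>) of (\<zeta>, \<xi>) \<Rightarrow> ?i R (\<xi> - \<zeta>) * \<Phi> \<zeta>))"
      by simp
    show "AE \<zeta> in lborel. integrable lborel (\<lambda>\<xi>. case (\<zeta>, \<xi>) of (\<zeta>, \<xi>) \<Rightarrow> ?i R (\<xi> - \<zeta>) * \<Phi> \<zeta>)"
      using it by simp
  qed
  show ?thesis
  proof (rule that[of "1 + (LINT x|lborel. (norm x)\<^sup>2 * \<Phi> x)" M])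
    show "0 \<le> 1 + (LINT x|lborel. (norm x)\<^sup>2 * \<Phi> x)"
      by (intro add_nonneg_nonneg Bochner_Integration.integral_nonneg) (auto simp: \<Phi>0)
    show "M R \<in> borel_measurable borel" for R
      unfolding M_def by measurable
    show "integrable lborel (M R)" for R
      unfolding M_def using lborel_pair.integrable_snd[OF pair[of R]] by simp
    show "0 \<le> M R \<xi>" for R \<xi>
      unfolding M_def by (intro Bochner_Integration.integral_nonneg) (auto simp: \<Phi>0)
    show "M R \<xi> \<le> 1" for R \<xi>
      unfolding M_def \<Phi>1[symmetric] by (intro integral_mono i1 \<Phi>) (auto simp: indicator_def \<Phi>0)
    show "\<bar>indicator (ball 0 R) \<xi> - M R \<xi>\<bar> * (1 + (norm \<xi> - R)\<^sup>2) \<le> 1 + (LINT x|lborel. (norm x)\<^sup>2 * \<Phi> x)" for R \<xi>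
      unfolding M_def by (intro norm_conv_indicator_le \<Phi>0 \<Phi> \<Phi>1 mom) measurable
    fix R and z :: 'a assume z: "3 * \<epsilon> \<le> norm z"
    let ?T = "\<lambda>\<zeta> \<xi>. complex_of_real (?i R (\<xi> - \<zeta>) * \<Phi> \<zeta>) * cis (z \<bullet> \<xi>)"
    have T: "integrable (lborel \<Otimes>\<^sub>M lborel) (case_prod ?T)"
      by (rule Bochner_Integration.integrable_bound[OF pair[of R]])
         (auto simp: norm_mult split: prod.split)
    have "(LINT \<xi>|lborel. complex_of_real (M R \<xi>) * cis (z \<bullet> \<xi>)) = (LINT \<xi>|lborel. LINT \<zeta>|lborel. ?T \<zeta> \<xi>)"
      unfolding M_def integral_mult_left_zero integral_complex_of_real ..
    also have "\<dots> = (LINT \<zeta>|lborel. LINT \<xi>|lborel. ?T \<zeta> \<xi>)"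
      by (rule lborel_pair.Fubini_integral[OF T])
    also have "\<dots> = (LINT \<zeta>|lborel. complex_of_real (\<Phi> \<zeta>) * cis (z \<bullet> \<zeta>) * (LINT \<xi>|lborel. complex_of_real (?i R \<xi>) * cis (z \<bullet> \<xi>)))"
    proof (rule Bochner_Integration.integral_cong[OF refl])
      fix \<zeta> :: 'a
      let ?g = "\<lambda>\<xi>. complex_of_real (\<Phi> \<zeta>) * cis (z \<bullet> \<zeta>) * (complex_of_real (?i R \<xi>) * cis (z \<bullet> \<xi>))"
      \<comment> \<open>Translating \<xi> by \<zeta> frees the indicator from \<zeta> and splits the
        phase into two factors.\<close>
      have "(LINT \<xi>|lborel. ?T \<zeta> \<xi>) = (LINT \<xi>|lborel. ?g (\<xi> + - \<zeta>))"
        by (intro Bochner_Integration.integral_cong)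
           (simp_all add: inner_diff_right cis_mult mult_ac)
      also have "\<dots> = (LINT \<xi>|lborel. ?g \<xi>)"
        by (rule translated_integral_lborel) measurable
      finally show "(LINT \<xi>|lborel. ?T \<zeta> \<xi>) = complex_of_real (\<Phi> \<zeta>) * cis (z \<bullet> \<zeta>) * (LINT \<xi>|lborel. complex_of_real (?i R \<xi>) * cis (z \<bullet> \<xi>))"
        by (simp only: integral_mult_right_zero)
    qed
    also have "\<dots> = 0"
      by (simp only: integral_mult_left_zero van[OF z] mult_zero_left)
    finally show "(LINT \<xi>|lborel. complex_of_real (M R \<xi>) * cis (z \<bullet> \<xi>)) = 0" .
  qed
qed

subsection \<open>The Fourier transform on square-integrable functions\<close>

lemma fnorm_const_sq: "(fnorm_const TYPE('a::euclidean_space))\<^sup>2 * (2 * pi) ^ DIM('a) = 1"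
proof -
  have "(fnorm_const TYPE('a))\<^sup>2 = (2 * pi) powr (- real DIM('a))"
    by (simp add: fnorm_const_def power2_eq_square flip: powr_add)
  also have "\<dots> = inverse ((2 * pi) ^ DIM('a))"
    by (simp only: powr_minus) (simp add: powr_realpow)
  finally have c: "(fnorm_const TYPE('a))\<^sup>2 = inverse ((2 * pi) ^ DIM('a))" .
  show ?thesis unfolding c by (rule left_inverse) simp
qed

lemma fourier_trunc_fint:
  fixes f :: "'a::euclidean_space \<Rightarrow> complex"
  assumes [measurable]: "f \<in> borel_measurable borel"
  shows "fourier_trunc f R \<xi> = complex_of_real (fnorm_const TYPE('a)) * fint (\<lambda>x. indicator (ball 0 R) x *\<^sub>R f x) (- \<xi>)"
proof -
  have [measurable]: "ball (0::'a) R \<in> sets borel" by simp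
  have "(LINT x : ball 0 R | lebesgue. f x * cis (- (x \<bullet> \<xi>))) = (LINT x|lborel. indicator (ball 0 R) x *\<^sub>R (f x * cis (- (x \<bullet> \<xi>))))"
    unfolding set_lebesgue_integral_def by (rule integral_completion) measurable
  then show ?thesis by (simp add: fourier_trunc_def fint_def)
qed

lemma nn_integral_lborel_reflect:
  fixes f :: "'a::euclidean_space \<Rightarrow> ennreal"
  assumes [measurable]: "f \<in> borel_measurable borel"
  shows "(\<integral>\<^sup>+x. f (- x) \<partial>lborel) = (\<integral>\<^sup>+x. f x \<partial>lborel)"
  by (subst (2) lborel_affine[of "-1" 0], simp, simp add: nn_integral_distr density_1)

lemma fint_unitary_le:
  fixes h :: "'a::euclidean_space \<Rightarrow> complex"
  assumes h: "integrable lborel h"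
  shows "(\<integral>\<^sup>+\<xi>. ennreal ((cmod (complex_of_real (fnorm_const TYPE('a)) * fint h (- \<xi>)))\<^sup>2) \<partial>lborel)
     \<le> (\<integral>\<^sup>+x. ennreal ((cmod (h x))\<^sup>2) \<partial>lborel)"
proof -
  have [measurable]: "h \<in> borel_measurable borel"
    using borel_measurable_integrable[OF h] by simp
  let ?c = "ennreal ((fnorm_const TYPE('a))\<^sup>2)"
  have "(\<integral>\<^sup>+\<xi>. ennreal ((cmod (complex_of_real (fnorm_const TYPE('a)) * fint h (- \<xi>)))\<^sup>2) \<partial>lborel)
      = (\<integral>\<^sup>+\<xi>. ?c * ennreal ((cmod (fint h (- \<xi>)))\<^sup>2) \<partial>lborel)"
    by (simp add: norm_mult power_mult_distrib ennreal_mult)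
  also have "\<dots> = ?c * (\<integral>\<^sup>+\<xi>. ennreal ((cmod (fint h (- \<xi>)))\<^sup>2) \<partial>lborel)"
    by (rule nn_integral_cmult) measurable
  also have "\<dots> = ?c * (\<integral>\<^sup>+\<xi>. ennreal ((cmod (fint h \<xi>))\<^sup>2) \<partial>lborel)"
    by (subst nn_integral_lborel_reflect[of "\<lambda>\<xi>. ennreal ((cmod (fint h \<xi>))\<^sup>2)"]) auto
  also have "\<dots> \<le> ?c * (ennreal ((2 * pi) ^ DIM('a)) * (\<integral>\<^sup>+x. ennreal ((cmod (h x))\<^sup>2) \<partial>lborel))"
    by (intro mult_left_mono fint_bessel h) simp
  also have "\<dots> = ennreal ((fnorm_const TYPE('a))\<^sup>2 * (2 * pi) ^ DIM('a)) * (\<integral>\<^sup>+x. ennreal ((cmod (h x))\<^sup>2) \<partial>lborel)"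
    by (subst ennreal_mult) (auto simp: mult.assoc)
  finally show ?thesis unfolding fnorm_const_sq by simp
qed

lemma integrable_restrict_L2:
  fixes f :: "'a::euclidean_space \<Rightarrow> complex"
  assumes [measurable]: "f \<in> borel_measurable borel" "S \<in> sets borel"
    and f: "(\<integral>\<^sup>+x. ennreal ((cmod (f x))\<^sup>2) \<partial>lborel) < \<infinity>" and S: "bounded S"
  shows "integrable lborel (\<lambda>x. indicator S x *\<^sub>R f x)"
proof (rule Bochner_Integration.integrable_bound)
  have "emeasure lborel S < \<infinity>" using emeasure_bounded_finite[OF S] by simp
  then show "integrable lborel (\<lambda>x. indicator S x + (cmod (f x))\<^sup>2 :: real)"
    using f by (intro Bochner_Integration.integrable_add integrable_real_indicator) (auto simp: integrable_iff_bounded)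
  have "a \<le> 1 + a\<^sup>2" for a :: real
    using sum_squares_bound[of 1 a] zero_le_power2[of a] by (cases "0 \<le> a") (auto intro: order_trans[of a 0])
  then show "AE x in lborel. norm (indicator S x *\<^sub>R f x) \<le> norm (indicator S x + (cmod (f x))\<^sup>2 :: real)"
    by (auto simp: indicator_def)
qed measurable

lemma tail_tendsto_0:
  fixes f :: "'a::euclidean_space \<Rightarrow> complex"
  assumes [measurable]: "f \<in> borel_measurable borel"
    and f: "(\<integral>\<^sup>+x. ennreal ((cmod (f x))\<^sup>2) \<partial>lborel) < \<infinity>"
  shows "((\<lambda>T. \<integral>\<^sup>+x\<in>- ball 0 T. ennreal ((cmod (f x))\<^sup>2) \<partial>lborel) \<longlongrightarrow> 0) at_top"
proof (rule tendsto_at_topI_sequentially)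
  fix X :: "nat \<Rightarrow> real" assume X: "filterlim X at_top sequentially"
  have [measurable]: "- ball (0::'a) T \<in> sets borel" for T by simp
  have "(\<lambda>n. \<integral>\<^sup>+x. ennreal ((cmod (f x))\<^sup>2) * indicator (- ball 0 (X n)) x \<partial>lborel) \<longlonglongrightarrow> (\<integral>\<^sup>+x. 0 \<partial>(lborel :: 'a measure))"
  proof (rule nn_integral_dominated_convergence[where w = "\<lambda>x. ennreal ((cmod (f x))\<^sup>2)"])
    show "AE x in lborel. (\<lambda>n. ennreal ((cmod (f x))\<^sup>2) * indicator (- ball 0 (X n)) x) \<longlonglongrightarrow> 0"
    proof (rule AE_I2)
      fix x :: 'a
      have "eventually (\<lambda>n. norm x < X n) sequentially"
        using X by (simp add: filterlim_at_top_dense)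
      then show "(\<lambda>n. ennreal ((cmod (f x))\<^sup>2) * indicator (- ball 0 (X n)) x) \<longlonglongrightarrow> 0"
        by (rule tendsto_eventually[OF eventually_mono]) auto
    qed
  qed (use f in \<open>auto split: split_indicator\<close>)
  then show "(\<lambda>n. \<integral>\<^sup>+x\<in>- ball 0 (X n). ennreal ((cmod (f x))\<^sup>2) \<partial>lborel) \<longlonglongrightarrow> 0" by simp
qed

lemma measurable_fourier_trunc [measurable]:
  fixes f :: "'a::euclidean_space \<Rightarrow> complex"
  assumes [measurable]: "f \<in> borel_measurable borel"
  shows "fourier_trunc f R \<in> borel_measurable borel"
proof -
  have [measurable]: "ball (0::'a) R \<in> sets borel" by simp
  show ?thesis unfolding fourier_trunc_fint[OF assms] by measurable
qed

lemma fourier_trunc_L2_le: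
  fixes f :: "'a::euclidean_space \<Rightarrow> complex"
  assumes [measurable]: "f \<in> borel_measurable borel"
    and f: "(\<integral>\<^sup>+x. ennreal ((cmod (f x))\<^sup>2) \<partial>lborel) < \<infinity>"
  shows "(\<integral>\<^sup>+\<xi>. ennreal ((cmod (fourier_trunc f S \<xi>))\<^sup>2) \<partial>lborel) \<le> (\<integral>\<^sup>+x. ennreal ((cmod (f x))\<^sup>2) \<partial>lborel)"
    and "T \<le> S \<Longrightarrow> (\<integral>\<^sup>+\<xi>. ennreal ((cmod (fourier_trunc f S \<xi> - fourier_trunc f T \<xi>))\<^sup>2) \<partial>lborel)
       \<le> (\<integral>\<^sup>+x\<in>- ball 0 T. ennreal ((cmod (f x))\<^sup>2) \<partial>lborel)"
proof -
  have [measurable]: "ball (0::'a) R \<in> sets borel" for R by simp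
  let ?f = "\<lambda>R x. indicator (ball 0 R) x *\<^sub>R f x"
  have i: "integrable lborel (?f R)" for R
    by (rule integrable_restrict_L2[OF _ _ f]) auto
  have "(\<integral>\<^sup>+\<xi>. ennreal ((cmod (fourier_trunc f S \<xi>))\<^sup>2) \<partial>lborel) \<le> (\<integral>\<^sup>+x. ennreal ((cmod (?f S x))\<^sup>2) \<partial>lborel)"
    unfolding fourier_trunc_fint[OF assms(1)] by (rule fint_unitary_le[OF i])
  also have "\<dots> \<le> (\<integral>\<^sup>+x. ennreal ((cmod (f x))\<^sup>2) \<partial>lborel)"
    by (intro nn_integral_mono) (auto simp: indicator_def)
  finally show "(\<integral>\<^sup>+\<xi>. ennreal ((cmod (fourier_trunc f S \<xi>))\<^sup>2) \<partial>lborel) \<le> (\<integral>\<^sup>+x. ennreal ((cmod (f x))\<^sup>2) \<partial>lborel)" .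
  assume TS: "T \<le> S"
  have "(\<integral>\<^sup>+\<xi>. ennreal ((cmod (fourier_trunc f S \<xi> - fourier_trunc f T \<xi>))\<^sup>2) \<partial>lborel) \<le> (\<integral>\<^sup>+x. ennreal ((cmod (?f S x - ?f T x))\<^sup>2) \<partial>lborel)"
    unfolding fourier_trunc_fint[OF assms(1)] right_diff_distrib[symmetric] fint_diff[OF i i, symmetric]
    by (rule fint_unitary_le) (use i in simp)
  also have "\<dots> \<le> (\<integral>\<^sup>+x\<in>- ball 0 T. ennreal ((cmod (f x))\<^sup>2) \<partial>lborel)"
    using TS by (intro nn_integral_mono) (auto simp: indicator_def)
  finally show "(\<integral>\<^sup>+\<xi>. ennreal ((cmod (fourier_trunc f S \<xi> - fourier_trunc f T \<xi>))\<^sup>2) \<partial>lborel)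
       \<le> (\<integral>\<^sup>+x\<in>- ball 0 T. ennreal ((cmod (f x))\<^sup>2) \<partial>lborel)" .
qed

lemma ennreal_le_suminf: "f n \<le> (\<Sum>n. f n)" for f :: "nat \<Rightarrow> ennreal"
  using sum_le_suminf[of f "{n}"] by simp

text \<open>The weight \<open>2 ^ n\<close> splits the decay rate evenly: the weighted squares still
  have integrals bounded by \<open>(1/2) ^ n\<close>, so their sum is finite almost everywhere, and
  at such a point the increments are at most a constant times
  \<open>(1 / sqrt 2) ^ n\<close>.\<close>

lemma AE_convergent_of_fast_Cauchy:
  fixes u :: "nat \<Rightarrow> 'a \<Rightarrow> complex"
  assumes [measurable]: "\<And>n. u n \<in> borel_measurable M"
    and fast: "\<And>n. (\<integral>\<^sup>+x. ennreal ((cmod (u (Suc n) x - u n x))\<^sup>2) \<partial>M) \<le> ennreal ((1/4) ^ n)"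
  shows "AE x in M. convergent (\<lambda>n. u n x)"
proof -
  let ?w = "\<lambda>n x. ennreal (2 ^ n * (cmod (u (Suc n) x - u n x))\<^sup>2)"
  have "(\<integral>\<^sup>+x. (\<Sum>n. ?w n x) \<partial>M) = (\<Sum>n. \<integral>\<^sup>+x. ?w n x \<partial>M)"
    by (rule nn_integral_suminf) measurable
  also have "\<dots> \<le> (\<Sum>n. ennreal ((1/2) ^ n))"
  proof (rule suminf_le)
    fix n
    have "(\<integral>\<^sup>+x. ?w n x \<partial>M) = ennreal (2 ^ n) * (\<integral>\<^sup>+x. ennreal ((cmod (u (Suc n) x - u n x))\<^sup>2) \<partial>M)"
      by (subst nn_integral_cmult[symmetric]) (auto simp: ennreal_mult)
    also have "\<dots> \<le> ennreal (2 ^ n) * ennreal ((1/4) ^ n)"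
      by (intro mult_left_mono fast) simp
    also have "\<dots> = ennreal ((1/2) ^ n)"
      by (subst ennreal_mult[symmetric], simp, simp, subst power_mult_distrib[symmetric]) simp
    finally show "(\<integral>\<^sup>+x. ?w n x \<partial>M) \<le> ennreal ((1/2) ^ n)" .
  qed auto
  also have "\<dots> = ennreal (\<Sum>n. (1/2) ^ n)"
    by (intro suminf_ennreal2 summable_geometric) auto
  also have "\<dots> < \<infinity>" by simp
  finally have "(\<integral>\<^sup>+x. (\<Sum>n. ?w n x) \<partial>M) \<noteq> \<infinity>" by simp
  then have "AE x in M. (\<Sum>n. ?w n x) \<noteq> \<infinity>"
    by (intro nn_integral_PInf_AE) measurable
  then show ?thesis
  proof (rule AE_mp, intro AE_I2 impI)
    fix x assume fin: "(\<Sum>n. ?w n x) \<noteq> \<infinity>"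
    define K where "K = enn2real (\<Sum>n. ?w n x)"
    have K: "(\<Sum>n. ?w n x) = ennreal K" "0 \<le> K" using fin by (auto simp: K_def less_top)
    have d: "cmod (u (Suc n) x - u n x) \<le> sqrt K * (1 / sqrt 2) ^ n" for n
    proof -
      have "?w n x \<le> (\<Sum>n. ?w n x)"
        by (rule ennreal_le_suminf)
      then have "2 ^ n * (cmod (u (Suc n) x - u n x))\<^sup>2 \<le> K"
        unfolding K(1) by (subst (asm) ennreal_le_iff[OF K(2)])
      then have "(1 / 2) ^ n * (2 ^ n * (cmod (u (Suc n) x - u n x))\<^sup>2) \<le> (1 / 2) ^ n * K"
        by (rule mult_left_mono) simp
      moreover have "(1 / 2) ^ n * (2 ^ n :: real) = 1"
        unfolding power_mult_distrib[symmetric] by simp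
      ultimately have "(cmod (u (Suc n) x - u n x))\<^sup>2 \<le> K * (1 / 2) ^ n"
        by (simp only: mult.assoc[symmetric] mult_1_left mult.commute[of K])
      then have "sqrt ((cmod (u (Suc n) x - u n x))\<^sup>2) \<le> sqrt (K * (1 / 2) ^ n)"
        by (rule real_sqrt_le_mono)
      then show ?thesis by (simp add: real_sqrt_mult real_sqrt_power real_sqrt_divide)
    qed
    have "summable (\<lambda>n. sqrt K * (1 / sqrt 2) ^ n)"
      by (intro summable_mult summable_geometric) auto
    then have "summable (\<lambda>n. u (Suc n) x - u n x)"
      by (rule summable_comparison_test'[where N = 0]) (rule d)
    then have "convergent (\<lambda>n. \<Sum>i<n. u (Suc i) x - u i x)"
      by (simp add: summable_iff_convergent)
    then have "convergent (\<lambda>n. u n x - u 0 x)"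
      using sum_lessThan_telescope[of "\<lambda>i. u i x"] by simp
    then have "convergent (\<lambda>n. (u n x - u 0 x) + u 0 x)"
      by (intro convergent_add convergent_const)
    then show "convergent (\<lambda>n. u n x)" by simp
  qed
qed

text \<open>The transform is introduced by \<open>SOME\<close>, so its defining property is
  available only once a witness exists. The argument is Riesz-Fischer: a fast subsequence of
  truncated transforms converges almost everywhere, and Fatou's lemma upgrades this to L2
  convergence along all radii.\<close>

lemma is_fourier_L2_exists:
  fixes f :: "'a::euclidean_space \<Rightarrow> complex"
  assumes [measurable]: "f \<in> borel_measurable borel"
    and f: "(\<integral>\<^sup>+x. ennreal ((cmod (f x))\<^sup>2) \<partial>lborel) < \<infinity>"
  shows "\<exists>g. is_fourier_L2 f g"
proof -
  let ?\<tau> = "\<lambda>T. \<integral>\<^sup>+x\<in>- ball 0 T. ennreal ((cmod (f x))\<^sup>2) \<partial>lborel"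
  let ?F = "fourier_trunc f"
  have "\<exists>T\<ge>real n. ?\<tau> T \<le> ennreal ((1/4) ^ n)" for n
  proof -
    have "eventually (\<lambda>T. ?\<tau> T < ennreal ((1/4) ^ n)) at_top"
      by (rule order_tendstoD(2)[OF tail_tendsto_0[OF assms]]) simp
    then have "eventually (\<lambda>T. real n \<le> T \<and> ?\<tau> T < ennreal ((1/4) ^ n)) at_top"
      by (intro eventually_conj eventually_ge_at_top)
    then show ?thesis by (auto dest!: eventually_happens)
  qed
  then obtain T where T: "\<And>n. real n \<le> T n" "\<And>n. ?\<tau> (T n) \<le> ennreal ((1/4) ^ n)" by metis
  \<comment> \<open>The chosen radii tend to infinity but need not increase, so consecutive ones are
    compared in either order.\<close>
  have fast: "(\<integral>\<^sup>+\<xi>. ennreal ((cmod (?F (T (Suc n)) \<xi> - ?F (T n) \<xi>))\<^sup>2) \<partial>lborel) \<le> ennreal ((1/4) ^ n)" for n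
  proof (cases "T n \<le> T (Suc n)")
    case True
    show ?thesis by (rule order_trans[OF fourier_trunc_L2_le(2)[OF assms True] T(2)])
  next
    case False
    then have "T (Suc n) \<le> T n" by simp
    then have "(\<integral>\<^sup>+\<xi>. ennreal ((cmod (?F (T n) \<xi> - ?F (T (Suc n)) \<xi>))\<^sup>2) \<partial>lborel) \<le> ?\<tau> (T (Suc n))"
      by (rule fourier_trunc_L2_le(2)[OF assms])
    also have "\<dots> \<le> ennreal ((1/4) ^ Suc n)" by (rule T(2))
    also have "\<dots> \<le> ennreal ((1/4) ^ n)" by (intro ennreal_leI power_decreasing) auto
    finally show ?thesis by (simp add: norm_minus_commute)
  qed
  \<comment> \<open>Where the sequence diverges \<open>lim\<close> takes an unspecified value; this
    happens only on a null set.\<close>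
  define g where "g \<xi> = lim (\<lambda>n. ?F (T n) \<xi>)" for \<xi>
  have [measurable]: "g \<in> borel_measurable borel" unfolding g_def by measurable
  have "AE \<xi> in lborel. convergent (\<lambda>n. ?F (T n) \<xi>)"
    by (rule AE_convergent_of_fast_Cauchy[OF _ fast]) measurable
  then have conv: "AE \<xi> in lborel. (\<lambda>n. ?F (T n) \<xi>) \<longlonglongrightarrow> g \<xi>"
    unfolding g_def by (simp add: convergent_LIMSEQ_iff)
  \<comment> \<open>Used twice: with \<open>k = 0\<close> it puts \<open>g\<close> into L2, and with
    \<open>k\<close> a truncated transform of radius \<open>R\<close> it bounds the error at
    \<open>R\<close> by the tail of \<open>f\<close>. The index shift \<open>m\<close> guarantees
    that every radius \<open>T (n + m)\<close> exceeds \<open>R\<close>.\<close>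
  have fatou: "(\<integral>\<^sup>+\<xi>. ennreal ((cmod (g \<xi> - k \<xi>))\<^sup>2) \<partial>lborel) \<le> B"
    if [measurable]: "k \<in> borel_measurable borel"
      and B: "\<And>n. (\<integral>\<^sup>+\<xi>. ennreal ((cmod (?F (T (n + m)) \<xi> - k \<xi>))\<^sup>2) \<partial>lborel) \<le> B" for k m B
  proof -
    have "(\<integral>\<^sup>+\<xi>. ennreal ((cmod (g \<xi> - k \<xi>))\<^sup>2) \<partial>lborel)
       \<le> (\<integral>\<^sup>+\<xi>. liminf (\<lambda>n. ennreal ((cmod (?F (T (n + m)) \<xi> - k \<xi>))\<^sup>2)) \<partial>lborel)"
    proof (rule nn_integral_mono_AE)
      show "AE \<xi> in lborel. ennreal ((cmod (g \<xi> - k \<xi>))\<^sup>2) \<le> liminf (\<lambda>n. ennreal ((cmod (?F (T (n + m)) \<xi> - k \<xi>))\<^sup>2))"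
        using conv
      proof (rule AE_mp, intro AE_I2 impI)
        fix \<xi> assume "(\<lambda>n. ?F (T n) \<xi>) \<longlonglongrightarrow> g \<xi>"
        then have "(\<lambda>n. ?F (T (n + m)) \<xi>) \<longlonglongrightarrow> g \<xi>" by (rule LIMSEQ_ignore_initial_segment)
        then have "(\<lambda>n. ennreal ((cmod (?F (T (n + m)) \<xi> - k \<xi>))\<^sup>2)) \<longlonglongrightarrow> ennreal ((cmod (g \<xi> - k \<xi>))\<^sup>2)"
          by (intro tendsto_intros tendsto_ennrealI)
        from lim_imp_Liminf[OF _ this] show "ennreal ((cmod (g \<xi> - k \<xi>))\<^sup>2) \<le> liminf (\<lambda>n. ennreal ((cmod (?F (T (n + m)) \<xi> - k \<xi>))\<^sup>2))"
          by simp
      qed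
    qed
    also have "\<dots> \<le> B"
      by (rule nn_integral_liminf_le[OF _ B]) measurable
    finally show ?thesis .
  qed
  have "(\<integral>\<^sup>+\<xi>. ennreal ((cmod (g \<xi> - 0))\<^sup>2) \<partial>lborel) \<le> (\<integral>\<^sup>+x. ennreal ((cmod (f x))\<^sup>2) \<partial>lborel)"
    by (rule fatou[where m = 0]) (use fourier_trunc_L2_le(1)[OF assms] in auto)
  then have "(\<integral>\<^sup>+\<xi>. ennreal ((cmod (g \<xi>))\<^sup>2) \<partial>lebesgue) < \<infinity>"
    using f by (simp add: nn_integral_completion)
  then have "g \<in> L2"
    unfolding L2_def by (auto intro!: integrableI_bounded measurable_completion)
  moreover have "((\<lambda>R. \<integral>\<^sup>+ \<xi>. ennreal ((cmod (g \<xi> - ?F R \<xi>))\<^sup>2) \<partial>lebesgue) \<longlongrightarrow> 0) at_top"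
  proof (rule tendsto_sandwich[OF _ _ tendsto_const tail_tendsto_0[OF assms]])
    show "\<forall>\<^sub>F R in at_top. (\<integral>\<^sup>+ \<xi>. ennreal ((cmod (g \<xi> - ?F R \<xi>))\<^sup>2) \<partial>lebesgue) \<le> ?\<tau> R"
    proof (rule always_eventually, rule allI)
      fix R
      obtain m where m: "R \<le> real m" using real_arch_simple by blast
      have "R \<le> T (n + m)" for n using T(1)[of "n + m"] m by simp
      then show "(\<integral>\<^sup>+ \<xi>. ennreal ((cmod (g \<xi> - ?F R \<xi>))\<^sup>2) \<partial>lebesgue) \<le> ?\<tau> R"
        unfolding nn_integral_completion
        by (intro fatou[where m = m] fourier_trunc_L2_le(2)[OF assms]) auto
    qed
  qed simp
  ultimately show ?thesis unfolding is_fourier_L2_def by blast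
qed

text \<open>Stated for any \<open>g\<close> with the limit property, since nothing else is known
  about a function picked by \<open>SOME\<close>. The 2 comes from
  \<open>(p + q)^2 \<le> 2 * p^2 + 2 * q^2\<close>, applied to \<open>g\<close> as error plus
  truncated transform; the error vanishes in the limit.\<close>

lemma fourier_L2_norm_le:
  fixes f g :: "'a::euclidean_space \<Rightarrow> complex"
  assumes [measurable]: "f \<in> borel_measurable borel" and [measurable]: "g \<in> borel_measurable borel"
    and f: "(\<integral>\<^sup>+x. ennreal ((cmod (f x))\<^sup>2) \<partial>lborel) < \<infinity>"
    and lim: "((\<lambda>R. \<integral>\<^sup>+ \<xi>. ennreal ((cmod (g \<xi> - fourier_trunc f R \<xi>))\<^sup>2) \<partial>lborel) \<longlongrightarrow> 0) at_top"
  shows "(\<integral>\<^sup>+\<xi>. ennreal ((cmod (g \<xi>))\<^sup>2) \<partial>lborel) \<le> 2 * (\<integral>\<^sup>+x. ennreal ((cmod (f x))\<^sup>2) \<partial>lborel)"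
proof -
  let ?B = "\<integral>\<^sup>+x. ennreal ((cmod (f x))\<^sup>2) \<partial>lborel"
  let ?D = "\<lambda>R. \<integral>\<^sup>+ \<xi>. ennreal ((cmod (g \<xi> - fourier_trunc f R \<xi>))\<^sup>2) \<partial>lborel"
  have *: "(\<integral>\<^sup>+\<xi>. ennreal ((cmod (g \<xi>))\<^sup>2) \<partial>lborel) \<le> 2 * ?D R + 2 * ?B" for R
  proof -
    have sq: "(cmod a)\<^sup>2 \<le> 2 * (cmod (a - b))\<^sup>2 + 2 * (cmod b)\<^sup>2" for a b
    proof -
      have "cmod a \<le> cmod (a - b) + cmod b" using norm_triangle_ineq[of "a - b" b] by simp
      then have "(cmod a)\<^sup>2 \<le> (cmod (a - b) + cmod b)\<^sup>2" by (intro power_mono) auto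
      also have "\<dots> \<le> 2 * (cmod (a - b))\<^sup>2 + 2 * (cmod b)\<^sup>2"
        using sum_squares_bound[of "cmod (a - b)" "cmod b"] by (simp add: power2_sum)
      finally show ?thesis .
    qed
    have "(\<integral>\<^sup>+\<xi>. ennreal ((cmod (g \<xi>))\<^sup>2) \<partial>lborel)
       \<le> (\<integral>\<^sup>+\<xi>. 2 * ennreal ((cmod (g \<xi> - fourier_trunc f R \<xi>))\<^sup>2) + 2 * ennreal ((cmod (fourier_trunc f R \<xi>))\<^sup>2) \<partial>lborel)"
    proof (rule nn_integral_mono)
      fix \<xi>
      have "ennreal ((cmod (g \<xi>))\<^sup>2) \<le> ennreal (2 * (cmod (g \<xi> - fourier_trunc f R \<xi>))\<^sup>2 + 2 * (cmod (fourier_trunc f R \<xi>))\<^sup>2)"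
        by (intro ennreal_leI sq)
      then show "ennreal ((cmod (g \<xi>))\<^sup>2) \<le> 2 * ennreal ((cmod (g \<xi> - fourier_trunc f R \<xi>))\<^sup>2) + 2 * ennreal ((cmod (fourier_trunc f R \<xi>))\<^sup>2)"
        by (simp add: ennreal_mult)
    qed
    also have "\<dots> = 2 * ?D R + 2 * (\<integral>\<^sup>+\<xi>. ennreal ((cmod (fourier_trunc f R \<xi>))\<^sup>2) \<partial>lborel)"
      by (simp add: nn_integral_add nn_integral_cmult)
    also have "\<dots> \<le> 2 * ?D R + 2 * ?B"
      by (intro add_left_mono mult_left_mono fourier_trunc_L2_le(1) f) auto
    finally show ?thesis .
  qed
  have "((\<lambda>R. 2 * ?D R + 2 * ?B) \<longlongrightarrow> 2 * 0 + 2 * ?B) at_top"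
    by (intro tendsto_add tendsto_const ennreal_tendsto_cmult lim) simp
  then have "(\<integral>\<^sup>+\<xi>. ennreal ((cmod (g \<xi>))\<^sup>2) \<partial>lborel) \<le> 2 * 0 + 2 * ?B"
    by (rule tendsto_lowerbound) (use * in auto)
  then show ?thesis by simp
qed

section \<open>Multipliers acting on a function that vanishes near the origin\<close>

lemma integrable_mult_L2:
  fixes a :: "'a::euclidean_space \<Rightarrow> real" and g :: "'a \<Rightarrow> complex"
  assumes [measurable]: "a \<in> borel_measurable borel" "g \<in> borel_measurable borel"
    and a: "integrable lborel (\<lambda>x. (a x)\<^sup>2)"
    and g: "(\<integral>\<^sup>+x. ennreal ((cmod (g x))\<^sup>2) \<partial>lborel) < \<infinity>"
  shows "integrable lborel (\<lambda>x. complex_of_real (a x) * g x)"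
proof (rule Bochner_Integration.integrable_bound)
  show "integrable lborel (\<lambda>x. (a x)\<^sup>2 + (cmod (g x))\<^sup>2)"
    using a g by (intro Bochner_Integration.integrable_add) (auto simp: integrable_iff_bounded)
  show "AE x in lborel. norm (complex_of_real (a x) * g x) \<le> norm ((a x)\<^sup>2 + (cmod (g x))\<^sup>2)"
  proof (rule AE_I2)
    fix x
    have "2 * (\<bar>a x\<bar> * cmod (g x)) \<le> (a x)\<^sup>2 + (cmod (g x))\<^sup>2"
      using sum_squares_bound[of "\<bar>a x\<bar>" "cmod (g x)"] by (simp add: mult.assoc)
    moreover have "0 \<le> \<bar>a x\<bar> * cmod (g x)" by simp
    ultimately have "\<bar>a x\<bar> * cmod (g x) \<le> (a x)\<^sup>2 + (cmod (g x))\<^sup>2" by linarith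
    then show "norm (complex_of_real (a x) * g x) \<le> norm ((a x)\<^sup>2 + (cmod (g x))\<^sup>2)"
      by (simp add: norm_mult)
  qed
qed measurable

text \<open>For a truncated transform the integral is, up to a constant, the truncation of
  \<open>f\<close> convolved at \<open>x\<close> with the transform of \<open>M\<close>. Either
  \<open>f y = 0\<close>, or \<open>norm y \<ge> \<rho>\<close> and hence
  \<open>norm (x - y) \<ge> d\<close>, where the transform of \<open>M\<close> vanishes. Since
  \<open>M\<close> is square-integrable, Cauchy-Schwarz carries the identity to
  \<open>g\<close>.\<close>

lemma band_limited_multiplier_vanishes:
  fixes f g :: "'a::euclidean_space \<Rightarrow> complex" and M :: "'a \<Rightarrow> real"
  assumes [measurable]: "f \<in> borel_measurable borel" and [measurable]: "g \<in> borel_measurable borel"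
    and f: "(\<integral>\<^sup>+x. ennreal ((cmod (f x))\<^sup>2) \<partial>lborel) < \<infinity>"
    and g: "(\<integral>\<^sup>+x. ennreal ((cmod (g x))\<^sup>2) \<partial>lborel) < \<infinity>"
    and lim: "((\<lambda>R. \<integral>\<^sup>+ \<xi>. ennreal ((cmod (g \<xi> - fourier_trunc f R \<xi>))\<^sup>2) \<partial>lborel) \<longlongrightarrow> 0) at_top"
    and supp: "\<And>y. norm y < \<rho> \<Longrightarrow> f y = 0"
    and [measurable]: "M \<in> borel_measurable borel" and M0: "\<And>\<xi>. 0 \<le> M \<xi>" and M1: "\<And>\<xi>. M \<xi> \<le> 1" and Mi: "integrable lborel M"
    and van: "\<And>z. d \<le> norm z \<Longrightarrow> (LINT \<xi>|lborel. complex_of_real (M \<xi>) * cis (z \<bullet> \<xi>)) = 0"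
    and x: "norm x + d \<le> \<rho>"
  shows "(LINT \<xi>|lborel. complex_of_real (M \<xi>) * g \<xi> * cis (x \<bullet> \<xi>)) = 0"
proof -
  let ?F = "fourier_trunc f"
  have M2: "integrable lborel (\<lambda>\<xi>. (M \<xi>)\<^sup>2)"
    by (rule Bochner_Integration.integrable_bound[OF Mi])
       (use M0 M1 in \<open>auto simp: power2_eq_square mult_left_le\<close>)
  have F0: "(LINT \<xi>|lborel. complex_of_real (M \<xi>) * ?F T \<xi> * cis (x \<bullet> \<xi>)) = 0" for T
  proof -
    have [measurable]: "ball (0::'a) T \<in> sets borel" by simp
    let ?f = "\<lambda>y. indicator (ball 0 T) y *\<^sub>R f y"
    let ?c = "complex_of_real (fnorm_const TYPE('a))"
    have fi: "integrable lborel ?f" by (rule integrable_restrict_L2[OF _ _ f]) auto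
    let ?T = "\<lambda>y \<xi>. ?f y * complex_of_real (M \<xi>) * cis ((x - y) \<bullet> \<xi>)"
    have MC: "integrable lborel (\<lambda>\<xi>. complex_of_real (M \<xi>))" using Mi by simp
    have T: "integrable (lborel \<Otimes>\<^sub>M lborel) (case_prod ?T)"
      by (rule Bochner_Integration.integrable_bound[OF integrable_lborel_product[OF fi MC]])
         (auto simp: norm_mult split: prod.split)
    have "(LINT \<xi>|lborel. complex_of_real (M \<xi>) * ?F T \<xi> * cis (x \<bullet> \<xi>)) = (LINT \<xi>|lborel. ?c * (LINT y|lborel. ?T y \<xi>))"
    proof (rule Bochner_Integration.integral_cong[OF refl])
      fix \<xi> :: 'a
      have "(LINT y|lborel. ?T y \<xi>) = (LINT y|lborel. (?f y * cis (y \<bullet> (- \<xi>))) * (complex_of_real (M \<xi>) * cis (x \<bullet> \<xi>)))"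
        by (intro Bochner_Integration.integral_cong)
           (simp_all add: inner_diff_left cis_mult mult_ac)
      then have "(LINT y|lborel. ?T y \<xi>) = fint ?f (- \<xi>) * (complex_of_real (M \<xi>) * cis (x \<bullet> \<xi>))"
        unfolding fint_def integral_mult_left_zero .
      then show "complex_of_real (M \<xi>) * ?F T \<xi> * cis (x \<bullet> \<xi>) = ?c * (LINT y|lborel. ?T y \<xi>)"
        by (simp only: fourier_trunc_fint[OF assms(1)] mult_ac)
    qed
    also have "\<dots> = ?c * (LINT \<xi>|lborel. (LINT y|lborel. ?T y \<xi>))"
      by (rule integral_mult_right_zero)
    also have "(LINT \<xi>|lborel. (LINT y|lborel. ?T y \<xi>)) = (LINT y|lborel. (LINT \<xi>|lborel. ?T y \<xi>))"
      by (rule lborel_pair.Fubini_integral[OF T])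
    also have "\<dots> = (LINT y|(lborel::'a measure). 0)"
    proof (rule Bochner_Integration.integral_cong[OF refl])
      fix y :: 'a
      have "(LINT \<xi>|lborel. ?T y \<xi>) = ?f y * (LINT \<xi>|lborel. complex_of_real (M \<xi>) * cis ((x - y) \<bullet> \<xi>))"
        unfolding mult.assoc by (rule integral_mult_right_zero)
      moreover have "d \<le> norm (x - y)" if "\<rho> \<le> norm y"
        using norm_triangle_ineq2[of y x] that x by (simp add: norm_minus_commute)
      ultimately show "(LINT \<xi>|lborel. ?T y \<xi>) = 0"
        using supp[of y] van[of "x - y"] by (cases "norm y < \<rho>") auto
    qed
    finally show ?thesis by simp
  qed
  let ?I = "LINT \<xi>|lborel. complex_of_real (M \<xi>) * g \<xi> * cis (x \<bullet> \<xi>)"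
  let ?D = "\<lambda>R. \<integral>\<^sup>+ \<xi>. ennreal ((cmod (g \<xi> - ?F R \<xi>))\<^sup>2) \<partial>lborel"
  let ?m = "\<integral>\<^sup>+ \<xi>. ennreal ((M \<xi>)\<^sup>2) \<partial>lborel"
  have cisi: "integrable lborel (\<lambda>\<xi>. h \<xi> * cis (x \<bullet> \<xi>))" if "integrable lborel h" for h
    using integrable_mult_cis[OF that, of x] by (simp add: inner_commute)
  have Mg: "integrable lborel (\<lambda>\<xi>. complex_of_real (M \<xi>) * g \<xi> * cis (x \<bullet> \<xi>))"
    by (intro cisi integrable_mult_L2 M2 g) measurable
  have MF: "integrable lborel (\<lambda>\<xi>. complex_of_real (M \<xi>) * ?F R \<xi> * cis (x \<bullet> \<xi>))" for R
    by (intro cisi integrable_mult_L2 M2 le_less_trans[OF fourier_trunc_L2_le(1) f] f) measurable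
  \<comment> \<open>Subtracting the integral for the truncated transform, which is 0, leaves only
    the error; the right-hand side tends to 0 while the left-hand side is independent of
    \<open>R\<close>.\<close>
  have bound: "(ennreal (norm ?I))\<^sup>2 \<le> ?m * ?D R" for R
  proof -
    have "?I = (LINT \<xi>|lborel. complex_of_real (M \<xi>) * g \<xi> * cis (x \<bullet> \<xi>) - complex_of_real (M \<xi>) * ?F R \<xi> * cis (x \<bullet> \<xi>))"
      by (subst Bochner_Integration.integral_diff[OF Mg MF]) (simp add: F0)
    then have "ennreal (norm ?I) \<le> (\<integral>\<^sup>+\<xi>. ennreal (norm (complex_of_real (M \<xi>) * g \<xi> * cis (x \<bullet> \<xi>) - complex_of_real (M \<xi>) * ?F R \<xi> * cis (x \<bullet> \<xi>))) \<partial>lborel)"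
      by (simp only:) (rule integral_norm_bound_ennreal, intro Bochner_Integration.integrable_diff Mg MF)
    also have "\<dots> = (\<integral>\<^sup>+\<xi>. ennreal (M \<xi>) * ennreal (cmod (g \<xi> - ?F R \<xi>)) \<partial>lborel)"
    proof (rule nn_integral_cong)
      fix \<xi>
      have "complex_of_real (M \<xi>) * g \<xi> * cis (x \<bullet> \<xi>) - complex_of_real (M \<xi>) * ?F R \<xi> * cis (x \<bullet> \<xi>) = complex_of_real (M \<xi>) * (g \<xi> - ?F R \<xi>) * cis (x \<bullet> \<xi>)"
        by (simp add: algebra_simps)
      then show "ennreal (norm (complex_of_real (M \<xi>) * g \<xi> * cis (x \<bullet> \<xi>) - complex_of_real (M \<xi>) * ?F R \<xi> * cis (x \<bullet> \<xi>)))
          = ennreal (M \<xi>) * ennreal (cmod (g \<xi> - ?F R \<xi>))"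
        using M0[of \<xi>] by (simp add: norm_mult ennreal_mult)
    qed
    finally have "(ennreal (norm ?I))\<^sup>2 \<le> (\<integral>\<^sup>+\<xi>. ennreal (M \<xi>) * ennreal (cmod (g \<xi> - ?F R \<xi>)) \<partial>lborel)\<^sup>2"
      by (rule power_mono) simp
    also have "\<dots> \<le> (\<integral>\<^sup>+\<xi>. (ennreal (M \<xi>))\<^sup>2 \<partial>lborel) * (\<integral>\<^sup>+\<xi>. (ennreal (cmod (g \<xi> - ?F R \<xi>)))\<^sup>2 \<partial>lborel)"
      by (rule Cauchy_Schwarz_nn_integral) measurable
    finally show ?thesis by (simp add: ennreal_power M0)
  qed
  have mfin: "?m < \<infinity>" using M2 by (simp add: integrable_iff_bounded)
  have "((\<lambda>R. ?m * ?D R) \<longlongrightarrow> ?m * 0) at_top"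
    by (intro ennreal_tendsto_cmult lim) (use mfin in simp)
  then have "(ennreal (norm ?I))\<^sup>2 \<le> ?m * 0"
    by (rule tendsto_lowerbound) (use bound in auto)
  then show ?thesis by simp
qed

subsection \<open>The maximal function\<close>

lemma annulus_split:
  assumes "a \<le> b" "b \<le> c"
  shows "indicator (annulus a c) x = (indicator (annulus a b) x + indicator (annulus b c) x :: 'b::semiring_1)"
  using assms by (auto simp: annulus_def indicator_def)

lemma nn_integral_annuli_sum:
  fixes w :: "'a::euclidean_space \<Rightarrow> ennreal"
  assumes [measurable]: "w \<in> borel_measurable borel" and t: "\<And>j. t j \<le> t (Suc j)"
  shows "(\<Sum>j<q. \<integral>\<^sup>+x\<in>annulus (t j) (t (Suc j)). w x \<partial>lborel) = (\<integral>\<^sup>+x\<in>annulus (t 0) (t q). w x \<partial>lborel)"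
proof (induction q)
  case 0
  show ?case by (simp add: annulus_def)
next
  case (Suc q)
  have t0: "t 0 \<le> t q" by (rule lift_Suc_mono_le[of t, OF t]) simp
  have "(\<integral>\<^sup>+x\<in>annulus (t 0) (t (Suc q)). w x \<partial>lborel)
     = (\<integral>\<^sup>+x. w x * indicator (annulus (t 0) (t q)) x + w x * indicator (annulus (t q) (t (Suc q))) x \<partial>lborel)"
    by (simp only: annulus_split[OF t0 t] distrib_left)
  then show ?case using Suc by (simp add: nn_integral_add)
qed

lemma bounded_annulus: "bounded (annulus a b)"
  by (rule bounded_subset[OF bounded_ball[of 0 b]]) (auto simp: annulus_def)

text \<open>For \<open>a = 0\<close> this is the overview's integral over the ball of radius
  \<open>b\<close>; for \<open>0 \<le> a \<le> b\<close> it is the increment between the radii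
  \<open>a\<close> and \<open>b\<close>.\<close>

definition fint_annulus :: "('a::euclidean_space \<Rightarrow> complex) \<Rightarrow> real \<Rightarrow> real \<Rightarrow> 'a \<Rightarrow> complex" where
  "fint_annulus g a b = fint (\<lambda>\<xi>. indicator (annulus a b) \<xi> *\<^sub>R g \<xi>)"

lemma measurable_fint_annulus [measurable]:
  assumes [measurable]: "g \<in> borel_measurable borel"
  shows "fint_annulus g a b \<in> borel_measurable borel"
  unfolding fint_annulus_def by measurable

section \<open>Variation of the ball integrals over a unit interval of radii\<close>

context
  fixes g :: "'a::euclidean_space \<Rightarrow> complex"
  assumes g_meas [measurable]: "g \<in> borel_measurable borel"
    and g_L2: "(\<integral>\<^sup>+x. ennreal ((cmod (g x))\<^sup>2) \<partial>lborel) < \<infinity>"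
begin

lemma integrable_annulus: "integrable lborel (\<lambda>\<xi>. indicator (annulus a b) \<xi> *\<^sub>R g \<xi>)"
  by (rule integrable_restrict_L2[OF _ _ g_L2 bounded_annulus]) measurable

lemma fint_annulus_split:
  assumes "a \<le> b" "b \<le> c"
  shows "fint_annulus g a c x = fint_annulus g a b x + fint_annulus g b c x"
proof -
  have "(LINT \<xi>|lborel. (indicator (annulus a c) \<xi> *\<^sub>R g \<xi>) * cis (\<xi> \<bullet> x))
    = (LINT \<xi>|lborel. (indicator (annulus a b) \<xi> *\<^sub>R g \<xi>) * cis (\<xi> \<bullet> x) + (indicator (annulus b c) \<xi> *\<^sub>R g \<xi>) * cis (\<xi> \<bullet> x))"
    unfolding annulus_split[OF assms, where 'b = real] by (simp add: algebra_simps)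
  also have "\<dots> = fint_annulus g a b x + fint_annulus g b c x"
    unfolding fint_annulus_def fint_def
    by (intro Bochner_Integration.integral_add integrable_mult_cis integrable_annulus)
  finally show ?thesis unfolding fint_annulus_def fint_def .
qed

lemma fint_annulus_empty: "b \<le> a \<Longrightarrow> fint_annulus g a b x = 0"
proof -
  assume "b \<le> a"
  then have "annulus a b = ({} :: 'a set)" by (auto simp: annulus_def)
  then show ?thesis by (simp add: fint_annulus_def fint_def)
qed

lemma fint_annulus_sum:
  assumes t: "\<And>j. t j \<le> t (Suc j)"
  shows "fint_annulus g (t 0) (t q) x = (\<Sum>j<q. fint_annulus g (t j) (t (Suc j)) x)"
proof (induction q)
  case (Suc q)
  have "t 0 \<le> t q" by (rule lift_Suc_mono_le[of t, OF t]) simp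
  from fint_annulus_split[OF this t] show ?case using Suc by simp
qed (simp add: fint_annulus_empty)

text \<open>Continuity from the left. The outer inequality of an annulus is strict, so frequencies
  with \<open>norm \<xi> = c\<close> belong neither to the limit nor to any approximating
  annulus.\<close>

lemma fint_annulus_tendsto:
  assumes le: "\<And>n. b n \<le> c" and lim: "b \<longlonglongrightarrow> c"
  shows "(\<lambda>n. fint_annulus g a (b n) x) \<longlonglongrightarrow> fint_annulus g a c x"
  unfolding fint_annulus_def fint_def
proof (rule integral_dominated_convergence)
  show "integrable lborel (\<lambda>\<xi>. norm (indicator (annulus a c) \<xi> *\<^sub>R g \<xi>))"
    by (intro integrable_norm integrable_annulus)
  show "AE \<xi> in lborel. (\<lambda>n. indicator (annulus a (b n)) \<xi> *\<^sub>R g \<xi> * cis (\<xi> \<bullet> x)) \<longlonglongrightarrow> indicator (annulus a c) \<xi> *\<^sub>R g \<xi> * cis (\<xi> \<bullet> x)"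
  proof (rule AE_I2)
    fix \<xi> :: 'a
    have "eventually (\<lambda>n. (indicator (annulus a (b n)) \<xi> :: real) = indicator (annulus a c) \<xi>) sequentially"
    proof (cases "norm \<xi> < c")
      case True
      have "eventually (\<lambda>n. norm \<xi> < b n) sequentially"
        using order_tendstoD(1)[OF lim True] .
      then show ?thesis by (rule eventually_mono) (use True in \<open>auto simp: annulus_def indicator_def\<close>)
    next
      case False
      then have "\<not> norm \<xi> < b n" for n using le[of n] by linarith
      then show ?thesis using False by (auto simp: annulus_def indicator_def)
    qed
    then show "(\<lambda>n. indicator (annulus a (b n)) \<xi> *\<^sub>R g \<xi> * cis (\<xi> \<bullet> x)) \<longlonglongrightarrow> indicator (annulus a c) \<xi> *\<^sub>R g \<xi> * cis (\<xi> \<bullet> x)"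
      by (intro tendsto_eventually) (rule eventually_mono, auto)
  qed
  show "AE \<xi> in lborel. norm (indicator (annulus a (b n)) \<xi> *\<^sub>R g \<xi> * cis (\<xi> \<bullet> x)) \<le> norm (indicator (annulus a c) \<xi> *\<^sub>R g \<xi>)" for n
    using le[of n] by (intro AE_I2) (auto simp: annulus_def indicator_def norm_mult)
qed measurable

text \<open>The square of a sum, not a sum of squares: the squared discrete variation over
  \<open>[a, a + 1]\<close> cut into \<open>Suc n\<close> equal pieces.\<close>

definition annuli_square_sum :: "nat \<Rightarrow> real \<Rightarrow> 'a \<Rightarrow> real" where
  "annuli_square_sum n a x = (\<Sum>j<Suc n. cmod (fint_annulus g (a + real j / Suc n) (a + real (Suc j) / Suc n) x))\<^sup>2"

lemma measurable_annuli_square_sum [measurable]: "annuli_square_sum n a \<in> borel_measurable borel"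
  unfolding annuli_square_sum_def by measurable

text \<open>The right-hand side no longer mentions \<open>R\<close>, so an uncountable supremum is
  bounded by the lower limit of one sequence of measurable functions, to which Fatou's lemma
  applies. Grid points approach \<open>R\<close> from below, and the increment up to a grid point is
  at most the variation over the whole grid.\<close>

lemma fint_annulus_le_liminf:
  assumes R: "a \<le> R" "R \<le> a + 1"
  shows "ennreal ((cmod (fint_annulus g a R x))\<^sup>2) \<le> liminf (\<lambda>n. ennreal (annuli_square_sum n a x))"
proof -
  \<comment> \<open>The last grid index not beyond \<open>R\<close>. It can equal
    \<open>Suc n\<close>, namely for \<open>R = a + 1\<close>, and then all pieces are used.\<close>
  define j where "j n = nat \<lfloor>(R - a) * real (Suc n)\<rfloor>" for n
  define b where "b n = a + real (j n) / Suc n" for n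
  have fl: "real (j n) = of_int \<lfloor>(R - a) * real (Suc n)\<rfloor>" for n
    unfolding j_def using R by (intro of_nat_nat) simp
  have j1: "real (j n) \<le> (R - a) * real (Suc n)" "(R - a) * real (Suc n) \<le> real (j n) + 1" for n
    unfolding fl by linarith+
  have j2: "j n \<le> Suc n" for n
  proof -
    have "(R - a) * real (Suc n) \<le> 1 * real (Suc n)" using R by (intro mult_right_mono) auto
    then have "real (j n) \<le> real (Suc n)" 
      using order_trans[OF j1(1)[of n]] by (simp only: mult_1_left)
    then show ?thesis by simp
  qed
  have b1: "b n \<le> R" for n
  proof -
    have "real (j n) / real (Suc n) \<le> R - a"
      using j1(1)[of n] by (subst pos_divide_le_eq) simp_all
    then show ?thesis unfolding b_def by linarith
  qed
  have b2: "R - 1 / real (Suc n) \<le> b n" for n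
  proof -
    have "R - a \<le> (real (j n) + 1) / real (Suc n)"
      using j1(2)[of n] by (subst pos_le_divide_eq) simp_all
    then show ?thesis unfolding b_def add_divide_distrib by linarith
  qed
  have "b \<longlonglongrightarrow> R"
  proof (rule tendsto_sandwich[OF _ _ _ tendsto_const])
    have "(\<lambda>n. R - 1 / real (Suc n)) \<longlonglongrightarrow> R - 0"
      by (intro tendsto_diff tendsto_const LIMSEQ_Suc[OF lim_1_over_n])
    then show "(\<lambda>n. R - 1 / real (Suc n)) \<longlonglongrightarrow> R" by simp
  qed (use b1 b2 in auto)
  then have "(\<lambda>n. fint_annulus g a (b n) x) \<longlonglongrightarrow> fint_annulus g a R x"
    by (intro fint_annulus_tendsto b1)
  then have "(\<lambda>n. ennreal ((cmod (fint_annulus g a (b n) x))\<^sup>2)) \<longlonglongrightarrow> ennreal ((cmod (fint_annulus g a R x))\<^sup>2)"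
    by (intro tendsto_intros tendsto_ennrealI)
  from lim_imp_Liminf[OF _ this]
  have "ennreal ((cmod (fint_annulus g a R x))\<^sup>2) = liminf (\<lambda>n. ennreal ((cmod (fint_annulus g a (b n) x))\<^sup>2))" by simp
  also have "\<dots> \<le> liminf (\<lambda>n. ennreal (annuli_square_sum n a x))"
  proof (intro Liminf_mono always_eventually allI ennreal_leI)
    fix n
    let ?t = "\<lambda>i. a + real i / Suc n"
    have t: "?t i \<le> ?t (Suc i)" for i by (simp add: divide_right_mono)
    have "cmod (fint_annulus g a (b n) x) = cmod (\<Sum>i<j n. fint_annulus g (?t i) (?t (Suc i)) x)"
      using fint_annulus_sum[of ?t "j n" x, OF t] by (simp add: b_def)
    also have "\<dots> \<le> (\<Sum>i<j n. cmod (fint_annulus g (?t i) (?t (Suc i)) x))" by (rule norm_sum)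
    also have "\<dots> \<le> (\<Sum>i<Suc n. cmod (fint_annulus g (?t i) (?t (Suc i)) x))"
      using j2[of n] by (intro sum_mono2) auto
    finally show "(cmod (fint_annulus g a (b n) x))\<^sup>2 \<le> annuli_square_sum n a x"
      unfolding annuli_square_sum_def by (intro power_mono) auto
  qed
  finally show ?thesis .
qed

end

lemma sum_power2_le:
  fixes a :: "nat \<Rightarrow> real"
  shows "(\<Sum>j<p. a j)\<^sup>2 \<le> real p * (\<Sum>j<p. (a j)\<^sup>2)"
  using Cauchy_Schwarz_ineq_sum[of "\<lambda>_. 1" a "{..<p}"] by simp

text \<open>Cauchy-Schwarz over the pieces costs a factor \<open>Suc n\<close>, and the trace
  estimate on each piece gains \<open>1 / Suc n\<close>. These cancel exactly, and the masses of
  \<open>g\<close> on the disjoint pieces add up to its mass on the unit annulus.\<close>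

lemma annuli_square_sum_bound:
  obtains C where "0 \<le> C"
    "\<And>(g :: 'a::euclidean_space \<Rightarrow> complex) n a. g \<in> borel_measurable borel \<Longrightarrow> (\<integral>\<^sup>+x. ennreal ((cmod (g x))\<^sup>2) \<partial>lborel) < \<infinity> \<Longrightarrow>
      (\<integral>\<^sup>+x\<in>cball 0 r. ennreal (annuli_square_sum g n a x) \<partial>lborel)
        \<le> ennreal C * (\<integral>\<^sup>+x\<in>annulus a (a + 1). ennreal ((cmod (g x))\<^sup>2) \<partial>lborel)"
proof -
  obtain C where C: "0 \<le> C" "\<And>a b (h :: 'a \<Rightarrow> complex). a \<le> b \<Longrightarrow> integrable lborel h \<Longrightarrow> (\<And>x. x \<notin> annulus a b \<Longrightarrow> h x = 0) \<Longrightarrow>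
       (\<integral>\<^sup>+\<xi>\<in>cball 0 r. ennreal ((cmod (fint h \<xi>))\<^sup>2) \<partial>lborel)
         \<le> ennreal (C * (b - a)) * (\<integral>\<^sup>+x. ennreal ((cmod (h x))\<^sup>2) \<partial>lborel)"
    by (rule fint_annulus_bound[where r = r and 'a = 'a]) blast
  have "(\<integral>\<^sup>+x\<in>cball 0 r. ennreal (annuli_square_sum g n a x) \<partial>lborel)
        \<le> ennreal C * (\<integral>\<^sup>+x\<in>annulus a (a + 1). ennreal ((cmod (g x))\<^sup>2) \<partial>lborel)"
    if gm [measurable]: "g \<in> borel_measurable borel" and g: "(\<integral>\<^sup>+x. ennreal ((cmod (g x))\<^sup>2) \<partial>lborel) < \<infinity>"
    for g :: "'a \<Rightarrow> complex" and n a
  proof -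
    define p where "p = real (Suc n)"
    have p: "0 < p" by (simp add: p_def)
    define t where "t j = a + real j / p" for j :: nat
    have t: "t j \<le> t (Suc j)" "t (Suc j) - t j = 1 / p" for j
      using p by (auto simp: t_def divide_right_mono field_simps)
    let ?V = "\<lambda>j. fint_annulus g (t j) (t (Suc j))"
    let ?N = "\<lambda>j. \<integral>\<^sup>+x\<in>annulus (t j) (t (Suc j)). ennreal ((cmod (g x))\<^sup>2) \<partial>lborel"
    have [measurable]: "cball (0::'a) r \<in> sets borel" by simp
    have V: "(\<integral>\<^sup>+x\<in>cball 0 r. ennreal ((cmod (?V j x))\<^sup>2) \<partial>lborel) \<le> ennreal (C / p) * ?N j" for j
    proof -
      have "(\<integral>\<^sup>+x\<in>cball 0 r. ennreal ((cmod (?V j x))\<^sup>2) \<partial>lborel)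
        \<le> ennreal (C * (t (Suc j) - t j)) * (\<integral>\<^sup>+x. ennreal ((cmod (indicator (annulus (t j) (t (Suc j))) x *\<^sub>R g x))\<^sup>2) \<partial>lborel)"
        unfolding fint_annulus_def by (intro C(2) t integrable_annulus gm g) simp
      also have "(\<integral>\<^sup>+x. ennreal ((cmod (indicator (annulus (t j) (t (Suc j))) x *\<^sub>R g x))\<^sup>2) \<partial>lborel) = ?N j"
        by (intro nn_integral_cong) (auto simp: indicator_def)
      finally show ?thesis by (simp add: t)
    qed
    have "(\<integral>\<^sup>+x\<in>cball 0 r. ennreal (annuli_square_sum g n a x) \<partial>lborel)
      \<le> (\<integral>\<^sup>+x. ennreal p * (\<Sum>j<Suc n. ennreal ((cmod (?V j x))\<^sup>2) * indicator (cball 0 r) x) \<partial>lborel)"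
    proof (rule nn_integral_mono)
      fix x :: 'a
      have "annuli_square_sum g n a x \<le> p * (\<Sum>j<Suc n. (cmod (?V j x))\<^sup>2)"
        unfolding annuli_square_sum_def[OF gm g] t_def p_def by (rule sum_power2_le)
      then have "ennreal (annuli_square_sum g n a x) \<le> ennreal p * (\<Sum>j<Suc n. ennreal ((cmod (?V j x))\<^sup>2))"
        using p by (subst sum_ennreal, simp, subst ennreal_mult[symmetric]) (auto intro!: ennreal_leI sum_nonneg simp del: sum.lessThan_Suc)
      then show "ennreal (annuli_square_sum g n a x) * indicator (cball 0 r) x \<le> ennreal p * (\<Sum>j<Suc n. ennreal ((cmod (?V j x))\<^sup>2) * indicator (cball 0 r) x)"
        by (cases "x \<in> cball 0 r") (simp only: indicator_simps mult_1_right, simp)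
    qed
    also have "\<dots> = ennreal p * (\<Sum>j<Suc n. \<integral>\<^sup>+x\<in>cball 0 r. ennreal ((cmod (?V j x))\<^sup>2) \<partial>lborel)"
    proof -
      have "(\<lambda>x. ennreal ((cmod (?V j x))\<^sup>2) * indicator (cball 0 r) x) \<in> borel_measurable lborel" for j
        by measurable
      then show ?thesis by (simp only: nn_integral_cmult nn_integral_sum borel_measurable_sum)
    qed
    also have "\<dots> \<le> ennreal p * (\<Sum>j<Suc n. ennreal (C / p) * ?N j)"
      by (intro mult_left_mono sum_mono V) auto
    also have "\<dots> = (ennreal p * ennreal (C / p)) * (\<Sum>j<Suc n. ?N j)"
      by (simp only: sum_distrib_left mult.assoc)
    also have "ennreal p * ennreal (C / p) = ennreal C"
      using p C(1) by (subst ennreal_mult[symmetric]) auto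
    also have "(\<Sum>j<Suc n. ?N j) = (\<integral>\<^sup>+x\<in>annulus (t 0) (t (Suc n)). ennreal ((cmod (g x))\<^sup>2) \<partial>lborel)"
      by (rule nn_integral_annuli_sum) (measurable, rule t)
    also have "t 0 = a" by (simp add: t_def)
    also have "t (Suc n) = a + 1" using p by (simp add: t_def p_def)
    finally show ?thesis .
  qed
  with C(1) show ?thesis by (rule that)
qed

section \<open>Summation over the integer radii\<close>

lemma inverse_square_sum_bound:
  obtains S where "0 \<le> S" "\<And>\<rho>::real. 0 \<le> \<rho> \<Longrightarrow> (\<Sum>k::nat. ennreal (1 / (1 + (\<rho> - real k)\<^sup>2))) \<le> ennreal S"
proof -
  define s where "s i = 1 / (1 + (real i)\<^sup>2)" for i :: nat
  have s0: "0 \<le> s i" for i by (simp add: s_def)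
  have "summable (\<lambda>i. inverse (real i ^ 2))" by (rule inverse_power_summable) simp
  then have sm: "summable s"
  proof (rule summable_comparison_test'[where N = 1])
    fix i :: nat assume "1 \<le> i"
    then show "norm (s i) \<le> inverse (real i ^ 2)"
      by (simp add: s_def inverse_eq_divide frac_le)
  qed
  have le: "(\<Sum>k\<in>A. s (h k)) \<le> suminf s" if "finite A" "inj_on h A" for A and h :: "nat \<Rightarrow> nat"
  proof -
    have "(\<Sum>k\<in>A. s (h k)) = (\<Sum>i\<in>h ` A. s i)" using that by (simp add: sum.reindex)
    also have "\<dots> \<le> suminf s" using that by (intro sum_le_suminf sm) (auto simp: s0)
    finally show ?thesis .
  qed
  have "0 \<le> 2 * suminf s" using suminf_nonneg[OF sm s0] by simp
  moreover have "(\<Sum>k::nat. ennreal (1 / (1 + (\<rho> - real k)\<^sup>2))) \<le> ennreal (2 * suminf s)" if \<rho>: "0 \<le> \<rho>" for \<rho> :: real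
  proof (rule suminf_le_const)
    \<comment> \<open>On either side of \<rho> the distances to the integers dominate distinct
      natural numbers, so each side is bounded by the full series \<open>suminf s\<close>; hence the
      constant \<open>2 * suminf s\<close>.\<close>
    define j where "j = nat \<lfloor>\<rho>\<rfloor>"
    have j: "real j \<le> \<rho>" "\<rho> \<le> real j + 1" using \<rho> unfolding j_def by linarith+
    let ?f = "\<lambda>k. 1 / (1 + (\<rho> - real k)\<^sup>2)"
    have f1: "?f k \<le> s (j - k)" if "k \<le> j" for k
      unfolding s_def using that j by (intro frac_le add_left_mono power_mono) (auto intro!: add_pos_nonneg)
    have f2: "?f k \<le> s (k - Suc j)" if "\<not> k \<le> j" for k
    proof -
      have "(real (k - Suc j))\<^sup>2 \<le> (real k - \<rho>)\<^sup>2"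
        using that j by (intro power_mono) (auto simp: of_nat_diff)
      then show ?thesis
        unfolding s_def power2_commute[of \<rho>] by (intro frac_le add_left_mono) (auto intro!: add_pos_nonneg)
    qed
    fix n
    have "(\<Sum>k<n. ?f k) = (\<Sum>k\<in>{..<n} \<inter> {..j}. ?f k) + (\<Sum>k\<in>{..<n} \<inter> - {..j}. ?f k)"
      by (subst sum.union_disjoint[symmetric]) (auto intro!: sum.cong)
    also have "\<dots> \<le> (\<Sum>k\<in>{..<n} \<inter> {..j}. s (j - k)) + (\<Sum>k\<in>{..<n} \<inter> - {..j}. s (k - Suc j))"
      by (intro add_mono sum_mono f1 f2) auto
    also have "\<dots> \<le> suminf s + suminf s"
      by (intro add_mono le) (auto simp: inj_on_def)
    finally have "(\<Sum>k<n. ?f k) \<le> 2 * suminf s" by simp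
    then show "(\<Sum>k<n. ennreal (?f k)) \<le> ennreal (2 * suminf s)"
      by (subst sum_ennreal) (auto intro!: ennreal_leI)
  qed simp
  ultimately show ?thesis by (rule that)
qed

text \<open>A measurable majorant \<open>Y\<close> stands in for the supremum over \<open>R\<close>,
  which spares a discussion of its measurability. \<open>Y\<close> sums, over all integers
  \<open>k\<close>, the square at radius \<open>k\<close> and the squared variation over the next
  unit interval; the single term with k the integer part of \<open>R\<close> already dominates.
  Summing instead of maximising is affordable because both series are controlled by the norm of
  \<open>g\<close>.\<close>

lemma maximal_bound:
  fixes r \<rho> :: real
  assumes r: "r < \<rho>"
  obtains C where "0 \<le> C"
    "\<And>f g :: 'a::euclidean_space \<Rightarrow> complex. \<lbrakk>f \<in> borel_measurable borel; g \<in> borel_measurable borel;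
       (\<integral>\<^sup>+x. ennreal ((cmod (f x))\<^sup>2) \<partial>lborel) < \<infinity>; \<And>y. norm y < \<rho> \<Longrightarrow> f y = 0;
       ((\<lambda>R. \<integral>\<^sup>+ \<xi>. ennreal ((cmod (g \<xi> - fourier_trunc f R \<xi>))\<^sup>2) \<partial>lborel) \<longlongrightarrow> 0) at_top\<rbrakk> \<Longrightarrow>
       \<exists>Y\<in>borel_measurable borel. (\<forall>x\<in>cball 0 r. \<forall>R\<ge>0. ennreal ((cmod (fint_annulus g 0 R x))\<^sup>2) \<le> Y x) \<and>
         (\<integral>\<^sup>+x\<in>cball 0 r. Y x \<partial>lborel) \<le> ennreal C * (\<integral>\<^sup>+x. ennreal ((cmod (f x))\<^sup>2) \<partial>lborel)"
proof -
  \<comment> \<open>Then \<open>3 * \<epsilon>\<close> is the gap between the ball of radius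
    \<open>r\<close> and the region where \<open>f\<close> may be nonzero, the distance beyond which
    the transforms of the smoothed indicators vanish.\<close>
  define \<epsilon> where "\<epsilon> = (\<rho> - r) / 3"
  have \<epsilon>3: "3 * \<epsilon> = \<rho> - r" by (simp add: \<epsilon>_def)
  have \<epsilon>: "0 < \<epsilon>" using r by (simp add: \<epsilon>_def)
  obtain M :: "real \<Rightarrow> 'a \<Rightarrow> real" and B where B: "0 \<le> B"
    and [measurable]: "\<And>R. M R \<in> borel_measurable borel" and Mi: "\<And>R. integrable lborel (M R)"
    and M0: "\<And>R \<xi>. 0 \<le> M R \<xi>" and M1: "\<And>R \<xi>. M R \<xi> \<le> 1"
    and MB: "\<And>R \<xi>. \<bar>indicator (ball 0 R) \<xi> - M R \<xi>\<bar> * (1 + (norm \<xi> - R)\<^sup>2) \<le> B"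
    and van: "\<And>R z. 3 * \<epsilon> \<le> norm z \<Longrightarrow> (LINT \<xi>|lborel. complex_of_real (M R \<xi>) * cis (z \<bullet> \<xi>)) = 0"
    by (rule smoothed_ball_indicators[OF \<epsilon>, where 'a = 'a]) blast
  obtain S where S: "0 \<le> S" "\<And>\<rho>::real. 0 \<le> \<rho> \<Longrightarrow> (\<Sum>k::nat. ennreal (1 / (1 + (\<rho> - real k)\<^sup>2))) \<le> ennreal S"
    by (rule inverse_square_sum_bound) blast
  obtain D where D: "0 \<le> D"
    "\<And>(g :: 'a \<Rightarrow> complex) n a. g \<in> borel_measurable borel \<Longrightarrow> (\<integral>\<^sup>+x. ennreal ((cmod (g x))\<^sup>2) \<partial>lborel) < \<infinity> \<Longrightarrow>
      (\<integral>\<^sup>+x\<in>cball 0 r. ennreal (annuli_square_sum g n a x) \<partial>lborel)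
        \<le> ennreal D * (\<integral>\<^sup>+x\<in>annulus a (a + 1). ennreal ((cmod (g x))\<^sup>2) \<partial>lborel)"
    by (rule annuli_square_sum_bound[where r = r and 'a = 'a]) blast
  define a where "a k \<xi> = indicator (ball 0 (real k)) \<xi> - M (real k) \<xi>" for k :: nat and \<xi>
  have [measurable]: "ball (0::'a) R \<in> sets borel" "cball (0::'a) R \<in> sets borel" for R by simp_all
  have [measurable]: "a k \<in> borel_measurable borel" for k unfolding a_def by measurable
  have a1: "\<bar>a k \<xi>\<bar> \<le> 1" for k \<xi>
    using M0[of "real k" \<xi>] M1[of "real k" \<xi>] by (auto simp: a_def indicator_def)
  have ai: "integrable lborel (a k)" for k
    unfolding a_def using emeasure_bounded_finite[OF bounded_ball, of "0::'a" "real k"]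
    by (intro Bochner_Integration.integrable_diff Mi integrable_real_indicator) (auto simp: top.not_eq_extremum)
  have a2i: "integrable lborel (\<lambda>\<xi>. (a k \<xi>)\<^sup>2)" for k
  proof (rule Bochner_Integration.integrable_bound[OF ai])
    have "(a k \<xi>)\<^sup>2 \<le> \<bar>a k \<xi>\<bar>" for \<xi>
      using mult_left_le[OF a1 abs_ge_zero, of "a k \<xi>" k \<xi>] by (simp add: power2_eq_square flip: abs_mult)
    then show "AE \<xi> in lborel. norm ((a k \<xi>)\<^sup>2) \<le> norm (a k \<xi>)" by simp
  qed measurable
  \<comment> \<open>At one frequency only radii near \<open>norm \<xi>\<close> matter: squaring the
    bound \<open>B / (1 + d^2)\<close>, with d the distance to the sphere, leaves more decay than
    needed, and one power suffices for a sum bounded uniformly in \<xi>.\<close>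
  have a2: "(\<Sum>k. ennreal ((a k \<xi>)\<^sup>2)) \<le> ennreal (B\<^sup>2 * S)" for \<xi>
  proof -
    have "(a k \<xi>)\<^sup>2 \<le> B\<^sup>2 * (1 / (1 + (norm \<xi> - real k)\<^sup>2))" for k
    proof -
      let ?w = "1 + (norm \<xi> - real k)\<^sup>2"
      have w: "1 \<le> ?w" by simp
      have "(\<bar>a k \<xi>\<bar> * ?w)\<^sup>2 \<le> B\<^sup>2"
        using MB[of "real k" \<xi>] by (intro power_mono) (auto simp: a_def)
      moreover have "(a k \<xi>)\<^sup>2 * ?w * 1 \<le> (a k \<xi>)\<^sup>2 * ?w * ?w"
        using w by (intro mult_left_mono) auto
      ultimately have "(a k \<xi>)\<^sup>2 * ?w \<le> B\<^sup>2"
        by (simp only: power_mult_distrib power2_abs power2_eq_square[of ?w] mult_1_right mult.assoc)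
      moreover have "0 < ?w" using w by linarith
      ultimately show ?thesis by (simp add: pos_le_divide_eq)
    qed
    then have "(\<Sum>k. ennreal ((a k \<xi>)\<^sup>2)) \<le> (\<Sum>k. ennreal (B\<^sup>2) * ennreal (1 / (1 + (norm \<xi> - real k)\<^sup>2)))"
      by (intro suminf_le) (auto simp flip: ennreal_mult intro!: ennreal_leI)
    also have "\<dots> = ennreal (B\<^sup>2) * (\<Sum>k. ennreal (1 / (1 + (norm \<xi> - real k)\<^sup>2)))"
      by (rule ennreal_suminf_cmult)
    also have "\<dots> \<le> ennreal (B\<^sup>2) * ennreal S"
      by (intro mult_left_mono S) auto
    finally show ?thesis using S(1) by (simp add: ennreal_mult)
  qed
  \<comment> \<open>The first summand pays for the integer radii, the second for the intervals
    between them. The later factor 4 is a 2 from squaring a sum of two terms and a 2 from bounding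
    the norm of \<open>g\<close> by that of \<open>f\<close>.\<close>
  define A where "A = (2 * pi) ^ DIM('a) * (B\<^sup>2 * S) + D"
  have A: "0 \<le> A" using S(1) D(1) by (simp add: A_def)
  have "\<exists>Y\<in>borel_measurable borel. (\<forall>x\<in>cball 0 r. \<forall>R\<ge>0. ennreal ((cmod (fint_annulus g 0 R x))\<^sup>2) \<le> Y x) \<and>
         (\<integral>\<^sup>+x\<in>cball 0 r. Y x \<partial>lborel) \<le> ennreal (4 * A) * (\<integral>\<^sup>+x. ennreal ((cmod (f x))\<^sup>2) \<partial>lborel)"
    if fm [measurable]: "f \<in> borel_measurable borel" and gm [measurable]: "g \<in> borel_measurable borel"
      and f: "(\<integral>\<^sup>+x. ennreal ((cmod (f x))\<^sup>2) \<partial>lborel) < \<infinity>" and supp: "\<And>y. norm y < \<rho> \<Longrightarrow> f y = 0"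
      and lim: "((\<lambda>R. \<integral>\<^sup>+ \<xi>. ennreal ((cmod (g \<xi> - fourier_trunc f R \<xi>))\<^sup>2) \<partial>lborel) \<longlongrightarrow> 0) at_top"
    for f g :: "'a \<Rightarrow> complex"
  proof -
    let ?N = "\<integral>\<^sup>+x. ennreal ((cmod (f x))\<^sup>2) \<partial>lborel"
    let ?G = "\<integral>\<^sup>+x. ennreal ((cmod (g x))\<^sup>2) \<partial>lborel"
    have gf: "?G \<le> 2 * ?N" by (rule fourier_L2_norm_le[OF fm gm f lim])
    then have g: "?G < \<infinity>" using f by (auto intro!: le_less_trans[OF gf] simp: ennreal_mult_less_top)
    have agi: "integrable lborel (\<lambda>\<xi>. complex_of_real (a k \<xi>) * g \<xi>)" for k
      by (rule integrable_mult_L2[OF _ gm a2i g]) measurable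
    have Ma: "integrable lborel (\<lambda>\<xi>. complex_of_real (M (real k) \<xi>) * g \<xi>)" for k
    proof (rule integrable_mult_L2[OF _ gm _ g])
      show "integrable lborel (\<lambda>\<xi>. (M (real k) \<xi>)\<^sup>2)"
        by (rule Bochner_Integration.integrable_bound[OF Mi[of "real k"]])
           (use M0 M1 in \<open>auto simp: power2_eq_square mult_left_le\<close>)
    qed measurable
    have ball: "annulus 0 R = ball (0::'a) R" for R by (auto simp: annulus_def)
    \<comment> \<open>Here the vanishing of \<open>f\<close> enters: on the ball of radius
      \<open>r\<close> the smoothed multiplier contributes 0, so the sharp cutoff may be replaced by
      the difference \<open>a k\<close>.\<close>
    have Gk: "fint_annulus g 0 (real k) x = fint (\<lambda>\<xi>. complex_of_real (a k \<xi>) * g \<xi>) x" if x: "x \<in> cball 0 r" for k x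
    proof -
      have "(LINT \<xi>|lborel. complex_of_real (M (real k) \<xi>) * g \<xi> * cis (x \<bullet> \<xi>)) = 0"
        by (rule band_limited_multiplier_vanishes[where d = "3 * \<epsilon>", OF fm gm f g lim supp _ M0 M1 Mi van])
           (use x \<epsilon>3 in auto)
      then have "fint (\<lambda>\<xi>. complex_of_real (M (real k) \<xi>) * g \<xi>) x = 0"
        by (simp add: fint_def inner_commute)
      moreover have "fint (\<lambda>\<xi>. indicator (ball 0 (real k)) \<xi> *\<^sub>R g \<xi> - complex_of_real (M (real k) \<xi>) * g \<xi>) x
          = fint (\<lambda>\<xi>. indicator (ball 0 (real k)) \<xi> *\<^sub>R g \<xi>) x - fint (\<lambda>\<xi>. complex_of_real (M (real k) \<xi>) * g \<xi>) x"
        by (rule fint_diff[OF integrable_restrict_L2[OF gm _ g] Ma]) auto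
      moreover have "(\<lambda>\<xi>. complex_of_real (a k \<xi>) * g \<xi>) = (\<lambda>\<xi>. indicator (ball 0 (real k)) \<xi> *\<^sub>R g \<xi> - complex_of_real (M (real k) \<xi>) * g \<xi>)"
        by (auto simp: a_def scaleR_conv_of_real left_diff_distrib)
      ultimately show ?thesis by (simp add: fint_annulus_def ball)
    qed
    define H where "H k x = liminf (\<lambda>n. ennreal (annuli_square_sum g n (real k) x))" for k :: nat and x
    note [measurable] = measurable_annuli_square_sum[OF gm g]
    have [measurable]: "H k \<in> borel_measurable borel" for k unfolding H_def by measurable
    define P where "P k x = ennreal ((cmod (fint (\<lambda>\<xi>. complex_of_real (a k \<xi>) * g \<xi>) x))\<^sup>2)" for k x
    have [measurable]: "P k \<in> borel_measurable borel" for k unfolding P_def by measurable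
    define Y where "Y x = 2 * (\<Sum>k. P k x + H k x)" for x
    have pw: "ennreal ((cmod (fint_annulus g 0 R x))\<^sup>2) \<le> Y x" if x: "x \<in> cball 0 r" and R: "0 \<le> R" for x R
    proof -
      define k where "k = nat \<lfloor>R\<rfloor>"
      have k: "real k \<le> R" "R \<le> real k + 1" using R unfolding k_def by linarith+
      let ?p = "fint_annulus g 0 (real k) x" and ?q = "fint_annulus g (real k) R x"
      have s: "fint_annulus g 0 R x = ?p + ?q"
        by (rule fint_annulus_split[OF gm g]) (use k in auto)
      have "(cmod (?p + ?q))\<^sup>2 \<le> (cmod ?p + cmod ?q)\<^sup>2" by (intro power_mono norm_triangle_ineq) simp
      also have "\<dots> \<le> 2 * ((cmod ?p)\<^sup>2 + (cmod ?q)\<^sup>2)"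
        using sum_squares_bound[of "cmod ?p" "cmod ?q"] by (simp add: power2_sum)
      finally have "ennreal ((cmod (fint_annulus g 0 R x))\<^sup>2) \<le> ennreal (2 * ((cmod ?p)\<^sup>2 + (cmod ?q)\<^sup>2))"
        unfolding s by (rule ennreal_leI)
      also have "\<dots> = 2 * (ennreal ((cmod ?p)\<^sup>2) + ennreal ((cmod ?q)\<^sup>2))"
        by (simp add: ennreal_mult distrib_left)
      also have "\<dots> \<le> 2 * (P k x + H k x)"
        unfolding H_def using fint_annulus_le_liminf[OF gm g k(1) k(2), of x] Gk[OF x, of k]
        by (intro mult_left_mono add_mono) (auto simp: P_def)
      also have "\<dots> \<le> Y x"
        unfolding Y_def by (intro mult_left_mono ennreal_le_suminf[of "\<lambda>k. P k x + H k x"]) simp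
      finally show ?thesis .
    qed
    let ?I = "indicator (cball 0 r) :: 'a \<Rightarrow> ennreal"
    have Pb: "(\<integral>\<^sup>+x. P k x * ?I x \<partial>lborel) \<le> ennreal ((2 * pi) ^ DIM('a)) * (\<integral>\<^sup>+\<xi>. ennreal ((a k \<xi>)\<^sup>2) * ennreal ((cmod (g \<xi>))\<^sup>2) \<partial>lborel)" for k
    proof -
      have "(\<integral>\<^sup>+x. P k x * ?I x \<partial>lborel) \<le> (\<integral>\<^sup>+x. P k x \<partial>lborel)"
        by (intro nn_integral_mono) (auto split: split_indicator)
      also have "\<dots> \<le> ennreal ((2 * pi) ^ DIM('a)) * (\<integral>\<^sup>+\<xi>. ennreal ((cmod (complex_of_real (a k \<xi>) * g \<xi>))\<^sup>2) \<partial>lborel)"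
        unfolding P_def by (rule fint_bessel[OF agi])
      finally show ?thesis by (simp add: norm_mult power_mult_distrib ennreal_mult)
    qed
    have Hb: "(\<integral>\<^sup>+x. H k x * ?I x \<partial>lborel) \<le> ennreal D * (\<integral>\<^sup>+x\<in>annulus (real k) (real (Suc k)). ennreal ((cmod (g x))\<^sup>2) \<partial>lborel)" for k
    proof -
      have "(\<integral>\<^sup>+x. H k x * ?I x \<partial>lborel) = (\<integral>\<^sup>+x. liminf (\<lambda>n. ennreal (annuli_square_sum g n (real k) x) * ?I x) \<partial>lborel)"
        unfolding H_def by (intro nn_integral_cong) (auto split: split_indicator simp: Liminf_const)
      also have "\<dots> \<le> ennreal D * (\<integral>\<^sup>+x\<in>annulus (real k) (real k + 1). ennreal ((cmod (g x))\<^sup>2) \<partial>lborel)"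
        by (rule nn_integral_liminf_le[OF _ D(2)[OF gm g]]) measurable
      finally show ?thesis by (simp add: add.commute)
    qed
    \<comment> \<open>Bessel's inequality is applied for each \<open>k\<close> separately; the sum
      then moves inside the frequency integral and falls on the multipliers alone.\<close>
    have sP: "(\<Sum>k. \<integral>\<^sup>+x. P k x * ?I x \<partial>lborel) \<le> ennreal ((2 * pi) ^ DIM('a) * (B\<^sup>2 * S)) * ?G"
    proof -
      have "(\<Sum>k. \<integral>\<^sup>+x. P k x * ?I x \<partial>lborel)
         \<le> (\<Sum>k. ennreal ((2 * pi) ^ DIM('a)) * (\<integral>\<^sup>+\<xi>. ennreal ((a k \<xi>)\<^sup>2) * ennreal ((cmod (g \<xi>))\<^sup>2) \<partial>lborel))"
        by (intro suminf_le Pb) auto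
      also have "\<dots> = ennreal ((2 * pi) ^ DIM('a)) * (\<Sum>k. \<integral>\<^sup>+\<xi>. ennreal ((a k \<xi>)\<^sup>2) * ennreal ((cmod (g \<xi>))\<^sup>2) \<partial>lborel)"
        by (rule ennreal_suminf_cmult)
      also have "(\<Sum>k. \<integral>\<^sup>+\<xi>. ennreal ((a k \<xi>)\<^sup>2) * ennreal ((cmod (g \<xi>))\<^sup>2) \<partial>lborel)
          = (\<integral>\<^sup>+\<xi>. (\<Sum>k. ennreal ((a k \<xi>)\<^sup>2) * ennreal ((cmod (g \<xi>))\<^sup>2)) \<partial>lborel)"
        by (rule nn_integral_suminf[symmetric]) measurable
      also have "\<dots> \<le> (\<integral>\<^sup>+\<xi>. ennreal (B\<^sup>2 * S) * ennreal ((cmod (g \<xi>))\<^sup>2) \<partial>lborel)"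
        unfolding ennreal_suminf_multc by (intro nn_integral_mono mult_right_mono a2) simp
      also have "\<dots> = ennreal (B\<^sup>2 * S) * ?G" by (rule nn_integral_cmult) measurable
      finally have "(\<Sum>k. \<integral>\<^sup>+x. P k x * ?I x \<partial>lborel) \<le> ennreal ((2 * pi) ^ DIM('a)) * (ennreal (B\<^sup>2 * S) * ?G)"
        by (simp add: mult_left_mono)
      then show ?thesis using S(1) by (subst ennreal_mult) (simp_all add: mult.assoc)
    qed
    have sH: "(\<Sum>k. \<integral>\<^sup>+x. H k x * ?I x \<partial>lborel) \<le> ennreal D * ?G"
    proof -
      let ?A = "\<lambda>k. \<integral>\<^sup>+x\<in>annulus (real k) (real (Suc k)). ennreal ((cmod (g x))\<^sup>2) \<partial>lborel"
      have "(\<Sum>k. \<integral>\<^sup>+x. H k x * ?I x \<partial>lborel) \<le> (\<Sum>k. ennreal D * ?A k)"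
        by (intro suminf_le Hb) auto
      also have "\<dots> = ennreal D * (\<Sum>k. ?A k)" by (rule ennreal_suminf_cmult)
      also have "(\<Sum>k. ?A k) \<le> ?G"
      proof (rule suminf_le_const)
        fix n
        have "(\<Sum>k<n. ?A k) = (\<integral>\<^sup>+x\<in>annulus (real 0) (real n). ennreal ((cmod (g x))\<^sup>2) \<partial>lborel)"
          by (rule nn_integral_annuli_sum[where t = real]) auto
        also have "\<dots> \<le> ?G" by (intro nn_integral_mono) (auto split: split_indicator)
        finally show "(\<Sum>k<n. ?A k) \<le> ?G" .
      qed simp
      finally show ?thesis by (simp add: mult_left_mono)
    qed
    have "(\<integral>\<^sup>+x\<in>cball 0 r. Y x \<partial>lborel) = (\<integral>\<^sup>+x. 2 * (\<Sum>k. P k x * ?I x + H k x * ?I x) \<partial>lborel)"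
      unfolding Y_def by (intro nn_integral_cong) (auto split: split_indicator)
    also have "\<dots> = 2 * (\<integral>\<^sup>+x. (\<Sum>k. P k x * ?I x + H k x * ?I x) \<partial>lborel)"
      by (rule nn_integral_cmult) measurable
    also have "\<dots> = 2 * (\<Sum>k. \<integral>\<^sup>+x. P k x * ?I x + H k x * ?I x \<partial>lborel)"
      by (subst nn_integral_suminf) auto
    also have "\<dots> = 2 * (\<Sum>k. (\<integral>\<^sup>+x. P k x * ?I x \<partial>lborel) + (\<integral>\<^sup>+x. H k x * ?I x \<partial>lborel))"
      by (subst nn_integral_add) auto
    also have "\<dots> = 2 * ((\<Sum>k. \<integral>\<^sup>+x. P k x * ?I x \<partial>lborel) + (\<Sum>k. \<integral>\<^sup>+x. H k x * ?I x \<partial>lborel))"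
      by (subst suminf_add) auto
    also have "\<dots> \<le> 2 * (ennreal ((2 * pi) ^ DIM('a) * (B\<^sup>2 * S)) * ?G + ennreal D * ?G)"
      by (intro mult_left_mono add_mono sP sH) simp
    also have "\<dots> = 2 * (ennreal A * ?G)"
      unfolding A_def using S(1) D(1) by (subst ennreal_plus) (auto simp: distrib_right)
    also have "\<dots> \<le> 2 * (ennreal A * (2 * ?N))"
      by (intro mult_left_mono gf) auto
    also have "\<dots> = ennreal (4 * A) * ?N"
      using A by (simp add: ennreal_mult mult_ac)
    finally have "(\<integral>\<^sup>+x\<in>cball 0 r. Y x \<partial>lborel) \<le> ennreal (4 * A) * ?N" .
    moreover have "Y \<in> borel_measurable borel" unfolding Y_def by measurable
    ultimately show ?thesis using pw by blast
  qed
  moreover have "0 \<le> 4 * A" using A by simp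
  ultimately show ?thesis using that by blast
qed

section \<open>Passage from Lebesgue measurable functions to Borel representatives\<close>

lemma lebesgue_measurable_AE_borel:
  fixes f :: "'a::euclidean_space \<Rightarrow> complex"
  assumes [measurable]: "f \<in> borel_measurable lebesgue"
  obtains f' where "f' \<in> borel_measurable borel" "AE x in lborel. f x = f' x"
proof -
  have "(\<lambda>x. Re (f x)) \<in> borel_measurable (completion lborel)" by measurable
  from completion_ex_borel_measurable_real[OF this] obtain u where
    [measurable]: "u \<in> borel_measurable lborel" and u: "AE x in lborel. Re (f x) = u x" by blast
  have "(\<lambda>x. Im (f x)) \<in> borel_measurable (completion lborel)" by measurable
  from completion_ex_borel_measurable_real[OF this] obtain v where
    [measurable]: "v \<in> borel_measurable lborel" and v: "AE x in lborel. Im (f x) = v x" by blast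
  show ?thesis
  proof (rule that[of "\<lambda>x. complex_of_real (u x) + \<i> * complex_of_real (v x)"])
    have "(\<lambda>x. complex_of_real (u x) + \<i> * complex_of_real (v x)) \<in> borel_measurable lborel" by measurable
    then show "(\<lambda>x. complex_of_real (u x) + \<i> * complex_of_real (v x)) \<in> borel_measurable borel" by simp
    show "AE x in lborel. f x = complex_of_real (u x) + \<i> * complex_of_real (v x)"
      using u v by eventually_elim (simp add: complex_eq_iff)
  qed
qed

lemma lebesgue_integral_AE_cong:
  fixes f f' h :: "'a::euclidean_space \<Rightarrow> complex"
  assumes [measurable]: "f \<in> borel_measurable lebesgue" "f' \<in> borel_measurable borel" "h \<in> borel_measurable borel" "A \<in> sets borel"
    and ae: "AE x in lborel. f x = f' x"
  shows "(LINT x:A|lebesgue. f x * h x) = (LINT x|lborel. indicator A x *\<^sub>R f' x * h x)"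
proof -
  have b: "(LINT x|lebesgue. indicator A x *\<^sub>R f' x * h x) = (LINT x|lborel. indicator A x *\<^sub>R f' x * h x)"
    by (rule integral_completion) measurable
  have [measurable]: "(\<lambda>x. x) \<in> borel_measurable lebesgue" "A \<in> sets lebesgue"
    by (auto intro!: measurable_completion)
  have ae': "AE x in lebesgue. f x = f' x" by (rule AE_completion[OF ae])
  have "(LINT x|lebesgue. indicator A x *\<^sub>R (f x * h x)) = (LINT x|lebesgue. indicator A x *\<^sub>R f' x * h x)"
  proof (rule integral_cong_AE)
    show "AE x in lebesgue. indicator A x *\<^sub>R (f x * h x) = indicator A x *\<^sub>R f' x * h x"
      using ae' by eventually_elim simp
  qed measurable
  then show ?thesis unfolding set_lebesgue_integral_def b .
qed

lemma ennreal_SUP_power2_le: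
  assumes "\<And>i. i \<in> I \<Longrightarrow> ennreal ((u i)\<^sup>2) \<le> B" and "\<And>i. i \<in> I \<Longrightarrow> 0 \<le> u i"
  shows "(SUP i\<in>I. ennreal (u i))\<^sup>2 \<le> B"
proof (cases B)
  case (real b)
  have "ennreal (u i) \<le> ennreal (sqrt b)" if "i \<in> I" for i
    using assms(1)[OF that] real by (intro ennreal_leI) (simp add: real_le_rsqrt)
  then have "(SUP i\<in>I. ennreal (u i)) \<le> ennreal (sqrt b)" by (rule SUP_least)
  then have "(SUP i\<in>I. ennreal (u i))\<^sup>2 \<le> (ennreal (sqrt b))\<^sup>2" by (rule power_mono) simp
  then show ?thesis using real by (simp add: ennreal_power)
qed simp

theorem theorem1p2:
  fixes m :: nat and r :: real
  assumes "m \<ge> 1" and "r < 3"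
  shows "\<exists>c::real. \<forall>f :: 'a::euclidean_space \<Rightarrow> complex.
           f \<in> L2 \<and> (AE x in lebesgue. norm x < 3 \<longrightarrow> f x = 0) \<longrightarrow>
           (\<integral>\<^sup>+ x \<in> cball 0 r. (spectral_max m f x)\<^sup>2 \<partial>lebesgue)
             \<le> ennreal c * (\<integral>\<^sup>+ x \<in> {x. norm x \<ge> 3}. ennreal ((cmod (f x))\<^sup>2) \<partial>lebesgue)"
proof -
  obtain C where C: "0 \<le> C"
    and max: "\<And>f g :: 'a::euclidean_space \<Rightarrow> complex. \<lbrakk>f \<in> borel_measurable borel; g \<in> borel_measurable borel;
       (\<integral>\<^sup>+x. ennreal ((cmod (f x))\<^sup>2) \<partial>lborel) < \<infinity>; \<And>y. norm y < 3 \<Longrightarrow> f y = 0;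
       ((\<lambda>R. \<integral>\<^sup>+ \<xi>. ennreal ((cmod (g \<xi> - fourier_trunc f R \<xi>))\<^sup>2) \<partial>lborel) \<longlongrightarrow> 0) at_top\<rbrakk> \<Longrightarrow>
       \<exists>Y\<in>borel_measurable borel. (\<forall>x\<in>cball 0 r. \<forall>R\<ge>0. ennreal ((cmod (fint_annulus g 0 R x))\<^sup>2) \<le> Y x) \<and>
         (\<integral>\<^sup>+x\<in>cball 0 r. Y x \<partial>lborel) \<le> ennreal C * (\<integral>\<^sup>+x. ennreal ((cmod (f x))\<^sup>2) \<partial>lborel)"
    by (rule maximal_bound[OF assms(2), where 'a = 'a]) blast
  define c where "c = fnorm_const TYPE('a)"
  show ?thesis
  proof (intro exI[of _ "c\<^sup>2 * C"] allI impI, elim conjE)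
    fix f :: "'a \<Rightarrow> complex"
    assume fL2: "f \<in> L2" and f3: "AE x in lebesgue. norm x < 3 \<longrightarrow> f x = 0"
    have [measurable]: "f \<in> borel_measurable lebesgue" and fi: "integrable lebesgue (\<lambda>x. (cmod (f x))\<^sup>2)"
      using fL2 by (auto simp: L2_def)
    have [measurable]: "ball (0::'a) R \<in> sets borel" "- ball (0::'a) R \<in> sets borel"
      "cball (0::'a) R \<in> sets borel" for R by simp_all
    obtain f1 where [measurable]: "f1 \<in> borel_measurable borel" and f1: "AE x in lborel. f x = f1 x"
      using lebesgue_measurable_AE_borel[of f] by auto
    \<comment> \<open>Besides being Borel, the representative is forced to vanish at every point
      with \<open>norm x < 3\<close>, turning the almost-everywhere hypothesis into the pointwise
      one of the maximal bound.\<close>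
    define f0 where "f0 x = indicator (- ball 0 3) x *\<^sub>R f1 x" for x
    have f0m [measurable]: "f0 \<in> borel_measurable borel" unfolding f0_def by measurable
    have f0z: "f0 y = 0" if "norm y < 3" for y using that by (simp add: f0_def)
    have f3': "AE x in lborel. norm x < 3 \<longrightarrow> f x = 0"
      using f3 by (simp add: AE_completion_iff)
    have f0: "AE x in lborel. f x = f0 x"
      using f1 f3' by eventually_elim (auto simp: f0_def indicator_def)
    have f0n: "(\<integral>\<^sup>+x. ennreal ((cmod (f0 x))\<^sup>2) \<partial>lborel) = (\<integral>\<^sup>+ x \<in> {x. norm x \<ge> 3}. ennreal ((cmod (f x))\<^sup>2) \<partial>lebesgue)"
      unfolding nn_integral_completion
      by (rule nn_integral_cong_AE) (use f0 in eventually_elim, auto simp: indicator_def f0z not_le)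
    have "(\<integral>\<^sup>+x. ennreal ((cmod (f0 x))\<^sup>2) \<partial>lborel) = (\<integral>\<^sup>+x. ennreal ((cmod (f x))\<^sup>2) \<partial>lebesgue)"
      unfolding nn_integral_completion by (rule nn_integral_cong_AE) (use f0 in eventually_elim, simp)
    also have "\<dots> < \<infinity>" using fi by (simp add: integrable_iff_bounded)
    finally have f0f: "(\<integral>\<^sup>+x. ennreal ((cmod (f0 x))\<^sup>2) \<partial>lborel) < \<infinity>" .
    \<comment> \<open>Truncated transforms are integrals, so changing \<open>f\<close> on a null set
      leaves them equal everywhere. The two functions therefore have the same L2 transforms, and
      existence carries over to \<open>f\<close>.\<close>
    have tr: "fourier_trunc f = fourier_trunc f0"
    proof (intro ext)
      fix R \<xi>
      show "fourier_trunc f R \<xi> = fourier_trunc f0 R \<xi>"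
        unfolding fourier_trunc_fint[OF f0m] unfolding fourier_trunc_def fint_def
        by (subst lebesgue_integral_AE_cong[OF _ f0m _ _ f0]) auto
    qed
    define g where "g = fourier_L2 f"
    have "is_fourier_L2 f = is_fourier_L2 f0"
      by (intro ext) (simp add: is_fourier_L2_def tr)
    then have "\<exists>g. is_fourier_L2 f g"
      using is_fourier_L2_exists[OF f0m f0f] by simp
    then have gf: "is_fourier_L2 f g"
      unfolding g_def fourier_L2_def by (rule someI_ex)
    have [measurable]: "g \<in> borel_measurable lebesgue"
      using gf by (simp add: is_fourier_L2_def L2_def)
    obtain g0 where g0m [measurable]: "g0 \<in> borel_measurable borel" and g0: "AE x in lborel. g x = g0 x"
      using lebesgue_measurable_AE_borel[of g] by auto
    have "(\<integral>\<^sup>+ \<xi>. ennreal ((cmod (g \<xi> - fourier_trunc f R \<xi>))\<^sup>2) \<partial>lebesgue) = (\<integral>\<^sup>+ \<xi>. ennreal ((cmod (g0 \<xi> - fourier_trunc f0 R \<xi>))\<^sup>2) \<partial>lborel)" for R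
      unfolding nn_integral_completion by (rule nn_integral_cong_AE) (use g0 in eventually_elim, simp add: tr)
    then have lim: "((\<lambda>R. \<integral>\<^sup>+ \<xi>. ennreal ((cmod (g0 \<xi> - fourier_trunc f0 R \<xi>))\<^sup>2) \<partial>lborel) \<longlongrightarrow> 0) at_top"
      using gf by (simp add: is_fourier_L2_def)
    obtain Y where [measurable]: "Y \<in> borel_measurable borel"
      and Y: "\<And>x R. x \<in> cball 0 r \<Longrightarrow> 0 \<le> R \<Longrightarrow> ennreal ((cmod (fint_annulus g0 0 R x))\<^sup>2) \<le> Y x"
      and Yi: "(\<integral>\<^sup>+x\<in>cball 0 r. Y x \<partial>lborel) \<le> ennreal C * (\<integral>\<^sup>+x. ennreal ((cmod (f0 x))\<^sup>2) \<partial>lborel)"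
      using max[OF f0m g0m f0f f0z lim] by blast
    have sp: "spectral_exp m lam f x = complex_of_real c * fint_annulus g0 0 (root (2 * m) lam) x" if lam: "0 < lam" for lam x
    proof -
      have m: "0 < 2 * m" using assms(1) by simp
      \<comment> \<open>The order of the operator enters only through this change of parameter from
        \<lambda> to the radius of the frequency ball.\<close>
      define R where "R = root (2 * m) lam"
      have R: "R ^ (2 * m) = lam" "0 \<le> R" using lam m by (simp_all add: R_def)
      have "norm \<xi> ^ (2 * m) < lam \<longleftrightarrow> norm \<xi> < R" for \<xi> :: 'a
        using power_less_imp_less_base[of "norm \<xi>" "2 * m" R] power_strict_mono[of "norm \<xi>" R "2 * m"] R m by auto
      then have A: "{\<xi>::'a. norm \<xi> ^ (2 * m) < lam} = annulus 0 R"
        by (auto simp: annulus_def)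
      show ?thesis
        unfolding spectral_exp_def A R_def[symmetric] g_def[symmetric] c_def fint_annulus_def fint_def
        by (subst lebesgue_integral_AE_cong[OF _ g0m _ _ g0]) (auto simp: inner_commute)
    qed
    have pt: "(spectral_max m f x)\<^sup>2 \<le> ennreal (c\<^sup>2) * Y x" if x: "x \<in> cball 0 r" for x
      unfolding spectral_max_def
    proof (rule ennreal_SUP_power2_le)
      fix lam :: real assume lam: "lam \<in> {0<..}"
      have "ennreal ((cmod (spectral_exp m lam f x))\<^sup>2) = ennreal (c\<^sup>2) * ennreal ((cmod (fint_annulus g0 0 (root (2 * m) lam) x))\<^sup>2)"
        using lam by (simp add: sp norm_mult power_mult_distrib ennreal_mult)
      also have "\<dots> \<le> ennreal (c\<^sup>2) * Y x"
        using lam by (intro mult_left_mono Y x) (auto intro!: real_root_ge_zero)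
      finally show "ennreal ((cmod (spectral_exp m lam f x))\<^sup>2) \<le> ennreal (c\<^sup>2) * Y x" .
    qed simp
    \<comment> \<open>The maximal function is compared only pointwise with \<open>Y\<close>; the
      factor \<open>c^2\<close> is the square of the normalising constant in the spectral
      expansion.\<close>
    have "(\<integral>\<^sup>+ x \<in> cball 0 r. (spectral_max m f x)\<^sup>2 \<partial>lebesgue) \<le> (\<integral>\<^sup>+ x. ennreal (c\<^sup>2) * (Y x * indicator (cball 0 r) x) \<partial>lborel)"
      unfolding nn_integral_completion
      by (intro nn_integral_mono) (use pt in \<open>auto split: split_indicator\<close>)
    also have "\<dots> = ennreal (c\<^sup>2) * (\<integral>\<^sup>+x\<in>cball 0 r. Y x \<partial>lborel)"
      by (rule nn_integral_cmult) measurable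
    also have "\<dots> \<le> ennreal (c\<^sup>2) * (ennreal C * (\<integral>\<^sup>+x. ennreal ((cmod (f0 x))\<^sup>2) \<partial>lborel))"
      by (intro mult_left_mono Yi) simp
    also have "\<dots> = ennreal (c\<^sup>2 * C) * (\<integral>\<^sup>+ x \<in> {x. norm x \<ge> 3}. ennreal ((cmod (f x))\<^sup>2) \<partial>lebesgue)"
      unfolding f0n using C by (simp add: ennreal_mult mult.assoc)
    finally show "(\<integral>\<^sup>+ x \<in> cball 0 r. (spectral_max m f x)\<^sup>2 \<partial>lebesgue)
        \<le> ennreal (c\<^sup>2 * C) * (\<integral>\<^sup>+ x \<in> {x. norm x \<ge> 3}. ennreal ((cmod (f x))\<^sup>2) \<partial>lebesgue)" .
  qed
qed

end
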